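(* Let $F$ and $G$ be finite simple graphs such that $(F,G)$ is a forcing pair. Then: (i) the pair consisting of the $K_3$-subdivision of $F$ and the $K_3$-subdivision of $G$ is a forcing pair; (ii) for every integer $k\ge 2$, the pair consisting of the $P_k$-subdivision of $F$ and the $P_k$-subdivision of $G$ is a forcing pair.
   Context: All graphs are finite and simple; $V_G$, $E_G$ denote vertex and edge sets and $e_G=|E_G|$. For graphs $G,H$, $t(G,H)$ is the probability that a uniformly random map $\phi:V_G\to V_H$ is a graph homomorphism, i.e. $\{\phi(u),\phi(v)\}\in E_H$ for every $\{u,v\}\in E_G$. A sequence of graphs $(H_n)_{n\in\mathbb N}$ of increasing order (number of vertices) is $p$-quasi-random if $t(J,H_n)=(1+o(1))\,p^{e_J}$ for every graph $J$. A pair $(F,G)$ of graphs is a forcing pair if for every $p$ with $0\le p\le 1$, every sequence of graphs $(H_n)_{n\in\mathbb N}$ of increasing order satisfying $t(F,H_n)=(1+o(1))\,p^{e_F}$ and $t(G,H_n)=(1+o(1))\,p^{e_G}$ is $p$-quasi-random. The $K_3$-subdivision of a graph $G$ is obtained by replacing each edge $\{u,v\}$ with a triangle on $u$, $v$ and a new vertex $w_{uv}$ (so the edge $\{u,v\}$ is kept and the edges $\{u,w_{uv}\}$, $\{v,w_{uv}\}$ are added; the new vertices are distinct for distinct edges). $P_k$ is the path with $k$ edges, and the $P_k$-subdivision of $G$ is obtained by replacing each edge $\{u,v\}$ with a path with $k$ edges from $u$ to $v$ whose $k-1$ internal vertices are new (distinct for distinct edges).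
   Formalization: In part (i) the forcing property is proved for 0 < p ≤ 1 only; p = 0 is left out because it fails there: (K_2, C_4) is a forcing pair, but complete bipartite graphs contain no triangle, so the K_3-subdivisions do not force at p = 0. *)

theory Defs
  imports "HOL-Library.FuncSet" "HOL-Library.Landau_Symbols"
begin

record 'a sgraph =
  verts :: "'a set"
  edges :: "'a set set"

definition simple_graph :: "'a sgraph \<Rightarrow> bool" where
  "simple_graph G \<longleftrightarrow> finite (verts G) \<and> (\<forall>e\<in>edges G. e \<subseteq> verts G \<and> card e = 2)"

definition graph_homs :: "'a sgraph \<Rightarrow> 'b sgraph \<Rightarrow> ('a \<Rightarrow> 'b) set" where
  "graph_homs G H =
     {\<phi> \<in> verts G \<rightarrow>\<^sub>E verts H. \<forall>u v. {u, v} \<in> edges G \<longrightarrow> {\<phi> u, \<phi> v} \<in> edges H}"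

definition hom_density :: "'a sgraph \<Rightarrow> 'b sgraph \<Rightarrow> real" where
  "hom_density G H = real (card (graph_homs G H)) / real (card (verts G \<rightarrow>\<^sub>E verts H))"

definition increasing_order :: "(nat \<Rightarrow> 'a sgraph) \<Rightarrow> bool" where
  "increasing_order H \<longleftrightarrow> strict_mono (\<lambda>n. card (verts (H n)))"

text \<open>
  A relation \<open>x\<^sub>n = (1 + o(1)) c\<close> is expressed by the library's asymptotic equivalence; for
  \<open>c = 0\<close> it says that \<open>x\<^sub>n = 0\<close> for all large \<open>n\<close>. Every finite graph is isomorphic to one
  with vertices in \<open>nat\<close>, so that type is used wherever all graphs are quantified over.
\<close>

definition has_density :: "real \<Rightarrow> (nat \<Rightarrow> nat sgraph) \<Rightarrow> 'a sgraph \<Rightarrow> bool" where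
  "has_density p H J \<longleftrightarrow>
     (\<lambda>n. hom_density J (H n)) \<sim>[sequentially] (\<lambda>_. p ^ card (edges J))"

definition quasi_random :: "real \<Rightarrow> (nat \<Rightarrow> nat sgraph) \<Rightarrow> bool" where
  "quasi_random p H \<longleftrightarrow> (\<forall>J :: nat sgraph. simple_graph J \<longrightarrow> has_density p H J)"

definition forces_at :: "real \<Rightarrow> 'a sgraph \<Rightarrow> 'b sgraph \<Rightarrow> bool" where
  "forces_at p F G \<longleftrightarrow>
     (\<forall>H :: nat \<Rightarrow> nat sgraph.
        (\<forall>n. simple_graph (H n)) \<and> increasing_order H \<and> has_density p H F \<and> has_density p H G
        \<longrightarrow> quasi_random p H)"

definition forcing_pair :: "'a sgraph \<Rightarrow> 'b sgraph \<Rightarrow> bool" where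
  "forcing_pair F G \<longleftrightarrow> (\<forall>p. 0 \<le> p \<and> p \<le> 1 \<longrightarrow> forces_at p F G)"

text \<open>The new vertex on the edge \<open>e\<close> is \<open>Inr e\<close>.\<close>

definition K3_subdivision :: "'a sgraph \<Rightarrow> ('a + 'a set) sgraph" where
  "K3_subdivision G =
     \<lparr>verts = Inl ` verts G \<union> Inr ` edges G,
      edges = (`) Inl ` edges G \<union> {{Inl u, Inr e} | u e. e \<in> edges G \<and> u \<in> e}\<rparr>"

text \<open>
  The vertex at distance \<open>i\<close> from \<open>u\<close> on the path with \<open>k\<close> edges that replaces \<open>{u, v}\<close>.
  An internal vertex is named by its distances from both ends, which makes the name independent
  of the direction in which the path is traversed.
\<close>

definition path_vertex :: "nat \<Rightarrow> 'a \<Rightarrow> 'a \<Rightarrow> nat \<Rightarrow> 'a + ('a \<times> nat) set" where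
  "path_vertex k u v i =
     (if i = 0 then Inl u else if i = k then Inl v else Inr {(u, i), (v, k - i)})"

definition path_subdivision :: "nat \<Rightarrow> 'a sgraph \<Rightarrow> ('a + ('a \<times> nat) set) sgraph" where
  "path_subdivision k G =
     \<lparr>verts = Inl ` verts G \<union> {path_vertex k u v i | u v i. {u, v} \<in> edges G \<and> 0 < i \<and> i < k},
      edges = {{path_vertex k u v i, path_vertex k u v (Suc i)} | u v i. {u, v} \<in> edges G \<and> i < k}\<rparr>"

lemma path_vertex_reverse:
  assumes "i \<le> k" "0 < k"
  shows "path_vertex k v u (k - i) = path_vertex k u v i"
  using assms by (auto simp: path_vertex_def)

lemma edge_endpoints:
  assumes "simple_graph G" "{u, v} \<in> edges G"
  shows "u \<noteq> v" "u \<in> verts G" "v \<in> verts G"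
proof -
  have "card {u, v} = 2" "{u, v} \<subseteq> verts G"
    using assms unfolding simple_graph_def by blast+
  then show "u \<noteq> v" "u \<in> verts G" "v \<in> verts G" by auto
qed

lemma finite_edges: "simple_graph G \<Longrightarrow> finite (edges G)"
  unfolding simple_graph_def by (rule finite_subset[of _ "Pow (verts G)"]) auto

lemma simple_graph_K3_subdivision:
  assumes "simple_graph G"
  shows "simple_graph (K3_subdivision G)"
  using assms finite_edges[OF assms]
  unfolding simple_graph_def K3_subdivision_def
  by (auto simp: card_image)

lemma simple_graph_path_subdivision:
  assumes G: "simple_graph G" and k: "2 \<le> k"
  shows "simple_graph (path_subdivision k G)"
proof -
  let ?I = "{path_vertex k u v i | u v i. {u, v} \<in> edges G \<and> 0 < i \<and> i < k}"
  have "?I \<subseteq> (\<lambda>(u, v, i). path_vertex k u v i) ` (verts G \<times> verts G \<times> {..<k})"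
    using edge_endpoints[OF G] by force
  moreover have "finite (verts G)"
    using G by (simp add: simple_graph_def)
  ultimately have fin: "finite ?I"
    by (meson finite_SigmaI finite_imageI finite_lessThan finite_subset)
  have mem: "path_vertex k u v i \<in> Inl ` verts G \<union> ?I"
    if "{u, v} \<in> edges G" "i \<le> k" for u v i
  proof (cases "i = 0 \<or> i = k")
    case True
    then show ?thesis using edge_endpoints[OF G that(1)] k by (auto simp: path_vertex_def)
  next
    case False
    then show ?thesis using that by (metis (mono_tags, lifting) UnI2 mem_Collect_eq
          bot_nat_0.not_eq_extremum le_neq_implies_less)
  qed
  have neq: "path_vertex k u v i \<noteq> path_vertex k u v (Suc i)"
    if "{u, v} \<in> edges G" "i < k" for u v i
    using edge_endpoints(1)[OF G that(1)] that(2) k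
    by (auto simp: path_vertex_def doubleton_eq_iff)
  show ?thesis
    unfolding simple_graph_def
  proof (intro conjI ballI)
    show "finite (verts (path_subdivision k G))"
      using fin \<open>finite (verts G)\<close> by (simp add: path_subdivision_def)
  next
    fix e assume "e \<in> edges (path_subdivision k G)"
    then obtain u v i where e: "e = {path_vertex k u v i, path_vertex k u v (Suc i)}"
      and uv: "{u, v} \<in> edges G" "i < k"
      by (auto simp: path_subdivision_def)
    show "card e = 2" using neq[OF uv] e by simp
    have "path_vertex k u v i \<in> Inl ` verts G \<union> ?I" "path_vertex k u v (Suc i) \<in> Inl ` verts G \<union> ?I"
      using mem[OF uv(1)] uv(2) by auto
    then show "e \<subseteq> verts (path_subdivision k G)"
      unfolding e by (simp add: path_subdivision_def)
  qed
qed

text \<open>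
  Density \<open>0\<close> is degenerate for \<open>K\<^sub>3\<close>-subdivisions: complete bipartite graphs contain no
  triangle, so a pair of \<open>K\<^sub>3\<close>-subdivisions of graphs with edges never forces at \<open>p = 0\<close>.
\<close>

lemma K3_subdivision_not_forces_at_0:
  assumes F: "edges F \<noteq> {}" "simple_graph F" and G: "edges G \<noteq> {}" "simple_graph G"
  shows "\<not> forces_at 0 (K3_subdivision F) (K3_subdivision G)"
proof
  assume *: "forces_at 0 (K3_subdivision F) (K3_subdivision G)"
  define H :: "nat \<Rightarrow> nat sgraph" where
    "H n = \<lparr>verts = {..<n + 2}, edges = {{a, b} | a b. a < n + 2 \<and> b < n + 2 \<and> even a \<and> odd b}\<rparr>" for n
  have edge_H: "{x, y} \<in> edges (H n) \<Longrightarrow> even x \<longleftrightarrow> odd y" for x y n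
    unfolding H_def by (auto simp: doubleton_eq_iff)
  have sg: "simple_graph (H n)" for n
    unfolding simple_graph_def H_def by (auto simp: card_2_iff)
  have dens0: "has_density 0 H (K3_subdivision A)" if A: "edges A \<noteq> {}" "simple_graph A" for A :: "'c sgraph"
  proof -
    obtain e where e: "e \<in> edges A" using A by auto
    then have "card e = 2" using A by (simp add: simple_graph_def)
    then obtain u v where uv: "e = {u, v}" by (meson card_2_iff)
    have E: "{Inl u, Inl v} \<in> edges (K3_subdivision A)" "{Inl u, Inr e} \<in> edges (K3_subdivision A)"
      "{Inl v, Inr e} \<in> edges (K3_subdivision A)"
      using e uv unfolding K3_subdivision_def by (auto simp: image_iff intro!: bexI[of _ e])
    have "graph_homs (K3_subdivision A) (H n) = {}" for n
      using E edge_H unfolding graph_homs_def by blast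
    moreover have "card (edges (K3_subdivision A)) \<noteq> 0"
      using E finite_edges[OF simple_graph_K3_subdivision[OF A(2)]] by auto
    ultimately show ?thesis by (simp add: has_density_def hom_density_def)
  qed
  have "increasing_order H" by (auto simp: increasing_order_def H_def strict_mono_def)
  then have qr: "quasi_random 0 H"
    using * sg dens0[OF F] dens0[OF G] unfolding forces_at_def by blast
  define K where "K = \<lparr>verts = {0, 1 :: nat}, edges = {{0, 1}}\<rparr>"
  have "simple_graph K" by (auto simp: simple_graph_def K_def)
  then have "(\<lambda>n. hom_density K (H n)) \<sim>[sequentially] (\<lambda>_. 0)"
    using qr unfolding quasi_random_def has_density_def by (force simp: K_def)
  then have "\<forall>\<^sub>F n in sequentially. hom_density K (H n) = 0"
    by (simp add: asymp_equiv_0_right_iff)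
  then obtain n where n: "hom_density K (H n) = 0"
    by (meson eventually_happens trivial_limit_sequentially)
  have fin: "finite (verts K \<rightarrow>\<^sub>E verts (H n))"
    by (intro finite_PiE) (auto simp: K_def H_def)
  have "{0, 1} \<in> edges (H n)"
    unfolding H_def by (simp, rule exI[of _ 0], rule exI[of _ "Suc 0"], simp)
  then have "restrict id (verts K) \<in> graph_homs K (H n)"
    unfolding graph_homs_def by (auto simp: K_def doubleton_eq_iff insert_commute) (auto simp: H_def)
  moreover have "graph_homs K (H n) \<subseteq> verts K \<rightarrow>\<^sub>E verts (H n)" by (auto simp: graph_homs_def)
  ultimately have "card (graph_homs K (H n)) \<noteq> 0" "card (verts K \<rightarrow>\<^sub>E verts (H n)) \<noteq> 0"
    using fin by (metis card_0_eq empty_iff finite_subset, metis card_0_eq empty_iff fin subsetD)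
  then show False using n by (simp add: hom_density_def)
qed

end

theory Submission
  imports Defs "HOL-Analysis.Weierstrass_Theorems"
begin

text \<open>
  Let \<open>H\<close> be a graph on \<open>N\<close> vertices. The density of a subdivision of \<open>F\<close> in \<open>H\<close> is the density of \<open>F\<close> in a
  weighted graph \<open>W\<close> on the same vertices: the weight of \<open>x y\<close> is the normalised number of walks
  with \<open>k\<close> edges from \<open>x\<close> to \<open>y\<close>, respectively the indicator of the edge \<open>x y\<close> times the normalised
  codegree of \<open>x\<close> and \<open>y\<close>. Rounding \<open>W\<close> to a random graph changes densities by \<open>O(N powr (-1/2))\<close>, so
  the forcing pair \<open>(F, G)\<close> shows that \<open>W\<close> is quasi-random, that is, close in the cut norm to the
  constant \<open>p\<^sup>k\<close>, respectively \<open>p\<^sup>3\<close>. It remains to see that \<open>H\<close> is then close to the constant \<open>p\<close>. For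
  walks this is a statement about roots of a self-adjoint operator; for triangles it follows from
  the strict convexity, in \<open>ln U\<close>, of the functional whose Euler equation is
  \<open>U (U \<circ> U) = p\<^sup>3\<close>. At density \<open>0\<close> a forcing pair contains a bipartite graph with an edge, and
  its path subdivisions map homomorphically to any graph with an edge.
\<close>

section \<open>Averages\<close>

text \<open>The forcing hypothesis speaks of graphs only, while \<open>W\<close> is weighted and may
  have weight on the diagonal. Rounding is harmless because uniform maps of a fixed finite set into
  \<open>N\<close> points are rarely non-injective. Of the quasi-randomness gained, only the
  densities of the edge, the path with two edges and the 4-cycle are used; by Cauchy-Schwarz they
  control the cut norm. The obstacle on the way back from \<open>W\<close> to \<open>H\<close> is
  that the cut norm is weak: the indicator \<open>U\<close> of \<open>H\<close> stays 0/1-valued,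
  and smallness in the cut norm does not survive multiplication by an arbitrary bounded kernel. The
  codegree is special: it averages products of a function of \<open>x\<close> and a function of
  \<open>y\<close>. Hence smallness survives multiplication by any continuous function of the
  codegree, and one can divide by a truncated codegree. No limit object is formed. All estimates
  concern sequences of finite averages, and an average over auxiliary points is replaced by a worst
  choice of them for each \<open>n\<close>. At density 0 the relation
  \<open>x = (1 + o(1)) 0\<close> means eventual vanishing. Closeness of densities says too little
  there, and a combinatorial argument takes over.\<close>

definition mean :: "'v set \<Rightarrow> ('v \<Rightarrow> real) \<Rightarrow> real" where
  "mean V f = (\<Sum>x\<in>V. f x) / real (card V)"

lemma mean_add: "mean V (\<lambda>x. f x + g x) = mean V f + mean V g"
  by (simp add: mean_def sum.distrib add_divide_distrib)

lemma mean_diff: "mean V (\<lambda>x. f x - g x) = mean V f - mean V g"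
  by (simp add: mean_def sum_subtractf diff_divide_distrib)

lemma mean_uminus: "mean V (\<lambda>x. - f x) = - mean V f"
  by (simp add: mean_def sum_negf)

lemma mean_cmult: "mean V (\<lambda>x. c * f x) = c * mean V f"
  by (simp add: mean_def sum_distrib_left)

lemma mean_multc: "mean V (\<lambda>x. f x * c) = mean V f * c"
  by (simp add: mean_def sum_distrib_right)

lemma mean_sum: "mean V (\<lambda>x. \<Sum>i\<in>I. f i x) = (\<Sum>i\<in>I. mean V (f i))"
  by (simp add: mean_def sum_divide_distrib[symmetric] sum.swap[of _ _ V])

lemma mean_swap: "mean V (\<lambda>x. mean W (\<lambda>y. f x y)) = mean W (\<lambda>y. mean V (\<lambda>x. f x y))"
  by (simp add: mean_def sum_divide_distrib[symmetric] sum.swap[of _ W V])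

lemma mean_cong: "(\<And>x. x \<in> V \<Longrightarrow> f x = g x) \<Longrightarrow> mean V f = mean V g"
  by (simp add: mean_def)

lemma mean_mono: "(\<And>x. x \<in> V \<Longrightarrow> f x \<le> g x) \<Longrightarrow> mean V f \<le> mean V g"
  by (simp add: mean_def divide_right_mono sum_mono)

lemma mean_nonneg: "(\<And>x. x \<in> V \<Longrightarrow> 0 \<le> f x) \<Longrightarrow> 0 \<le> mean V f"
  by (simp add: mean_def sum_nonneg)

lemma abs_mean_le: "\<bar>mean V f\<bar> \<le> mean V (\<lambda>x. \<bar>f x\<bar>)"
  by (simp add: mean_def divide_right_mono)

text \<open>The condition \<open>0 \<le> c\<close> covers empty and infinite \<open>V\<close>, where
  the mean is 0 by division by zero; so no nonemptiness has to be carried along.\<close>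

lemma mean_le_bound:
  assumes "\<And>x. x \<in> V \<Longrightarrow> f x \<le> c" "0 \<le> c"
  shows "mean V f \<le> c"
proof -
  have "(\<Sum>x\<in>V. f x) \<le> real (card V) * c"
    using sum_bounded_above[of V f c] assms by simp
  then show ?thesis
    using assms(2) by (cases "card V = 0") (auto simp: mean_def divide_le_eq mult.commute)
qed

lemma abs_mean_bound:
  assumes "\<And>x. x \<in> V \<Longrightarrow> \<bar>f x\<bar> \<le> c" "0 \<le> c"
  shows "\<bar>mean V f\<bar> \<le> c"
  by (rule order_trans[OF abs_mean_le mean_le_bound]) (use assms in auto)

lemma mean_const: "finite V \<Longrightarrow> V \<noteq> {} \<Longrightarrow> mean V (\<lambda>_. c) = c"
  by (simp add: mean_def)

text \<open>Lets an average over an auxiliary point be replaced by one worst point for each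
  \<open>n\<close>, which turns a family of test functions into a single sequence.\<close>

lemma abs_mean_attained:
  assumes "finite V" "V \<noteq> {}"
  shows "\<exists>x\<in>V. \<bar>mean V f\<bar> \<le> \<bar>f x\<bar>"
proof -
  define m where "m = Max ((\<lambda>x. \<bar>f x\<bar>) ` V)"
  have "m \<in> (\<lambda>x. \<bar>f x\<bar>) ` V" unfolding m_def using assms by (intro Max_in) auto
  then obtain x where x: "x \<in> V" "m = \<bar>f x\<bar>" by auto
  have "\<bar>mean V f\<bar> \<le> m"
  proof (rule abs_mean_bound)
    show "\<bar>f y\<bar> \<le> m" if "y \<in> V" for y unfolding m_def using assms that by simp
    show "0 \<le> m" using x by simp
  qed
  then show ?thesis using x by auto
qed

lemma mean_Cauchy_Schwarz:
  "(mean V (\<lambda>x. f x * g x))\<^sup>2 \<le> mean V (\<lambda>x. (f x)\<^sup>2) * mean V (\<lambda>x. (g x)\<^sup>2)"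
  using Cauchy_Schwarz_ineq_sum[of f g V]
  by (simp add: mean_def power_divide power2_eq_square[of "real (card V)"] divide_right_mono)

lemma mean_power2_le:
  shows "(mean V f)\<^sup>2 \<le> mean V (\<lambda>x. (f x)\<^sup>2)"
proof -
  have "(mean V f)\<^sup>2 \<le> mean V (\<lambda>x. (f x)\<^sup>2) * mean V (\<lambda>x. 1\<^sup>2)"
    using mean_Cauchy_Schwarz[of V f "\<lambda>_. 1"] by simp
  also have "\<dots> \<le> mean V (\<lambda>x. (f x)\<^sup>2) * 1"
    by (intro mult_left_mono mean_le_bound mean_nonneg) auto
  finally show ?thesis by simp
qed

section \<open>Averages over all maps between two sets\<close>

definition avg :: "'i set \<Rightarrow> 'v set \<Rightarrow> (('i \<Rightarrow> 'v) \<Rightarrow> real) \<Rightarrow> real" where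
  "avg A V F = mean (A \<rightarrow>\<^sub>E V) F"

lemma avg_cong: "(\<And>\<phi>. \<phi> \<in> A \<rightarrow>\<^sub>E V \<Longrightarrow> F \<phi> = G \<phi>) \<Longrightarrow> avg A V F = avg A V G"
  unfolding avg_def by (rule mean_cong)

text \<open>Exchanging \<open>\<phi> a\<close> with \<open>x\<close> is an involution on pairs
  \<open>(\<phi>, x)\<close>. Averaging out a vertex in this way leaves the domain \<open>A\<close>
  unchanged, so that many vertices can be treated in turn without re-indexing.\<close>

lemma avg_resample:
  assumes "finite V" "V \<noteq> {}" "a \<in> A"
  shows "avg A V F = avg A V (\<lambda>\<phi>. mean V (\<lambda>x. F (\<phi>(a := x))))"
proof -
  have "(\<Sum>(\<phi>, x)\<in>(A \<rightarrow>\<^sub>E V) \<times> V. F (\<phi>(a := x))) = (\<Sum>(\<phi>, x)\<in>(A \<rightarrow>\<^sub>E V) \<times> V. F \<phi>)"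
    by (rule sum.reindex_bij_witness[of _ "\<lambda>(\<phi>, x). (\<phi>(a := x), \<phi> a)" "\<lambda>(\<phi>, x). (\<phi>(a := x), \<phi> a)"])
      (use assms in \<open>auto simp: PiE_iff extensional_def\<close>)
  then have "(\<Sum>\<phi>\<in>A \<rightarrow>\<^sub>E V. \<Sum>x\<in>V. F (\<phi>(a := x))) = real (card V) * (\<Sum>\<phi>\<in>A \<rightarrow>\<^sub>E V. F \<phi>)"
    by (simp add: sum.cartesian_product[symmetric] sum_distrib_left)
  then show ?thesis
    using assms by (simp add: avg_def mean_def sum_divide_distrib[symmetric])
qed

lemma avg_empty: "avg {} V F = F (\<lambda>_. undefined)"
  by (simp add: avg_def mean_def)

lemma avg_insert:
  assumes "finite V" "finite A" "a \<notin> A"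
  shows "avg (insert a A) V F = mean V (\<lambda>x. avg A V (\<lambda>\<phi>. F (\<phi>(a := x))))"
proof -
  have inj: "inj_on (\<lambda>(y, g). g(a := y)) (V \<times> (A \<rightarrow>\<^sub>E V))"
    using inj_combinator[OF assms(3), of "\<lambda>_. V"] by (simp add: case_prod_unfold)
  have "(\<Sum>\<phi>\<in>insert a A \<rightarrow>\<^sub>E V. F \<phi>) = (\<Sum>x\<in>V. \<Sum>\<phi>\<in>A \<rightarrow>\<^sub>E V. F (\<phi>(a := x)))"
    unfolding PiE_insert_eq sum.reindex[OF inj] sum.cartesian_product
    by (rule sum.cong) auto
  then show ?thesis
    using assms by (simp add: avg_def mean_def card_PiE sum_divide_distrib[symmetric] mult.commute)
qed

lemma avg_unused:
  assumes V: "finite V" "V \<noteq> {}" and "finite B" "A \<subseteq> B"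
    and dep: "\<And>\<phi> a x. a \<in> B - A \<Longrightarrow> F (\<phi>(a := x)) = F \<phi>"
  shows "avg B V F = avg A V F"
proof -
  have "finite A" using assms finite_subset by blast
  have "avg (A \<union> C) V F = avg A V F" if "finite C" "C \<subseteq> B - A" for C
    using that
  proof (induction C rule: finite_induct)
    case (insert c C)
    have "avg (A \<union> insert c C) V F = mean V (\<lambda>x. avg (A \<union> C) V (\<lambda>\<phi>. F (\<phi>(c := x))))"
      using insert V \<open>finite A\<close> avg_insert[of V "A \<union> C" c F] by auto
    also have "\<dots> = mean V (\<lambda>x. avg (A \<union> C) V F)"
      using dep insert.prems by simp
    finally show ?case using insert V by (simp add: mean_const)
  qed simp
  from this[of "B - A"] show ?thesis using assms by (simp add: Un_absorb1)
qed

lemma avg_reindex: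
  assumes "inj_on j A"
  shows "avg (j ` A) V F = avg A V (\<lambda>\<phi>. F (\<lambda>b. if b \<in> j ` A then \<phi> (the_inv_into A j b) else undefined))"
proof -
  have "bij_betw (\<lambda>\<phi> b. if b \<in> j ` A then \<phi> (the_inv_into A j b) else undefined) (A \<rightarrow>\<^sub>E V) (j ` A \<rightarrow>\<^sub>E V)"
  proof (rule bij_betw_byWitness[where f' = "\<lambda>\<psi> a. if a \<in> A then \<psi> (j a) else undefined"])
  qed (use assms in \<open>auto simp: PiE_iff extensional_def fun_eq_iff the_inv_into_f_f\<close>)
  then show ?thesis
    unfolding avg_def mean_def
    by (simp add: sum.reindex_bij_betw[symmetric] bij_betw_same_card[symmetric])
qed

section \<open>Averages over pairs of points\<close>

definition mean2 :: "'v set \<Rightarrow> ('v \<Rightarrow> 'v \<Rightarrow> real) \<Rightarrow> real" where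
  "mean2 V f = mean V (\<lambda>x. mean V (f x))"

lemma mean2_add: "mean2 V (\<lambda>x y. f x y + g x y) = mean2 V f + mean2 V g"
  by (simp add: mean2_def mean_add)

lemma mean2_diff: "mean2 V (\<lambda>x y. f x y - g x y) = mean2 V f - mean2 V g"
  by (simp add: mean2_def mean_diff)

lemma mean2_cmult: "mean2 V (\<lambda>x y. c * f x y) = c * mean2 V f"
  by (simp add: mean2_def mean_cmult)

lemma mean2_uminus: "mean2 V (\<lambda>x y. - f x y) = - mean2 V f"
  by (simp add: mean2_def mean_uminus)

lemma mean2_const: "finite V \<Longrightarrow> V \<noteq> {} \<Longrightarrow> mean2 V (\<lambda>_ _. c) = c"
  by (simp add: mean2_def mean_const)

lemma mean2_cong: "(\<And>x y. x \<in> V \<Longrightarrow> y \<in> V \<Longrightarrow> f x y = g x y) \<Longrightarrow> mean2 V f = mean2 V g"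
  unfolding mean2_def by (intro mean_cong)

lemma mean2_mono: "(\<And>x y. x \<in> V \<Longrightarrow> y \<in> V \<Longrightarrow> f x y \<le> g x y) \<Longrightarrow> mean2 V f \<le> mean2 V g"
  unfolding mean2_def by (intro mean_mono)

lemma mean2_nonneg: "(\<And>x y. x \<in> V \<Longrightarrow> y \<in> V \<Longrightarrow> 0 \<le> f x y) \<Longrightarrow> 0 \<le> mean2 V f"
  unfolding mean2_def by (intro mean_nonneg)

lemma abs_mean2_le: "\<bar>mean2 V f\<bar> \<le> mean2 V (\<lambda>x y. \<bar>f x y\<bar>)"
  unfolding mean2_def by (rule order_trans[OF abs_mean_le]) (intro mean_mono abs_mean_le)

lemma mean2_le_bound:
  "(\<And>x y. x \<in> V \<Longrightarrow> y \<in> V \<Longrightarrow> f x y \<le> c) \<Longrightarrow> 0 \<le> c \<Longrightarrow> mean2 V f \<le> c"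
  unfolding mean2_def by (intro mean_le_bound)

lemma mean2_power2_le: "(mean2 V f)\<^sup>2 \<le> mean2 V (\<lambda>x y. (f x y)\<^sup>2)"
  unfolding mean2_def by (rule order_trans[OF mean_power2_le]) (intro mean_mono mean_power2_le)

lemma mean_mean2_swap: "mean V (\<lambda>z. mean2 V (\<lambda>x y. f x y z)) = mean2 V (\<lambda>x y. mean V (f x y))"
  unfolding mean2_def
  by (subst mean_swap) (rule mean_cong, rule mean_swap)

text \<open>Invariance of a triple average under cyclic relabelling; it symmetrises sums over
  triangles.\<close>

lemma mean_mean2_rotate:
  "mean2 V (\<lambda>x y. mean V (\<lambda>z. F y z x)) = mean2 V (\<lambda>x y. mean V (F x y))"
  using mean_mean2_swap[of V F] by (simp add: mean2_def)

section \<open>Cut norm\<close>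

text \<open>Convergence to \<open>0\<close> in the cut norm, stated through test functions.\<close>

definition cut_small :: "(nat \<Rightarrow> 'v set) \<Rightarrow> (nat \<Rightarrow> 'v \<Rightarrow> 'v \<Rightarrow> real) \<Rightarrow> bool" where
  "cut_small V K \<longleftrightarrow>
     (\<forall>a b. (\<forall>n. \<forall>x\<in>V n. \<bar>a n x\<bar> \<le> 1) \<and> (\<forall>n. \<forall>x\<in>V n. \<bar>b n x\<bar> \<le> 1) \<longrightarrow>
        (\<lambda>n. mean2 (V n) (\<lambda>x y. K n x y * a n x * b n y)) \<longlonglongrightarrow> 0)"

locale vertex_sets =
  fixes V :: "nat \<Rightarrow> 'v set"
  assumes finite_V: "finite (V n)" and nonempty_V: "V n \<noteq> {}"
begin

lemma cut_smallI:
  assumes "\<And>a b. \<forall>n. \<forall>x\<in>V n. \<bar>a n x\<bar> \<le> 1 \<Longrightarrow> \<forall>n. \<forall>x\<in>V n. \<bar>b n x\<bar> \<le> 1 \<Longrightarrow>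
     (\<lambda>n. mean2 (V n) (\<lambda>x y. K n x y * a n x * b n y)) \<longlonglongrightarrow> 0"
  shows "cut_small V K"
  using assms unfolding cut_small_def by simp

lemma cut_smallD:
  assumes "cut_small V K" "\<forall>n. \<forall>x\<in>V n. \<bar>a n x\<bar> \<le> c" "\<forall>n. \<forall>x\<in>V n. \<bar>b n x\<bar> \<le> d"
  shows "(\<lambda>n. mean2 (V n) (\<lambda>x y. K n x y * a n x * b n y)) \<longlonglongrightarrow> 0"
proof -
  \<comment> \<open>Adding 1 makes the scaling factors positive whatever the signs of
    \<open>c\<close> and \<open>d\<close>.\<close>
  define c' d' where "c' = \<bar>c\<bar> + 1" and "d' = \<bar>d\<bar> + 1"
  have pos: "c' > 0" "d' > 0" by (auto simp: c'_def d'_def)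
  have *: "\<bar>a n x / c'\<bar> \<le> 1" "\<bar>b n x / d'\<bar> \<le> 1" if "x \<in> V n" for n x
    using assms(2,3) that pos by (force simp: c'_def d'_def)+
  have "(\<lambda>n. mean2 (V n) (\<lambda>x y. K n x y * (a n x / c') * (b n y / d'))) \<longlonglongrightarrow> 0"
    using assms(1)[unfolded cut_small_def, rule_format, of "\<lambda>n x. a n x / c'" "\<lambda>n x. b n x / d'"] * by auto
  from tendsto_mult_left[OF this, of "c' * d'"] show ?thesis
    using pos by (simp add: mean2_cmult[symmetric] field_simps)
qed

lemma cut_small_add:
  assumes "cut_small V K" "cut_small V L"
  shows "cut_small V (\<lambda>n x y. K n x y + L n x y)"
proof (rule cut_smallI)
  fix a b :: "nat \<Rightarrow> 'v \<Rightarrow> real"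
  assume ab: "\<forall>n. \<forall>x\<in>V n. \<bar>a n x\<bar> \<le> 1" "\<forall>n. \<forall>x\<in>V n. \<bar>b n x\<bar> \<le> 1"
  show "(\<lambda>n. mean2 (V n) (\<lambda>x y. (K n x y + L n x y) * a n x * b n y)) \<longlonglongrightarrow> 0"
    using tendsto_add[OF cut_smallD[OF assms(1) ab] cut_smallD[OF assms(2) ab]]
    by (simp add: distrib_right mean2_add)
qed

lemma cut_small_cmult:
  assumes "cut_small V K"
  shows "cut_small V (\<lambda>n x y. c * K n x y)"
proof (rule cut_smallI)
  fix a b :: "nat \<Rightarrow> 'v \<Rightarrow> real"
  assume ab: "\<forall>n. \<forall>x\<in>V n. \<bar>a n x\<bar> \<le> 1" "\<forall>n. \<forall>x\<in>V n. \<bar>b n x\<bar> \<le> 1"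
  show "(\<lambda>n. mean2 (V n) (\<lambda>x y. c * K n x y * a n x * b n y)) \<longlonglongrightarrow> 0"
    using tendsto_mult_left[OF cut_smallD[OF assms(1) ab], of c]
    by (simp add: mult.assoc mean2_cmult)
qed

lemma cut_small_sum:
  assumes "\<And>i. i \<in> I \<Longrightarrow> cut_small V (K i)"
  shows "cut_small V (\<lambda>n x y. \<Sum>i\<in>I. K i n x y)"
  using assms
proof (induction I rule: infinite_finite_induct)
  case (insert i I)
  then show ?case by (simp add: cut_small_add)
qed (auto simp: cut_small_def mean2_def mean_def)

lemma mean2_abs_bound_tendsto:
  assumes "(\<lambda>n. mean2 (V n) (\<lambda>x y. \<bar>K n x y\<bar>)) \<longlonglongrightarrow> 0" and "\<forall>n. \<forall>x\<in>V n. \<forall>y\<in>V n. \<bar>g n x y\<bar> \<le> c"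
  shows "(\<lambda>n. mean2 (V n) (\<lambda>x y. K n x y * g n x y)) \<longlonglongrightarrow> 0"
proof (rule Lim_null_comparison)
  show "(\<lambda>n. c * mean2 (V n) (\<lambda>x y. \<bar>K n x y\<bar>)) \<longlonglongrightarrow> 0"
    using tendsto_mult_left[OF assms(1), of c] by simp
  show "\<forall>\<^sub>F n in sequentially. norm (mean2 (V n) (\<lambda>x y. K n x y * g n x y)) \<le> c * mean2 (V n) (\<lambda>x y. \<bar>K n x y\<bar>)"
  proof (rule always_eventually, rule allI)
    fix n
    have "mean2 (V n) (\<lambda>x y. \<bar>K n x y * g n x y\<bar>) \<le> mean2 (V n) (\<lambda>x y. c * \<bar>K n x y\<bar>)"
      by (rule mean2_mono) (simp add: abs_mult mult.commute[of c] mult_left_mono assms(2)[rule_format])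
    then show "norm (mean2 (V n) (\<lambda>x y. K n x y * g n x y)) \<le> c * mean2 (V n) (\<lambda>x y. \<bar>K n x y\<bar>)"
      using abs_mean2_le[of "V n" "\<lambda>x y. K n x y * g n x y"] by (simp add: mean2_cmult)
  qed
qed

lemma cut_small_abs:
  assumes "(\<lambda>n. mean2 (V n) (\<lambda>x y. \<bar>K n x y\<bar>)) \<longlonglongrightarrow> 0"
  shows "cut_small V K"
proof (rule cut_smallI)
  fix a b :: "nat \<Rightarrow> 'v \<Rightarrow> real"
  assume ab: "\<forall>n. \<forall>x\<in>V n. \<bar>a n x\<bar> \<le> 1" "\<forall>n. \<forall>x\<in>V n. \<bar>b n x\<bar> \<le> 1"
  have "\<bar>a n x * b n y\<bar> \<le> 1" if "x \<in> V n" "y \<in> V n" for n x y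
    using mult_mono[OF ab(1)[rule_format, OF that(1)] ab(2)[rule_format, OF that(2)]] by (simp add: abs_mult)
  then have "\<forall>n. \<forall>x\<in>V n. \<forall>y\<in>V n. \<bar>a n x * b n y\<bar> \<le> 1" by blast
  from mean2_abs_bound_tendsto[OF assms this] show "(\<lambda>n. mean2 (V n) (\<lambda>x y. K n x y * a n x * b n y)) \<longlonglongrightarrow> 0"
    by (simp add: mult.assoc)
qed

lemma mean2_abs_tendsto:
  assumes "(\<lambda>n. mean2 (V n) (\<lambda>x y. (K n x y)\<^sup>2)) \<longlonglongrightarrow> 0"
  shows "(\<lambda>n. mean2 (V n) (\<lambda>x y. \<bar>K n x y\<bar>)) \<longlonglongrightarrow> 0"
proof -
  have "(\<lambda>n. (mean2 (V n) (\<lambda>x y. \<bar>K n x y\<bar>))\<^sup>2) \<longlonglongrightarrow> 0"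
  proof (rule Lim_null_comparison[OF always_eventually assms], rule allI)
    show "norm ((mean2 (V n) (\<lambda>x y. \<bar>K n x y\<bar>))\<^sup>2) \<le> mean2 (V n) (\<lambda>x y. (K n x y)\<^sup>2)" for n
      using mean2_power2_le[of "V n" "\<lambda>x y. \<bar>K n x y\<bar>"] by simp
  qed
  then show ?thesis by simp
qed

text \<open>An average over \<open>w\<close> is at most its largest term, so a single sequence of test functions suffices.\<close>

lemma cut_small_mean:
  assumes D: "cut_small V D"
    and a: "\<forall>n. \<forall>x\<in>V n. \<forall>w\<in>V n. \<bar>\<alpha> n x w\<bar> \<le> c"
    and b: "\<forall>n. \<forall>x\<in>V n. \<forall>w\<in>V n. \<bar>\<beta> n x w\<bar> \<le> d"
  shows "(\<lambda>n. mean (V n) (\<lambda>w. mean2 (V n) (\<lambda>x y. D n x y * \<alpha> n x w * \<beta> n y w))) \<longlonglongrightarrow> 0"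
proof -
  let ?G = "\<lambda>n w. mean2 (V n) (\<lambda>x y. D n x y * \<alpha> n x w * \<beta> n y w)"
  define w where "w n = (SOME w. w \<in> V n \<and> \<bar>mean (V n) (?G n)\<bar> \<le> \<bar>?G n w\<bar>)" for n
  have w: "w n \<in> V n \<and> \<bar>mean (V n) (?G n)\<bar> \<le> \<bar>?G n (w n)\<bar>" for n
    unfolding w_def by (rule someI_ex) (use abs_mean_attained[OF finite_V nonempty_V, of n "?G n"] in auto)
  have "(\<lambda>n. ?G n (w n)) \<longlonglongrightarrow> 0"
    by (rule cut_smallD[OF D, of _ c _ d]) (use a b w in auto)
  then have "(\<lambda>n. \<bar>?G n (w n)\<bar>) \<longlonglongrightarrow> 0" by (simp add: tendsto_rabs_zero)
  then show ?thesis
    by (rule Lim_null_comparison[rotated]) (use w in auto)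
qed

text \<open>For each fixed \<open>z\<close> the new factor splits into a function of
  \<open>x\<close> and one of \<open>y\<close>, which the test functions absorb;
  \<open>cut_small_mean\<close> then averages over \<open>z\<close>.\<close>

lemma cut_small_mult_mean:
  assumes D: "cut_small V D"
    and a: "\<forall>n. \<forall>x\<in>V n. \<forall>w\<in>V n. \<bar>\<alpha> n x w\<bar> \<le> 1"
    and b: "\<forall>n. \<forall>x\<in>V n. \<forall>w\<in>V n. \<bar>\<beta> n w x\<bar> \<le> 1"
  shows "cut_small V (\<lambda>n x y. D n x y * mean (V n) (\<lambda>z. \<alpha> n x z * \<beta> n z y))"
proof (rule cut_smallI)
  fix s t :: "nat \<Rightarrow> 'v \<Rightarrow> real"
  assume st: "\<forall>n. \<forall>x\<in>V n. \<bar>s n x\<bar> \<le> 1" "\<forall>n. \<forall>x\<in>V n. \<bar>t n x\<bar> \<le> 1"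
  have 1: "\<bar>\<alpha> n x w * s n x\<bar> \<le> 1" "\<bar>\<beta> n w x * t n x\<bar> \<le> 1" if "x \<in> V n" "w \<in> V n" for n x w
    using mult_mono[OF a[rule_format, OF that] st(1)[rule_format, OF that(1)]]
      mult_mono[OF b[rule_format, OF that] st(2)[rule_format, OF that(1)]]
    by (simp_all add: abs_mult)
  then have 2: "\<forall>n. \<forall>x\<in>V n. \<forall>w\<in>V n. \<bar>\<alpha> n x w * s n x\<bar> \<le> 1" "\<forall>n. \<forall>x\<in>V n. \<forall>w\<in>V n. \<bar>\<beta> n w x * t n x\<bar> \<le> 1"
    by blast+
  have "mean (V n) (\<lambda>w. mean2 (V n) (\<lambda>x y. D n x y * (\<alpha> n x w * s n x) * (\<beta> n w y * t n y)))
    = mean2 (V n) (\<lambda>x y. D n x y * mean (V n) (\<lambda>z. \<alpha> n x z * \<beta> n z y) * s n x * t n y)" for n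
    unfolding mean_mean2_swap
    by (intro mean2_cong) (simp add: mean_cmult[symmetric] mean_multc[symmetric] mult_ac)
  then show "(\<lambda>n. mean2 (V n) (\<lambda>x y. D n x y * mean (V n) (\<lambda>z. \<alpha> n x z * \<beta> n z y) * s n x * t n y)) \<longlonglongrightarrow> 0"
    using cut_small_mean[OF D 2] by simp
qed

section \<open>Multiplication by functions of the codegree\<close>

definition codeg :: "(nat \<Rightarrow> 'v \<Rightarrow> 'v \<Rightarrow> real) \<Rightarrow> nat \<Rightarrow> 'v \<Rightarrow> 'v \<Rightarrow> real" where
  "codeg U n x y = mean (V n) (\<lambda>z. U n x z * U n z y)"

lemma cut_small_mult_codeg_power:
  assumes D: "cut_small V D"
    and U: "\<forall>n. \<forall>x\<in>V n. \<forall>y\<in>V n. \<bar>U n x y\<bar> \<le> 1"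
  shows "cut_small V (\<lambda>n x y. D n x y * codeg U n x y ^ k)"
proof (induction k)
  case (Suc k)
  have "cut_small V (\<lambda>n x y. (D n x y * codeg U n x y ^ k) * mean (V n) (\<lambda>z. U n x z * U n z y))"
    by (rule cut_small_mult_mean[OF Suc.IH]) (use U in auto)
  then show ?case by (simp add: codeg_def mult_ac)
qed (simp add: D)

text \<open>These products are the building blocks of Bernstein polynomials in the codegree.\<close>

lemma cut_small_mult_codeg_Bernstein:
  assumes D: "cut_small V D"
    and U: "\<forall>n. \<forall>x\<in>V n. \<forall>y\<in>V n. \<bar>U n x y\<bar> \<le> 1"
  shows "cut_small V (\<lambda>n x y. D n x y * codeg U n x y ^ k * (1 - codeg U n x y) ^ j)"
proof (induction j)
  case (Suc j)
  from cut_small_mult_codeg_power[OF Suc.IH U, of 1]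
  have "cut_small V (\<lambda>n x y. D n x y * codeg U n x y ^ k * (1 - codeg U n x y) ^ j * codeg U n x y)" by simp
  from cut_small_add[OF Suc.IH cut_small_cmult[OF this, of "-1"]]
  show ?case by (simp add: algebra_simps)
qed (simp add: cut_small_mult_codeg_power[OF D U])

lemma codeg_range:
  assumes "x \<in> V n" "y \<in> V n" and U: "\<forall>n. \<forall>x\<in>V n. \<forall>y\<in>V n. 0 \<le> U n x y \<and> U n x y \<le> 1"
  shows "codeg U n x y \<in> {0..1}"
proof -
  have "0 \<le> U n x z * U n z y \<and> U n x z * U n z y \<le> 1" if "z \<in> V n" for z
    using U[rule_format, OF assms(1) that] U[rule_format, OF that assms(2)] mult_le_one[of "U n x z" "U n z y"] by auto
  then show ?thesis unfolding codeg_def by (auto intro!: mean_nonneg mean_le_bound)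
qed

text \<open>Weierstrass approximation: \<open>\<psi>\<close> is replaced by a Bernstein polynomial.
  Since \<open>D\<close> and the test functions are bounded by 1, the uniform error passes unchanged
  to the average.\<close>

lemma cut_small_mult_codeg_continuous:
  fixes \<psi> :: "real \<Rightarrow> real"
  assumes D: "cut_small V D" and D1: "\<forall>n. \<forall>x\<in>V n. \<forall>y\<in>V n. \<bar>D n x y\<bar> \<le> 1"
    and U: "\<forall>n. \<forall>x\<in>V n. \<forall>y\<in>V n. 0 \<le> U n x y \<and> U n x y \<le> 1"
    and \<psi>: "continuous_on {0..1} \<psi>"
  shows "cut_small V (\<lambda>n x y. D n x y * \<psi> (codeg U n x y))"
proof (rule cut_smallI)
  fix a b :: "nat \<Rightarrow> 'v \<Rightarrow> real"
  assume ab: "\<forall>n. \<forall>x\<in>V n. \<bar>a n x\<bar> \<le> 1" "\<forall>n. \<forall>x\<in>V n. \<bar>b n x\<bar> \<le> 1"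
  have U': "\<forall>n. \<forall>x\<in>V n. \<forall>y\<in>V n. \<bar>U n x y\<bar> \<le> 1" using U by auto
  show "(\<lambda>n. mean2 (V n) (\<lambda>x y. D n x y * \<psi> (codeg U n x y) * a n x * b n y)) \<longlonglongrightarrow> 0"
  proof (rule LIMSEQ_I)
    fix r :: real assume r: "0 < r"
    obtain N where N: "\<And>n x. N \<le> n \<Longrightarrow> x \<in> {0..1} \<Longrightarrow> \<bar>\<psi> x - (\<Sum>k\<le>n. \<psi> (k/n) * Bernstein n k x)\<bar> < r/2"
      using Bernstein_Weierstrass[OF \<psi>, of "r/2"] r by auto
    define P where "P x = (\<Sum>k\<le>N. \<psi> (k/N) * Bernstein N k x)" for x
    have P: "\<bar>\<psi> x - P x\<bar> \<le> r/2" if "x \<in> {0..1}" for x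
      using N[of N x] that unfolding P_def by simp
    have "cut_small V (\<lambda>n x y. \<Sum>k\<le>N. \<psi> (k/N) * real (N choose k) *
        (D n x y * codeg U n x y ^ k * (1 - codeg U n x y) ^ (N - k)))"
      by (intro cut_small_sum cut_small_cmult cut_small_mult_codeg_Bernstein D U')
    then have "cut_small V (\<lambda>n x y. D n x y * P (codeg U n x y))"
      by (simp add: P_def Bernstein_def sum_distrib_left mult_ac)
    from LIMSEQ_D[OF cut_smallD[OF this ab], of "r/2"] r
    obtain M where M: "\<And>n. M \<le> n \<Longrightarrow> \<bar>mean2 (V n) (\<lambda>x y. D n x y * P (codeg U n x y) * a n x * b n y)\<bar> < r/2"
      by auto
    have close: "\<bar>mean2 (V n) (\<lambda>x y. D n x y * \<psi> (codeg U n x y) * a n x * b n y)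
        - mean2 (V n) (\<lambda>x y. D n x y * P (codeg U n x y) * a n x * b n y)\<bar> \<le> r/2" for n
      unfolding mean2_diff[symmetric]
    proof (rule order_trans[OF abs_mean2_le mean2_le_bound])
      fix x y assume xy: "x \<in> V n" "y \<in> V n"
      have "\<bar>D n x y\<bar> * \<bar>\<psi> (codeg U n x y) - P (codeg U n x y)\<bar> * \<bar>a n x\<bar> * \<bar>b n y\<bar> \<le> 1 * (r/2) * 1 * 1"
        using r xy by (intro mult_mono D1[rule_format] ab[rule_format] P codeg_range U) auto
      then show "\<bar>D n x y * \<psi> (codeg U n x y) * a n x * b n y - D n x y * P (codeg U n x y) * a n x * b n y\<bar> \<le> r/2"
        by (simp add: abs_mult[symmetric] algebra_simps)
    qed (use r in simp)
    have "norm (mean2 (V n) (\<lambda>x y. D n x y * \<psi> (codeg U n x y) * a n x * b n y) - 0) < r" if "M \<le> n" for n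
      using M[OF that] close[of n] unfolding real_norm_def diff_0_right by linarith
    then show "\<exists>no. \<forall>n\<ge>no. norm (mean2 (V n) (\<lambda>x y. D n x y * \<psi> (codeg U n x y) * a n x * b n y) - 0) < r" by blast
  qed
qed

end

section \<open>Triangle kernels\<close>

text \<open>The quotient \<open>(exp s - 1) / s\<close> is the mean value of \<open>exp\<close>
  between 0 and \<open>s\<close>, hence at least \<open>exp (- M)\<close>. This is the quantitative
  form of strict convexity.\<close>

lemma exp_minus_one_mult_ge:
  fixes s :: real
  assumes "\<bar>s\<bar> \<le> M"
  shows "exp (- M) * s\<^sup>2 \<le> (exp s - 1) * s"
proof (cases "s \<ge> 0")
  case True
  have "exp (- M) * s\<^sup>2 \<le> 1 * s\<^sup>2"
    using assms by (intro mult_right_mono) auto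
  also have "\<dots> \<le> (exp s - 1) * s"
    unfolding power2_eq_square mult_1 using True exp_ge_add_one_self[of s] by (intro mult_right_mono) linarith+
  finally show ?thesis .
next
  case False
  have "exp (- M) * (- s) \<le> exp s * (exp (- s) - 1)"
    using False assms exp_ge_add_one_self[of "- s"] by (intro mult_mono) auto
  also have "\<dots> = 1 - exp s"
    by (simp add: right_diff_distrib mult_exp_exp)
  finally have "exp (- M) * (- s) * (- s) \<le> (1 - exp s) * (- s)"
    using False by (intro mult_right_mono) auto
  then show ?thesis by (simp add: power2_eq_square algebra_simps)
qed

text \<open>The logarithm has slope at least 1 on \<open>(0, 1]\<close>; this leads back from the
  logarithmic scale.\<close>

lemma abs_diff_le_ln_quotient:
  fixes a b :: real
  assumes "0 < a" "a \<le> 1" "0 < b" "b \<le> 1"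
  shows "\<bar>a - b\<bar> \<le> \<bar>ln (a / b)\<bar>"
proof -
  have *: "d - c \<le> ln (d / c)" if "0 < c" "c \<le> d" "d \<le> 1" for c d :: real
  proof -
    have "ln (c / d) \<le> c / d - 1" using that by (intro ln_le_minus_one) auto
    moreover have "d * (1 - c / d) \<le> 1 * (1 - c / d)"
      using that by (intro mult_right_mono) auto
    ultimately show ?thesis
      using that by (simp add: ln_div right_diff_distrib)
  qed
  show ?thesis
    using *[of a b] *[of b a] assms by (cases "a \<le> b") (auto simp: ln_div)
qed

context vertex_sets
begin

text \<open>
  If \<open>U\<close> has codegree function \<open>f\<close> and \<open>U f\<close> is close to \<open>p\<^sup>3\<close> in the cut norm, then \<open>U\<close> is close to
  \<open>g = p\<^sup>3 / f\<close>, where \<open>f\<close> is first truncated from below at \<open>p\<^sup>3\<close>. The function \<open>g\<close> is bounded away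
  from \<open>0\<close> and satisfies \<open>g (g \<circ> g) \<approx> p\<^sup>3\<close>, which says that \<open>v = ln (g / p)\<close> is nearly a
  critical point of the strictly convex functional
  \<open>\<integral> exp (v x y + v y z + v z x) / 3 - \<integral> v\<close>, whose only critical point is \<open>v = 0\<close>.
\<close>

lemma cut_small_triangle_kernel:
  assumes U: "\<forall>n. \<forall>x\<in>V n. \<forall>y\<in>V n. 0 \<le> U n x y \<and> U n x y \<le> 1"
    and sym: "\<And>n x y. U n x y = U n y x"
    and p: "0 < p" "p \<le> 1"
    and small: "cut_small V (\<lambda>n x y. U n x y * codeg U n x y - p ^ 3)"
  shows "cut_small V (\<lambda>n x y. U n x y - p)"
proof -
  define q where "q = p ^ 3"
  have q: "0 < q" "q \<le> 1" "q \<le> p"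
    using p power_decreasing[of 1 3 p] by (auto simp: q_def power_le_one)
  define f where "f = codeg U"
  have f01: "f n x y \<in> {0..1}" if "x \<in> V n" "y \<in> V n" for n x y
    unfolding f_def by (rule codeg_range[OF that U])
  have fsym: "f n x y = f n y x" for n x y
    unfolding f_def codeg_def by (rule mean_cong) (simp add: sym mult.commute)
  define D where "D n x y = U n x y * f n x y - q" for n x y
  have D: "cut_small V D" using small by (simp add: D_def[abs_def] f_def q_def)
  have D1: "\<forall>n. \<forall>x\<in>V n. \<forall>y\<in>V n. \<bar>D n x y\<bar> \<le> 1"
  proof (intro allI ballI)
    fix n x y assume xy: "x \<in> V n" "y \<in> V n"
    have "0 \<le> U n x y * f n x y" "U n x y * f n x y \<le> 1"
      using U xy f01[OF xy] mult_le_one[of "U n x y" "f n x y"] by auto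
    then show "\<bar>D n x y\<bar> \<le> 1" using q by (auto simp: D_def)
  qed
  \<comment> \<open>The deficit of the codegree below \<open>q\<close>. Since
    \<open>U \<le> 1\<close>, one has \<open>D \<le> f - q\<close>, which is
    \<open>- \<psi> (f)\<close> where the deficit is positive. Testing \<open>D\<close> against
    \<open>\<psi> (f)\<close> thus bounds the mean square of the deficit.\<close>
  define \<psi> where "\<psi> t = max (q - t) 0" for t :: real
  have "cut_small V (\<lambda>n x y. D n x y * \<psi> (f n x y))"
    unfolding f_def \<psi>_def
    by (rule cut_small_mult_codeg_continuous[OF D D1 U]) (intro continuous_intros)
  from cut_smallD[OF this, of "\<lambda>_ _. 1" 1 "\<lambda>_ _. 1" 1]
  have "(\<lambda>n. mean2 (V n) (\<lambda>x y. D n x y * \<psi> (f n x y))) \<longlonglongrightarrow> 0" by simp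
  then have "(\<lambda>n. - mean2 (V n) (\<lambda>x y. D n x y * \<psi> (f n x y))) \<longlonglongrightarrow> 0"
    using tendsto_minus by force
  then have "(\<lambda>n. mean2 (V n) (\<lambda>x y. (\<psi> (f n x y))\<^sup>2)) \<longlonglongrightarrow> 0"
  proof (rule Lim_null_comparison[rotated], intro always_eventually allI)
    fix n
    have "(\<psi> (f n x y))\<^sup>2 \<le> -1 * (D n x y * \<psi> (f n x y))" if "x \<in> V n" "y \<in> V n" for x y
    proof -
      have "U n x y * f n x y \<le> f n x y"
        using U that f01[OF that] by (simp add: mult_left_le_one_le)
      then have "\<psi> (f n x y) * \<psi> (f n x y) \<le> (q - U n x y * f n x y) * \<psi> (f n x y)"
        by (cases "f n x y \<le> q") (auto simp: \<psi>_def intro: mult_right_mono)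
      then show ?thesis by (simp add: D_def power2_eq_square algebra_simps)
    qed
    then have "mean2 (V n) (\<lambda>x y. (\<psi> (f n x y))\<^sup>2) \<le> mean2 (V n) (\<lambda>x y. -1 * (D n x y * \<psi> (f n x y)))"
      by (rule mean2_mono)
    moreover have "0 \<le> mean2 (V n) (\<lambda>x y. (\<psi> (f n x y))\<^sup>2)" by (rule mean2_nonneg) simp
    ultimately show "norm (mean2 (V n) (\<lambda>x y. (\<psi> (f n x y))\<^sup>2)) \<le> - mean2 (V n) (\<lambda>x y. D n x y * \<psi> (f n x y))"
      unfolding mean2_cmult by simp
  qed
  then have psi0: "(\<lambda>n. mean2 (V n) (\<lambda>x y. \<bar>\<psi> (f n x y)\<bar>)) \<longlonglongrightarrow> 0"
    by (rule mean2_abs_tendsto)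
  define m where "m n x y = max (f n x y) q" for n x y
  have m: "q \<le> m n x y" "m n x y > 0" "m n x y = f n x y + \<psi> (f n x y)" for n x y
    using q by (auto simp: m_def \<psi>_def max_def)
  have m1: "m n x y \<le> 1" if "x \<in> V n" "y \<in> V n" for n x y
    using f01[OF that] q by (auto simp: m_def)
  define g where "g n x y = q / m n x y" for n x y
  have g: "q \<le> g n x y" "g n x y \<le> 1" "0 < g n x y" if "x \<in> V n" "y \<in> V n" for n x y
    using m(1,2)[where n=n and x=x and y=y] m1[OF that] q
    by (simp_all add: g_def pos_le_divide_eq mult_left_le)
  have gsym: "g n x y = g n y x" for n x y by (simp add: g_def m_def fsym)
  have gm: "g n x y * m n x y = q" for n x y
    using m(2)[where n=n and x=x and y=y] by (simp add: g_def)
  \<comment> \<open>From \<open>U m = U f + U \<psi> = D + q + U \<psi>\<close>, division by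
    \<open>m\<close> gives \<open>U - g = D / m + \<psi> U / m\<close>. The first term is a multiple
    of \<open>D\<close> by a continuous function of the codegree; the second is small in
    mean.\<close>
  have Ug: "cut_small V (\<lambda>n x y. U n x y - g n x y)"
  proof -
    have 1: "cut_small V (\<lambda>n x y. D n x y * (1 / m n x y))"
      unfolding m_def f_def
      by (rule cut_small_mult_codeg_continuous[OF D D1 U, of "\<lambda>t. 1 / max t q"])
        (use q in \<open>auto intro!: continuous_intros\<close>)
    have "\<forall>n. \<forall>x\<in>V n. \<forall>y\<in>V n. \<bar>\<bar>U n x y / m n x y\<bar>\<bar> \<le> 1 / q"
      using U m(1,2) q by (auto simp: abs_divide abs_of_pos intro!: frac_le)
    from mean2_abs_bound_tendsto[OF psi0 this]
    have "(\<lambda>n. mean2 (V n) (\<lambda>x y. \<bar>\<psi> (f n x y) * (U n x y / m n x y)\<bar>)) \<longlonglongrightarrow> 0"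
      by (simp add: abs_mult \<psi>_def)
    then have 2: "cut_small V (\<lambda>n x y. \<psi> (f n x y) * (U n x y / m n x y))"
      by (rule cut_small_abs)
    have "D n x y * (1 / m n x y) + \<psi> (f n x y) * (U n x y / m n x y) = U n x y - g n x y" for n x y
    proof -
      have "\<psi> (f n x y) = m n x y - f n x y" by (simp add: m(3))
      then show ?thesis
        using m(2)[where n=n and x=x and y=y] by (simp only: D_def g_def) (simp add: field_simps)
    qed
    with cut_small_add[OF 1 2] show ?thesis by simp
  qed
  define v where "v n x y = ln (g n x y / p)" for n x y
  \<comment> \<open>As \<open>g\<close> lies between \<open>p ^ 3\<close> and 1,
    \<open>v = ln g - ln p\<close> lies between \<open>2 * ln p\<close> and
    \<open>- ln p\<close>.\<close>
  define M where "M = - 2 * ln p"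
  have M: "M \<ge> 0" using p by (simp add: M_def)
  have v: "\<bar>v n x y\<bar> \<le> M" if "x \<in> V n" "y \<in> V n" for n x y
  proof -
    have "ln q \<le> ln (g n x y)" "ln (g n x y) \<le> 0"
      using g[OF that] q by auto
    moreover have "ln q = 3 * ln p" using p by (simp add: q_def ln_realpow)
    moreover have "v n x y = ln (g n x y) - ln p" using g[OF that] p by (simp add: v_def ln_div)
    moreover have "ln p \<le> 0" using p by simp
    ultimately show ?thesis unfolding M_def by linarith
  qed
  have vsym: "v n x y = v n y x" for n x y by (simp add: v_def gsym)
  have gv: "g n x y = p * exp (v n x y)" if "x \<in> V n" "y \<in> V n" for n x y
    using g[OF that] p by (simp add: v_def)
  define r where "r n x y = v n x y * g n x y" for n x y
  have r: "\<bar>r n x y\<bar> \<le> M" if "x \<in> V n" "y \<in> V n" for n x y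
    using mult_mono[OF v[OF that], of "\<bar>g n x y\<bar>" 1] g[OF that] M by (simp add: r_def abs_mult)
  \<comment> \<open>Both \<open>codeg g\<close> and \<open>f = codeg U\<close> are quadratic.
    Exchanging \<open>U\<close> for \<open>g\<close> one factor at a time leaves terms linear in
    \<open>U - g\<close>, and for each third vertex the remaining factors are test
    functions.\<close>
  have lim1: "(\<lambda>n. mean2 (V n) (\<lambda>x y. r n x y * (codeg g n x y - f n x y))) \<longlonglongrightarrow> 0"
  proof -
    let ?\<Delta> = "\<lambda>n x y. U n x y - g n x y"
    have "(\<lambda>n. mean (V n) (\<lambda>w. mean2 (V n) (\<lambda>x y. ?\<Delta> n x y * r n x w * g n y w))) \<longlonglongrightarrow> 0"
      by (rule cut_small_mean[OF Ug, of _ M _ 1]) (use r g in fastforce)+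
    moreover have "(\<lambda>n. mean (V n) (\<lambda>w. mean2 (V n) (\<lambda>x y. ?\<Delta> n x y * U n w x * r n w y))) \<longlonglongrightarrow> 0"
      by (rule cut_small_mean[OF Ug, of _ 1 _ M]) (use r U in auto)
    ultimately have *: "(\<lambda>n. - (mean (V n) (\<lambda>w. mean2 (V n) (\<lambda>x y. ?\<Delta> n x y * r n x w * g n y w))
        + mean (V n) (\<lambda>w. mean2 (V n) (\<lambda>x y. ?\<Delta> n x y * U n w x * r n w y)))) \<longlonglongrightarrow> 0"
      using tendsto_minus[OF tendsto_add] by fastforce
    have e1: "mean (V n) (\<lambda>w. mean2 (V n) (\<lambda>x y. ?\<Delta> n x y * r n x w * g n y w))
      = mean2 (V n) (\<lambda>x w. mean (V n) (\<lambda>z. r n x w * (?\<Delta> n x z * g n z w)))" for n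
      unfolding mean2_def by (subst mean_swap) (simp add: mult_ac)
    have e2: "mean (V n) (\<lambda>w. mean2 (V n) (\<lambda>x y. ?\<Delta> n x y * U n w x * r n w y))
      = mean2 (V n) (\<lambda>w y. mean (V n) (\<lambda>z. r n w y * (U n w z * ?\<Delta> n z y)))" for n
      unfolding mean2_def by (rule mean_cong, subst mean_swap) (simp add: mult_ac)
    have e3: "codeg g n x y - f n x y =
      - (mean (V n) (\<lambda>z. ?\<Delta> n x z * g n z y) + mean (V n) (\<lambda>z. U n x z * ?\<Delta> n z y))" for n x y
      unfolding f_def codeg_def mean_add[symmetric] mean_diff[symmetric] mean_uminus[symmetric]
      by (rule mean_cong) (simp add: algebra_simps)
    have "mean2 (V n) (\<lambda>x y. r n x y * (codeg g n x y - f n x y)) =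
       - (mean (V n) (\<lambda>w. mean2 (V n) (\<lambda>x y. ?\<Delta> n x y * r n x w * g n y w))
        + mean (V n) (\<lambda>w. mean2 (V n) (\<lambda>x y. ?\<Delta> n x y * U n w x * r n w y)))" for n
      unfolding e1 e2 e3 mean_cmult mean2_add[symmetric] mean2_uminus[symmetric]
      by (rule mean2_cong) (simp only: distrib_left mult_minus_right)
    with * show ?thesis by simp
  qed
  have lim2: "(\<lambda>n. mean2 (V n) (\<lambda>x y. \<psi> (f n x y) * - r n x y)) \<longlonglongrightarrow> 0"
    by (rule mean2_abs_bound_tendsto[OF psi0, of _ M]) (use r in auto)
  \<comment> \<open>\<open>Y n\<close> is \<open>q\<close> times the derivative of the convex
    functional at \<open>v\<close> in the direction \<open>v\<close>.\<close>
  define Y where "Y n = mean2 (V n) (\<lambda>x y. v n x y * (g n x y * codeg g n x y - q))" for n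
  have Y_eq: "Y n = mean2 (V n) (\<lambda>x y. r n x y * (codeg g n x y - f n x y))
      + mean2 (V n) (\<lambda>x y. \<psi> (f n x y) * - r n x y)" for n
    unfolding Y_def mean2_add[symmetric]
  proof (rule mean2_cong)
    fix x y
    have "q = g n x y * f n x y + g n x y * \<psi> (f n x y)"
      using gm[of n x y] by (simp add: m(3) distrib_left)
    then show "v n x y * (g n x y * codeg g n x y - q) = r n x y * (codeg g n x y - f n x y) + \<psi> (f n x y) * - r n x y"
      unfolding r_def by (simp only:) (simp add: algebra_simps)
  qed
  have "(\<lambda>n. Y n) \<longlonglongrightarrow> 0" unfolding Y_eq using tendsto_add[OF lim1 lim2] by simp
  then have Y: "Y \<longlonglongrightarrow> 0" .
  \<comment> \<open>The sum \<open>s\<close> of three values of \<open>v\<close> is at most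
    \<open>3 * M\<close> in absolute value, and the triangle weight is
    \<open>q * exp s\<close>.\<close>
  define c where "c = q * exp (- (3 * M))"
  have c: "c > 0" using q by (simp add: c_def)
  have key: "3 * (c * mean2 (V n) (\<lambda>x y. (v n x y)\<^sup>2)) \<le> 3 * Y n" for n
  proof -
    let ?E = "\<lambda>F. mean2 (V n) (\<lambda>x y. mean (V n) (F x y))"
    define T where "T x y z = g n x y * g n y z * g n z x" for x y z
    define s where "s x y z = v n x y + v n y z + v n z x" for x y z
    have rot: "?E (\<lambda>x y z. F y z x) = ?E F" for F by (rule mean_mean2_rotate)
    have rot2: "?E (\<lambda>x y z. F z x y) = ?E F" for F
      using rot[of "\<lambda>x y z. F y z x"] rot[of F] by simp
    have T: "T x y z = q * exp (s x y z)" if "x \<in> V n" "y \<in> V n" "z \<in> V n" for x y z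
      using that by (simp add: T_def s_def gv q_def exp_add power3_eq_cube)
    have "c * (s x y z)\<^sup>2 \<le> (T x y z - q) * s x y z" if "x \<in> V n" "y \<in> V n" "z \<in> V n" for x y z
    proof -
      have "\<bar>s x y z\<bar> \<le> 3 * M"
        using v[OF that(1,2)] v[OF that(2,3)] v[OF that(3,1)] unfolding s_def by linarith
      from mult_left_mono[OF exp_minus_one_mult_ge[OF this], of q] q
      show ?thesis by (simp add: T[OF that] c_def algebra_simps)
    qed
    then have "?E (\<lambda>x y z. c * (s x y z)\<^sup>2) \<le> ?E (\<lambda>x y z. (T x y z - q) * s x y z)"
      by (intro mean2_mono mean_mono)
    \<comment> \<open>\<open>T\<close> is invariant under cyclic shifts, so each summand of
      \<open>s\<close> contributes a rotated copy of the same integrand.\<close>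
    also have "\<dots> = ?E (\<lambda>x y z. (T x y z - q) * v n x y) + ?E (\<lambda>x y z. (T y z x - q) * v n y z)
      + ?E (\<lambda>x y z. (T z x y - q) * v n z x)"
      unfolding mean2_add[symmetric] mean_add[symmetric]
      by (intro mean2_cong mean_cong) (simp add: s_def T_def algebra_simps)
    also have "\<dots> = 3 * ?E (\<lambda>x y z. (T x y z - q) * v n x y)"
      unfolding rot[of "\<lambda>x y z. (T x y z - q) * v n x y"] rot2[of "\<lambda>x y z. (T x y z - q) * v n x y"] by simp
    also have "?E (\<lambda>x y z. (T x y z - q) * v n x y) = Y n"
      unfolding Y_def
    proof (rule mean2_cong)
      fix x y
      have "mean (V n) (\<lambda>z. (T x y z - q) * v n x y) =
        (g n x y * mean (V n) (\<lambda>z. g n y z * g n z x) - mean (V n) (\<lambda>_. q)) * v n x y"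
        unfolding mean_cmult[symmetric] mean_diff[symmetric] mean_multc[symmetric]
        by (rule mean_cong) (simp add: T_def algebra_simps)
      also have "mean (V n) (\<lambda>z. g n y z * g n z x) = codeg g n x y"
        unfolding codeg_def by (rule mean_cong) (metis gsym mult.commute)
      finally show "mean (V n) (\<lambda>z. (T x y z - q) * v n x y) = v n x y * (g n x y * codeg g n x y - q)"
        by (simp add: mean_const[OF finite_V nonempty_V])
    qed
    finally have upper: "c * ?E (\<lambda>x y z. (s x y z)\<^sup>2) \<le> 3 * Y n"
      by (simp add: mean_cmult mean2_cmult)
    define S1 where "S1 = ?E (\<lambda>x y z. (v n x y)\<^sup>2)"
    define S2 where "S2 = ?E (\<lambda>x y z. v n x y * v n y z)"
    have "?E (\<lambda>x y z. (s x y z)\<^sup>2) = (?E (\<lambda>x y z. (v n x y)\<^sup>2) + ?E (\<lambda>x y z. (v n y z)\<^sup>2) + ?E (\<lambda>x y z. (v n z x)\<^sup>2))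
       + 2 * (?E (\<lambda>x y z. v n x y * v n y z) + ?E (\<lambda>x y z. v n y z * v n z x) + ?E (\<lambda>x y z. v n z x * v n x y))"
      unfolding mean2_add[symmetric] mean_add[symmetric] mean2_cmult[symmetric] mean_cmult[symmetric]
      by (intro mean2_cong mean_cong) (simp add: s_def power2_eq_square algebra_simps)
    also have "\<dots> = 3 * S1 + 6 * S2"
      using rot[of "\<lambda>x y z. (v n x y)\<^sup>2"] rot2[of "\<lambda>x y z. (v n x y)\<^sup>2"]
        rot[of "\<lambda>x y z. v n x y * v n y z"] rot2[of "\<lambda>x y z. v n x y * v n y z"]
      by (simp add: S1_def S2_def)
    finally have expand: "?E (\<lambda>x y z. (s x y z)\<^sup>2) = 3 * S1 + 6 * S2" .
    have "S2 = mean (V n) (\<lambda>y. mean (V n) (\<lambda>x. v n x y * mean (V n) (v n y)))"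
      unfolding S2_def mean2_def by (subst mean_swap) (simp add: mean_cmult)
    also have "\<dots> = mean (V n) (\<lambda>y. mean (V n) (v n y) * mean (V n) (v n y))"
      unfolding mean_multc
    proof (rule mean_cong)
      fix y
      have "mean (V n) (\<lambda>x. v n x y) = mean (V n) (v n y)"
        by (rule mean_cong) (rule vsym)
      then show "mean (V n) (\<lambda>x. v n x y) * mean (V n) (v n y) = mean (V n) (v n y) * mean (V n) (v n y)"
        by simp
    qed
    finally have "S2 \<ge> 0" by (simp add: mean_nonneg)
    moreover have "S1 = mean2 (V n) (\<lambda>x y. (v n x y)\<^sup>2)"
      by (simp add: S1_def mean_const[OF finite_V nonempty_V])
    ultimately have "3 * mean2 (V n) (\<lambda>x y. (v n x y)\<^sup>2) \<le> ?E (\<lambda>x y z. (s x y z)\<^sup>2)"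
      using expand by simp
    then have "c * (3 * mean2 (V n) (\<lambda>x y. (v n x y)\<^sup>2)) \<le> c * ?E (\<lambda>x y z. (s x y z)\<^sup>2)"
      using c by (intro mult_left_mono) auto
    then show ?thesis using upper by linarith
  qed
  have "(\<lambda>n. mean2 (V n) (\<lambda>x y. (v n x y)\<^sup>2)) \<longlonglongrightarrow> 0"
  proof (rule Lim_null_comparison[OF always_eventually])
    show "(\<lambda>n. Y n / c) \<longlonglongrightarrow> 0" using tendsto_divide[OF Y tendsto_const[of c]] c by simp
    show "\<forall>n. norm (mean2 (V n) (\<lambda>x y. (v n x y)\<^sup>2)) \<le> Y n / c"
      using key c by (auto simp: field_simps mean2_nonneg)
  qed
  then have v0: "(\<lambda>n. mean2 (V n) (\<lambda>x y. \<bar>v n x y\<bar>)) \<longlonglongrightarrow> 0" by (rule mean2_abs_tendsto)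
  have "(\<lambda>n. mean2 (V n) (\<lambda>x y. \<bar>g n x y - p\<bar>)) \<longlonglongrightarrow> 0"
  proof (rule Lim_null_comparison[OF always_eventually v0], rule allI)
    fix n
    have "mean2 (V n) (\<lambda>x y. \<bar>g n x y - p\<bar>) \<le> mean2 (V n) (\<lambda>x y. \<bar>v n x y\<bar>)"
      unfolding v_def by (intro mean2_mono abs_diff_le_ln_quotient) (use g p in auto)
    then show "norm (mean2 (V n) (\<lambda>x y. \<bar>g n x y - p\<bar>)) \<le> mean2 (V n) (\<lambda>x y. \<bar>v n x y\<bar>)"
      by (simp add: mean2_nonneg)
  qed
  from cut_small_add[OF Ug cut_small_abs[OF this]] show ?thesis by simp
qed

end

section \<open>Walk kernels\<close>

definition kernel_op :: "'v set \<Rightarrow> ('v \<Rightarrow> 'v \<Rightarrow> real) \<Rightarrow> ('v \<Rightarrow> real) \<Rightarrow> 'v \<Rightarrow> real" where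
  "kernel_op V U y x = mean V (\<lambda>z. U x z * y z)"

text \<open>The normalised number of walks with \<open>Suc j\<close> (not \<open>j\<close>) edges.\<close>

fun walk :: "'v set \<Rightarrow> ('v \<Rightarrow> 'v \<Rightarrow> real) \<Rightarrow> nat \<Rightarrow> 'v \<Rightarrow> 'v \<Rightarrow> real" where
  "walk V U 0 x y = U x y"
| "walk V U (Suc j) x y = mean V (\<lambda>z. walk V U j x z * U z y)"

definition sqnorm :: "'v set \<Rightarrow> ('v \<Rightarrow> real) \<Rightarrow> real" where
  "sqnorm V y = mean V (\<lambda>x. (y x)\<^sup>2)"

lemma kernel_op_walk: "kernel_op V (walk V U j) y = (kernel_op V U ^^ Suc j) y"
proof (induction j arbitrary: y)
  case 0
  then show ?case by (simp add: kernel_op_def[abs_def])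
next
  case (Suc j)
  have "kernel_op V (walk V U (Suc j)) y x = kernel_op V (walk V U j) (kernel_op V U y) x" for x
  proof -
    have "kernel_op V (walk V U (Suc j)) y x = mean V (\<lambda>z. mean V (\<lambda>t. walk V U j x t * (U t z * y z)))"
      by (simp add: kernel_op_def mean_multc[symmetric] mult.assoc)
    also have "\<dots> = kernel_op V (walk V U j) (kernel_op V U y) x"
      by (subst mean_swap) (simp add: kernel_op_def mean_cmult)
    finally show ?thesis .
  qed
  then have "kernel_op V (walk V U (Suc j)) y = kernel_op V (walk V U j) (kernel_op V U y)" by blast
  also have "\<dots> = (kernel_op V U ^^ Suc j) (kernel_op V U y)" by (rule Suc.IH)
  finally show ?case by (simp only: funpow_Suc_right o_apply)
qed

lemma kernel_op_add: "kernel_op V U (\<lambda>x. f x + g x) x = kernel_op V U f x + kernel_op V U g x"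
  by (simp add: kernel_op_def distrib_left mean_add)

lemma kernel_op_diff: "kernel_op V U (\<lambda>x. f x - g x) x = kernel_op V U f x - kernel_op V U g x"
  by (simp add: kernel_op_def right_diff_distrib mean_diff)

lemma kernel_op_cmult: "kernel_op V U (\<lambda>x. c * f x) x = c * kernel_op V U f x"
  by (simp add: kernel_op_def mean_cmult[symmetric] mult_ac)

lemma sqnorm_nonneg: "0 \<le> sqnorm V y"
  by (simp add: sqnorm_def mean_nonneg)

text \<open>A triangle inequality for squared norms with a lost factor; it avoids square roots and
  suffices for limits equal to 0.\<close>

lemma sqnorm_add_le: "sqnorm V (\<lambda>x. f x + g x) \<le> 2 * sqnorm V f + 2 * sqnorm V g"
proof -
  have "(f x + g x)\<^sup>2 \<le> 2 * (f x)\<^sup>2 + 2 * (g x)\<^sup>2" for x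
    using sum_squares_bound[of "f x" "g x"] by (simp add: power2_sum)
  then show ?thesis
    unfolding sqnorm_def mean_cmult[symmetric] mean_add[symmetric] by (intro mean_mono)
qed

lemma sqnorm_diff_le: "sqnorm V (\<lambda>x. f x - g x) \<le> 2 * sqnorm V f + 2 * sqnorm V g"
  using sqnorm_add_le[of V f "\<lambda>x. - g x"] by (simp add: sqnorm_def)

lemma sqnorm_cmult: "sqnorm V (\<lambda>x. c * f x) = c\<^sup>2 * sqnorm V f"
  by (simp add: sqnorm_def power_mult_distrib mean_cmult)

lemma tendsto_zero_le_twice:
  fixes f g h :: "nat \<Rightarrow> real"
  assumes "f \<longlonglongrightarrow> 0" "g \<longlonglongrightarrow> 0" "\<And>n. \<bar>h n\<bar> \<le> 2 * f n + 2 * g n"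
  shows "h \<longlonglongrightarrow> 0"
proof (rule Lim_null_comparison)
  show "(\<lambda>n. 2 * f n + 2 * g n) \<longlonglongrightarrow> 0"
    using tendsto_add[OF tendsto_mult_left[OF assms(1), of 2] tendsto_mult_left[OF assms(2), of 2]] by simp
qed (use assms(3) in auto)

lemma kernel_op_bound:
  assumes "\<forall>x\<in>V. \<forall>y\<in>V. \<bar>U x y\<bar> \<le> 1" "\<forall>x\<in>V. \<bar>y x\<bar> \<le> c" "0 \<le> c" "x \<in> V"
  shows "\<bar>kernel_op V U y x\<bar> \<le> c"
  unfolding kernel_op_def
proof (rule abs_mean_bound)
  fix z assume "z \<in> V"
  then have "\<bar>U x z\<bar> * \<bar>y z\<bar> \<le> 1 * c"
    using assms by (intro mult_mono) auto
  then show "\<bar>U x z * y z\<bar> \<le> c" by (simp add: abs_mult)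
qed (use assms in simp)

lemma sqnorm_kernel_op_le:
  assumes "\<forall>x\<in>V. \<forall>y\<in>V. \<bar>U x y\<bar> \<le> 1"
  shows "sqnorm V (kernel_op V U y) \<le> sqnorm V y"
  unfolding sqnorm_def
proof (rule mean_le_bound)
  fix x assume x: "x \<in> V"
  have "(kernel_op V U y x)\<^sup>2 \<le> mean V (\<lambda>z. (U x z * y z)\<^sup>2)"
    unfolding kernel_op_def by (rule mean_power2_le)
  also have "\<dots> \<le> mean V (\<lambda>z. (y z)\<^sup>2)"
  proof (rule mean_mono)
    fix z assume "z \<in> V"
    then have "(U x z)\<^sup>2 \<le> 1" using assms x by (simp add: abs_square_le_1)
    then show "(U x z * y z)\<^sup>2 \<le> (y z)\<^sup>2"
      using mult_right_mono[of "(U x z)\<^sup>2" 1 "(y z)\<^sup>2"] by (simp add: power_mult_distrib)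
  qed
  finally show "(kernel_op V U y x)\<^sup>2 \<le> mean V (\<lambda>z. (y z)\<^sup>2)" .
qed (simp add: mean_nonneg)

lemma kernel_op_self_adjoint:
  assumes "\<And>x y. U x y = U y x"
  shows "mean V (\<lambda>x. f x * kernel_op V U g x) = mean V (\<lambda>x. kernel_op V U f x * g x)"
proof -
  have "mean V (\<lambda>x. f x * kernel_op V U g x) = mean V (\<lambda>x. mean V (\<lambda>z. f x * (U x z * g z)))"
    by (simp add: kernel_op_def mean_cmult)
  also have "\<dots> = mean V (\<lambda>z. mean V (\<lambda>x. U z x * f x * g z))"
    by (subst mean_swap) (use assms in \<open>simp add: mult_ac\<close>)
  finally show ?thesis by (simp add: kernel_op_def mean_multc)
qed

text \<open>Self-adjointness rewrites the squared norm of \<open>A y\<close> as the inner product of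
  \<open>y\<close> with \<open>A (A y)\<close>, to which Cauchy-Schwarz applies.\<close>

lemma sqnorm_kernel_op_log_convex:
  assumes "\<And>x y. U x y = U y x"
  shows "(sqnorm V (kernel_op V U y))\<^sup>2 \<le> sqnorm V y * sqnorm V (kernel_op V U (kernel_op V U y))"
proof -
  have "sqnorm V (kernel_op V U y) = mean V (\<lambda>x. y x * kernel_op V U (kernel_op V U y) x)"
    using kernel_op_self_adjoint[where U=U and V=V, OF assms, of y "kernel_op V U y"]
    by (simp add: sqnorm_def power2_eq_square)
  then show ?thesis using mean_Cauchy_Schwarz unfolding sqnorm_def by metis
qed

context vertex_sets
begin

text \<open>
  Let \<open>A\<close> be the normalised adjacency operator. As \<open>A\<close> commutes with \<open>A\<^sup>k\<close>, which is close to a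
  multiple of the projection onto constants, the constants are approximate eigenvectors of \<open>A\<close>.
  On functions \<open>y\<close> of mean zero \<open>A\<^sup>k y\<close> is small, hence so is \<open>A y\<close>, since the norms of
  \<open>A\<^sup>j y\<close> are log-convex in \<open>j\<close>.
\<close>

lemma cut_small_walk_kernel:
  assumes U: "\<forall>n. \<forall>x\<in>V n. \<forall>y\<in>V n. 0 \<le> U n x y \<and> U n x y \<le> 1"
    and sym: "\<And>n x y. U n x y = U n y x"
    and p: "0 < p" "p \<le> 1"
    and small: "cut_small V (\<lambda>n x y. walk (V n) (U n) j x y - p ^ Suc j)"
  shows "cut_small V (\<lambda>n x y. U n x y - p)"
proof -
  define k q where "k = Suc j" and "q = p ^ k"
  have q: "0 < q" "q \<le> 1" using p by (auto simp: q_def power_le_one)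
  define A where "A n = kernel_op (V n) (U n)" for n
  have U1: "\<forall>x\<in>V n. \<forall>y\<in>V n. \<bar>U n x y\<bar> \<le> 1" for n using U by auto
  have contr: "sqnorm (V n) (A n y) \<le> sqnorm (V n) y" for n y
    unfolding A_def by (rule sqnorm_kernel_op_le[OF U1])
  have pow_bound: "\<bar>(A n ^^ i) y x\<bar> \<le> c" if "\<forall>x\<in>V n. \<bar>y x\<bar> \<le> c" "0 \<le> c" "x \<in> V n" for n i y c x
    using that(3)
  proof (induction i arbitrary: x)
    case (Suc i)
    then show ?case using kernel_op_bound[OF U1[of n], of "(A n ^^ i) y" c x] that by (simp add: A_def)
  qed (use that in auto)
  \<comment> \<open>The kernel difference is tested against \<open>y\<close> and its own residual
    \<open>b\<close>; the resulting average is exactly the squared norm of \<open>b\<close>.\<close>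
  have lim: "(\<lambda>n. sqnorm (V n) (\<lambda>x. (A n ^^ k) (y n) x - q * mean (V n) (y n))) \<longlonglongrightarrow> 0"
    if y: "\<forall>n. \<forall>x\<in>V n. \<bar>y n x\<bar> \<le> 1" for y
  proof -
    define b where "b n x = (A n ^^ k) (y n) x - q * mean (V n) (y n)" for n x
    have b: "b n x = mean (V n) (\<lambda>z. (walk (V n) (U n) j x z - q) * y n z)" for n x
      using fun_cong[OF kernel_op_walk[of "V n" "U n" j "y n"], of x]
      by (simp add: b_def A_def k_def kernel_op_def left_diff_distrib mean_diff mean_cmult del: funpow.simps)
    have "\<bar>b n x\<bar> \<le> 2" if "x \<in> V n" for n x
    proof -
      have "\<bar>mean (V n) (y n)\<bar> \<le> 1" using y by (intro abs_mean_bound) auto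
      then have "\<bar>q * mean (V n) (y n)\<bar> \<le> 1" using q by (simp add: abs_mult mult_le_one)
      moreover have "\<bar>(A n ^^ k) (y n) x\<bar> \<le> 1" using y that by (intro pow_bound) auto
      ultimately show ?thesis unfolding b_def by linarith
    qed
    then have "(\<lambda>n. mean2 (V n) (\<lambda>x z. (walk (V n) (U n) j x z - p ^ Suc j) * b n x * y n z)) \<longlonglongrightarrow> 0"
      by (intro cut_smallD[OF small, of b 2 y 1]) (use y in auto)
    moreover have "mean2 (V n) (\<lambda>x z. (walk (V n) (U n) j x z - p ^ Suc j) * b n x * y n z) = sqnorm (V n) (b n)" for n
    proof -
      have "mean2 (V n) (\<lambda>x z. (walk (V n) (U n) j x z - p ^ Suc j) * b n x * y n z)
        = mean (V n) (\<lambda>x. b n x * mean (V n) (\<lambda>z. (walk (V n) (U n) j x z - q) * y n z))"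
        by (simp add: mean2_def mean_cmult[symmetric] q_def k_def mult_ac)
      then show ?thesis by (simp add: b[symmetric] sqnorm_def power2_eq_square)
    qed
    ultimately show ?thesis by (simp add: b_def[abs_def])
  qed
  define one where "one = (\<lambda>_ :: 'v. 1 :: real)"
  define d where "d n = A n one" for n
  define \<delta> where "\<delta> n = mean (V n) (d n)" for n
  have d: "\<bar>d n x\<bar> \<le> 1" if "x \<in> V n" for n x
    using pow_bound[of n one 1 x 1] that by (simp add: d_def one_def)
  have lim_one: "(\<lambda>n. sqnorm (V n) (\<lambda>x. (A n ^^ k) one x - q)) \<longlonglongrightarrow> 0"
    using lim[of "\<lambda>_. one"] by (simp add: one_def mean_const[OF finite_V nonempty_V])
  \<comment> \<open>With \<open>d = A one\<close>, commuting \<open>A\<close> past its power gives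
    \<open>(A ^^ k) d - q * d = A ((A ^^ k) one - q * one)\<close>, and \<open>A\<close> is a
    contraction.\<close>
  have comm: "(\<lambda>n. sqnorm (V n) (\<lambda>x. (A n ^^ k) (d n) x - q * d n x)) \<longlonglongrightarrow> 0"
  proof (rule Lim_null_comparison[OF always_eventually lim_one], rule allI)
    fix n
    have "(A n ^^ k) (d n) x - q * d n x = A n (\<lambda>x. (A n ^^ k) one x - q * one x) x" for x
      by (simp add: d_def A_def kernel_op_diff kernel_op_cmult funpow_swap1)
    then show "norm (sqnorm (V n) (\<lambda>x. (A n ^^ k) (d n) x - q * d n x)) \<le> sqnorm (V n) (\<lambda>x. (A n ^^ k) one x - q)"
      using contr[of n "\<lambda>x. (A n ^^ k) one x - q * one x"] by (simp add: sqnorm_nonneg one_def)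
  qed
  have lim_d: "(\<lambda>n. sqnorm (V n) (\<lambda>x. (A n ^^ k) (d n) x - q * \<delta> n)) \<longlonglongrightarrow> 0"
    using lim[of d] d by (simp add: \<delta>_def)
  \<comment> \<open>The \<open>k\<close>-th power sends \<open>d\<close> close to
    \<open>q * \<delta>\<close> and also close to \<open>q * d\<close>; as \<open>q\<close> is
    positive, the degrees are nearly constant.\<close>
  have "(\<lambda>n. sqnorm (V n) (\<lambda>x. q * (d n x - \<delta> n))) \<longlonglongrightarrow> 0"
  proof (rule tendsto_zero_le_twice[OF lim_d comm])
    fix n
    show "\<bar>sqnorm (V n) (\<lambda>x. q * (d n x - \<delta> n))\<bar> \<le>
      2 * sqnorm (V n) (\<lambda>x. (A n ^^ k) (d n) x - q * \<delta> n) + 2 * sqnorm (V n) (\<lambda>x. (A n ^^ k) (d n) x - q * d n x)"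
      using sqnorm_diff_le[of "V n" "\<lambda>x. (A n ^^ k) (d n) x - q * \<delta> n" "\<lambda>x. (A n ^^ k) (d n) x - q * d n x"]
      by (simp add: sqnorm_nonneg algebra_simps)
  qed
  from tendsto_mult_left[OF this, of "1 / q\<^sup>2"]
  have reg: "(\<lambda>n. sqnorm (V n) (\<lambda>x. d n x - \<delta> n)) \<longlonglongrightarrow> 0"
    using q by (simp add: sqnorm_cmult)
  have \<delta>01: "0 \<le> \<delta> n" "\<delta> n \<le> 1" for n
    unfolding \<delta>_def d_def A_def kernel_op_def one_def
    using U by (auto intro!: mean_nonneg mean_le_bound)
  have powers: "(\<lambda>n. sqnorm (V n) (\<lambda>x. (A n ^^ i) one x - \<delta> n ^ i)) \<longlonglongrightarrow> 0" for i
  proof (induction i)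
    case 0
    then show ?case by (simp add: one_def sqnorm_def mean_def)
  next
    case (Suc i)
    show ?case
    proof (rule tendsto_zero_le_twice[OF Suc.IH reg])
      fix n
      have eq: "(A n ^^ Suc i) one x - \<delta> n ^ Suc i =
          A n (\<lambda>x. (A n ^^ i) one x - \<delta> n ^ i * one x) x + \<delta> n ^ i * (d n x - \<delta> n)" for x
        by (simp add: A_def d_def kernel_op_diff kernel_op_cmult) (simp add: algebra_simps)
      have "sqnorm (V n) (\<lambda>x. \<delta> n ^ i * (d n x - \<delta> n)) \<le> sqnorm (V n) (\<lambda>x. d n x - \<delta> n)"
        unfolding sqnorm_cmult using \<delta>01[of n] sqnorm_nonneg[of "V n" "\<lambda>x. d n x - \<delta> n"]
        by (intro mult_left_le_one_le) (auto simp: power_le_one)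
      moreover have "sqnorm (V n) (A n (\<lambda>x. (A n ^^ i) one x - \<delta> n ^ i * one x))
          \<le> sqnorm (V n) (\<lambda>x. (A n ^^ i) one x - \<delta> n ^ i)"
        using contr[of n "\<lambda>x. (A n ^^ i) one x - \<delta> n ^ i * one x"] by (simp add: one_def)
      ultimately show "\<bar>sqnorm (V n) (\<lambda>x. (A n ^^ Suc i) one x - \<delta> n ^ Suc i)\<bar> \<le>
         2 * sqnorm (V n) (\<lambda>x. (A n ^^ i) one x - \<delta> n ^ i) + 2 * sqnorm (V n) (\<lambda>x. d n x - \<delta> n)"
        using sqnorm_add_le[of "V n" "A n (\<lambda>x. (A n ^^ i) one x - \<delta> n ^ i * one x)" "\<lambda>x. \<delta> n ^ i * (d n x - \<delta> n)"]
        unfolding eq abs_of_nonneg[OF sqnorm_nonneg] by linarith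
    qed
  qed
  \<comment> \<open>The \<open>k\<close>-th power sends \<open>one\<close> close to both
    \<open>q\<close> and \<open>\<delta> ^ k\<close>. Since \<open>\<delta>\<close> is nonnegative,
    taking real roots then gives the limit \<open>p\<close>.\<close>
  have "(\<lambda>n. (q - \<delta> n ^ k)\<^sup>2) \<longlonglongrightarrow> 0"
  proof (rule tendsto_zero_le_twice[OF powers[of k] lim_one])
    fix n
    have "sqnorm (V n) (\<lambda>x. q - \<delta> n ^ k) = (q - \<delta> n ^ k)\<^sup>2"
      by (simp add: sqnorm_def mean_const[OF finite_V nonempty_V])
    then show "\<bar>(q - \<delta> n ^ k)\<^sup>2\<bar> \<le>
      2 * sqnorm (V n) (\<lambda>x. (A n ^^ k) one x - \<delta> n ^ k) + 2 * sqnorm (V n) (\<lambda>x. (A n ^^ k) one x - q)"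
      using sqnorm_diff_le[of "V n" "\<lambda>x. (A n ^^ k) one x - \<delta> n ^ k" "\<lambda>x. (A n ^^ k) one x - q"]
      by simp
  qed
  then have "(\<lambda>n. q - \<delta> n ^ k) \<longlonglongrightarrow> 0" by simp
  from tendsto_diff[OF tendsto_const[of q] this] have "(\<lambda>n. \<delta> n ^ k) \<longlonglongrightarrow> q" by simp
  then have "(\<lambda>n. root k (\<delta> n ^ k)) \<longlonglongrightarrow> root k q" by (rule tendsto_real_root)
  then have \<delta>: "\<delta> \<longlonglongrightarrow> p"
    using \<delta>01 p by (simp add: real_root_power_cancel k_def q_def del: power_Suc)
  have mean_zero: "(\<lambda>n. sqnorm (V n) (A n (y n))) \<longlonglongrightarrow> 0"
    if y: "\<forall>n. \<forall>x\<in>V n. \<bar>y n x\<bar> \<le> 1" and y0: "\<forall>n. mean (V n) (y n) = 0" for y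
  proof -
    have "(\<lambda>n. sqnorm (V n) ((A n ^^ k) (y n))) \<longlonglongrightarrow> 0"
      using lim[OF y] y0 by simp
    \<comment> \<open>One step of the descent from exponent \<open>k\<close> to exponent 1: by
      log-convexity the square of the middle term is at most the later term, because the earlier one
      is at most 1.\<close>
    moreover have "(\<lambda>n. sqnorm (V n) ((A n ^^ Suc i) (y n))) \<longlonglongrightarrow> 0"
      if "(\<lambda>n. sqnorm (V n) ((A n ^^ Suc (Suc i)) (y n))) \<longlonglongrightarrow> 0" for i
    proof -
      have "(\<lambda>n. (sqnorm (V n) ((A n ^^ Suc i) (y n)))\<^sup>2) \<longlonglongrightarrow> 0"
      proof (rule Lim_null_comparison[OF always_eventually that], rule allI)
        fix n
        have "((A n ^^ i) (y n) x)\<^sup>2 \<le> 1" if "x \<in> V n" for x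
          using pow_bound[of n "y n" 1 x i] y that by (simp add: abs_square_le_1)
        then have "sqnorm (V n) ((A n ^^ i) (y n)) \<le> 1"
          unfolding sqnorm_def by (intro mean_le_bound) auto
        then show "norm ((sqnorm (V n) ((A n ^^ Suc i) (y n)))\<^sup>2) \<le> sqnorm (V n) ((A n ^^ Suc (Suc i)) (y n))"
          using sqnorm_kernel_op_log_convex[of "U n" "V n" "(A n ^^ i) (y n)", OF sym]
            mult_right_mono[of "sqnorm (V n) ((A n ^^ i) (y n))" 1 "sqnorm (V n) ((A n ^^ Suc (Suc i)) (y n))"]
          by (simp add: A_def sqnorm_nonneg)
      qed
      then show ?thesis by simp
    qed
    then have "(\<lambda>n. sqnorm (V n) ((A n ^^ Suc 0) (y n))) \<longlonglongrightarrow> 0"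
      if "(\<lambda>n. sqnorm (V n) ((A n ^^ Suc i) (y n))) \<longlonglongrightarrow> 0" for i
      using that by (induction i) auto
    ultimately show ?thesis unfolding k_def by force
  qed
  show ?thesis
  proof (rule cut_smallI)
    fix a b :: "nat \<Rightarrow> 'v \<Rightarrow> real"
    assume a: "\<forall>n. \<forall>x\<in>V n. \<bar>a n x\<bar> \<le> 1" and b: "\<forall>n. \<forall>x\<in>V n. \<bar>b n x\<bar> \<le> 1"
    define \<mu> where "\<mu> n = mean (V n) (b n)" for n
    have \<mu>: "\<bar>\<mu> n\<bar> \<le> 1" for n unfolding \<mu>_def using b by (intro abs_mean_bound) auto
    \<comment> \<open>Halving keeps the centred function within \<open>[-1, 1]\<close>.\<close>
    define y where "y n x = (b n x - \<mu> n) / 2" for n x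
    have "\<bar>y n x\<bar> \<le> 1" if "x \<in> V n" for n x
    proof -
      have "\<bar>b n x\<bar> \<le> 1" using b that by blast
      then have "\<bar>b n x - \<mu> n\<bar> \<le> 2" using \<mu>[of n] by linarith
      then show ?thesis by (simp add: y_def)
    qed
    moreover have "mean (V n) (y n) = 0" for n
    proof -
      have "mean (V n) (y n) = mean (V n) (\<lambda>x. 1 / 2 * (b n x - \<mu> n))"
        by (rule mean_cong) (simp add: y_def)
      also have "\<dots> = 0"
        unfolding mean_cmult mean_diff mean_const[OF finite_V nonempty_V] by (simp add: \<mu>_def)
      finally show ?thesis .
    qed
    ultimately have lim_y: "(\<lambda>n. sqnorm (V n) (A n (y n))) \<longlonglongrightarrow> 0" by (intro mean_zero) auto
    have lim_p: "(\<lambda>n. (\<delta> n - p)\<^sup>2) \<longlonglongrightarrow> 0"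
      using tendsto_diff[OF \<delta> tendsto_const[of p]] by simp
    define h where "h n x = A n (b n) x - p * \<mu> n" for n x
    have eq: "mean2 (V n) (\<lambda>x z. (U n x z - p) * a n x * b n z) = mean (V n) (\<lambda>x. a n x * h n x)" for n
      unfolding mean2_def
    proof (rule mean_cong)
      fix x
      have "mean (V n) (\<lambda>z. (U n x z - p) * a n x * b n z) = a n x * mean (V n) (\<lambda>z. U n x z * b n z - p * b n z)"
        unfolding mean_cmult[symmetric] by (rule mean_cong) (simp add: algebra_simps)
      then show "mean (V n) (\<lambda>z. (U n x z - p) * a n x * b n z) = a n x * h n x"
        by (simp add: h_def A_def kernel_op_def \<mu>_def mean_diff mean_cmult)
    qed
    \<comment> \<open>The decomposition is
      \<open>h = 2 * A y + \<mu> * ((d - \<delta>) + (\<delta> - p))\<close>. Each splitting costs a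
      factor 2, and the coefficient 2 of \<open>A y\<close> contributes a factor 4.\<close>
    have bound: "(mean (V n) (\<lambda>x. a n x * h n x))\<^sup>2 \<le>
      8 * sqnorm (V n) (A n (y n)) + (4 * sqnorm (V n) (\<lambda>x. d n x - \<delta> n) + 4 * (\<delta> n - p)\<^sup>2)" for n
    proof -
      have "(a n x)\<^sup>2 \<le> 1" if "x \<in> V n" for x using a that by (simp add: abs_square_le_1)
      then have "mean (V n) (\<lambda>x. (a n x)\<^sup>2) \<le> 1" by (intro mean_le_bound) auto
      then have s0: "(mean (V n) (\<lambda>x. a n x * h n x))\<^sup>2 \<le> sqnorm (V n) (h n)"
        using mean_Cauchy_Schwarz[of "V n" "a n" "h n"] mult_right_mono[of _ 1 "sqnorm (V n) (h n)"]
        by (fastforce simp: sqnorm_def[symmetric] sqnorm_nonneg intro: order_trans)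
      have h: "h n x = 2 * A n (y n) x + \<mu> n * ((d n x - \<delta> n) + (\<delta> n - p))" for x
      proof -
        have "b n = (\<lambda>x. 2 * y n x + \<mu> n * one x)" by (rule ext) (simp add: y_def one_def field_simps)
        then have "A n (b n) x = 2 * A n (y n) x + \<mu> n * d n x"
          by (simp add: A_def d_def kernel_op_add kernel_op_cmult)
        then show ?thesis by (simp add: h_def algebra_simps)
      qed
      have s1: "sqnorm (V n) (h n) \<le> 2 * sqnorm (V n) (\<lambda>x. 2 * A n (y n) x)
          + 2 * sqnorm (V n) (\<lambda>x. \<mu> n * ((d n x - \<delta> n) + (\<delta> n - p)))"
        unfolding ext[where f = "h n", OF h] by (rule sqnorm_add_le)
      have s2: "sqnorm (V n) (\<lambda>x. \<mu> n * ((d n x - \<delta> n) + (\<delta> n - p))) \<le> sqnorm (V n) (\<lambda>x. (d n x - \<delta> n) + (\<delta> n - p))"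
        unfolding sqnorm_cmult using \<mu>[of n] by (intro mult_left_le_one_le) (auto simp: sqnorm_nonneg abs_square_le_1)
      have s3: "sqnorm (V n) (\<lambda>x. (d n x - \<delta> n) + (\<delta> n - p)) \<le> 2 * sqnorm (V n) (\<lambda>x. d n x - \<delta> n) + 2 * sqnorm (V n) (\<lambda>x. \<delta> n - p)"
        by (rule sqnorm_add_le)
      have s4: "sqnorm (V n) (\<lambda>x. \<delta> n - p) = (\<delta> n - p)\<^sup>2"
        by (simp add: sqnorm_def mean_const[OF finite_V nonempty_V])
      have s5: "sqnorm (V n) (\<lambda>x. 2 * A n (y n) x) = 4 * sqnorm (V n) (A n (y n))"
        by (simp add: sqnorm_cmult)
      show ?thesis using s0 s1 s2 s3 unfolding s4 s5 by linarith
    qed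
    have "(\<lambda>n. 8 * sqnorm (V n) (A n (y n)) + (4 * sqnorm (V n) (\<lambda>x. d n x - \<delta> n) + 4 * (\<delta> n - p)\<^sup>2)) \<longlonglongrightarrow> 0"
      using tendsto_add[OF tendsto_mult_left[OF lim_y, of 8]
          tendsto_add[OF tendsto_mult_left[OF reg, of 4] tendsto_mult_left[OF lim_p, of 4]]] by simp
    then have "(\<lambda>n. (mean (V n) (\<lambda>x. a n x * h n x))\<^sup>2) \<longlonglongrightarrow> 0"
      by (rule Lim_null_comparison[rotated]) (use bound in auto)
    then show "(\<lambda>n. mean2 (V n) (\<lambda>x z. (U n x z - p) * a n x * b n z)) \<longlonglongrightarrow> 0"
      by (simp add: eq)
  qed
qed

end

section \<open>Random rounding of weighted graphs\<close>

text \<open>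
  Weights are functions of vertex sets, which makes them symmetric; the weight of a loop at \<open>x\<close> is
  the value at \<open>{x}\<close>.
\<close>

definition tden :: "'a sgraph \<Rightarrow> 'v set \<Rightarrow> ('v set \<Rightarrow> real) \<Rightarrow> real" where
  "tden J V w = avg (verts J) V (\<lambda>\<phi>. \<Prod>e\<in>edges J. w (\<phi> ` e))"

lemma prod_of_bool:
  "finite A \<Longrightarrow> (\<Prod>x\<in>A. of_bool (P x)) = (of_bool (\<forall>x\<in>A. P x) :: real)"
  by (induction A rule: finite_induct) auto

lemma hom_density_eq_tden:
  assumes "simple_graph J" "finite (verts H)"
  shows "hom_density J H = tden J (verts H) (\<lambda>e. of_bool (e \<in> edges H))"
proof -
  have fin: "finite (verts J \<rightarrow>\<^sub>E verts H)"
    using assms by (intro finite_PiE) (auto simp: simple_graph_def)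
  have pairs: "\<exists>u v. e = {u, v}" if "e \<in> edges J" for e
    using assms(1) that unfolding simple_graph_def by (meson card_2_iff)
  have "graph_homs J H = {\<phi> \<in> verts J \<rightarrow>\<^sub>E verts H. \<forall>e\<in>edges J. \<phi> ` e \<in> edges H}"
    unfolding graph_homs_def using pairs by fastforce
  then have "real (card (graph_homs J H)) = (\<Sum>\<phi>\<in>verts J \<rightarrow>\<^sub>E verts H. of_bool (\<forall>e\<in>edges J. \<phi> ` e \<in> edges H))"
    using fin by (simp add: Int_def of_bool_def sum.If_cases)
  then show ?thesis
    by (simp add: hom_density_def tden_def avg_def mean_def prod_of_bool finite_edges[OF assms(1)])
qed

text \<open>Given the other coordinates, \<open>\<phi> a\<close> is uniform and
  \<open>t \<phi>\<close> is a fixed value.\<close>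

lemma avg_collision:
  assumes V: "finite V" "V \<noteq> {}" and "a \<in> A" and t: "\<And>\<phi> x. t (\<phi>(a := x)) = t \<phi>"
  shows "avg A V (\<lambda>\<phi>. of_bool (\<phi> a = t \<phi>)) \<le> 1 / real (card V)"
proof -
  have "avg A V (\<lambda>\<phi>. of_bool (\<phi> a = t \<phi>)) = avg A V (\<lambda>\<phi>. mean V (\<lambda>x. of_bool (x = t \<phi>)))"
    using avg_resample[OF assms(1-3), of "\<lambda>\<phi>. of_bool (\<phi> a = t \<phi>)"] by (simp add: t)
  also have "\<dots> \<le> 1 / real (card V)"
    unfolding avg_def
  proof (rule mean_le_bound)
    show "mean V (\<lambda>x. of_bool (x = t \<phi>)) \<le> 1 / real (card V)" for \<phi>
      unfolding mean_def using V by (intro divide_right_mono) (auto simp: of_bool_def)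
  qed simp
  finally show ?thesis .
qed

text \<open>Expanding the product of \<open>w e + g e\<close> over \<open>E\<close>, with
  \<open>g\<close> equal to 0 on \<open>A\<close>, leaves exactly the terms of those
  \<open>S\<close> that contain \<open>A\<close>.\<close>

lemma random_subset_prob:
  fixes w :: "'e \<Rightarrow> real"
  assumes "finite E" "A \<subseteq> E"
  shows "(\<Sum>S\<in>Pow E. (\<Prod>e\<in>S. w e) * (\<Prod>e\<in>E - S. 1 - w e) * of_bool (A \<subseteq> S)) = (\<Prod>e\<in>A. w e)"
proof -
  define g where "g e = (if e \<in> A then 0 else 1 - w e)" for e
  have "(\<Prod>e\<in>E - S. g e) = (\<Prod>e\<in>E - S. 1 - w e) * of_bool (A \<subseteq> S)" if "S \<in> Pow E" for S
  proof (cases "A \<subseteq> S")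
    case True
    then have "(\<Prod>e\<in>E - S. g e) = (\<Prod>e\<in>E - S. 1 - w e)"
      by (intro prod.cong) (auto simp: g_def)
    then show ?thesis using True by simp
  next
    case False
    then obtain e where "e \<in> A" "e \<notin> S" by auto
    then have "e \<in> E - S" "g e = 0" using assms by (auto simp: g_def)
    then have "(\<Prod>e\<in>E - S. g e) = 0" using assms by (intro prod_zero) auto
    then show ?thesis using False by simp
  qed
  then have "(\<Sum>S\<in>Pow E. (\<Prod>e\<in>S. w e) * (\<Prod>e\<in>E - S. 1 - w e) * of_bool (A \<subseteq> S))
    = (\<Sum>S\<in>Pow E. (\<Prod>e\<in>S. w e) * (\<Prod>e\<in>E - S. g e))"
    by (simp add: mult.assoc)
  also have "\<dots> = (\<Prod>e\<in>E. w e + g e)" using assms by (simp add: prod_add)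
  also have "\<dots> = (\<Prod>e\<in>A. w e)"
    using assms by (intro prod.mono_neutral_cong_right) (auto simp: g_def)
  finally show ?thesis .
qed

definition pairs :: "'v set \<Rightarrow> 'v set set" where
  "pairs V = {e. e \<subseteq> V \<and> card e = 2}"

text \<open>The law of a random subset of \<open>E\<close> that contains each \<open>e\<close>
  independently with probability \<open>w e\<close>.\<close>

definition subset_prob :: "'e set \<Rightarrow> ('e \<Rightarrow> real) \<Rightarrow> 'e set \<Rightarrow> real" where
  "subset_prob E w S = (\<Prod>e\<in>S. w e) * (\<Prod>e\<in>E - S. 1 - w e)"

lemma subset_prob_nonneg: "\<forall>e. 0 \<le> w e \<and> w e \<le> 1 \<Longrightarrow> 0 \<le> subset_prob E w S"
  by (simp add: subset_prob_def prod_nonneg)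

lemma sum_subset_prob: "finite E \<Longrightarrow> (\<Sum>S\<in>Pow E. subset_prob E w S) = 1"
  using random_subset_prob[of E "{}" w] by (simp add: subset_prob_def)

text \<open>
  Two independent uniform maps are jointly injective up to probability \<open>3 v\<^sup>2 / N\<close>, and for jointly
  injective maps the corresponding deviations are uncorrelated.
\<close>

lemma random_graph_second_moment:
  fixes J :: "'a sgraph" and V :: "'v set"
  assumes J: "simple_graph J" and V: "finite V" "V \<noteq> {}" and w: "\<forall>e. 0 \<le> w e \<and> w e \<le> 1"
  shows "(\<Sum>S\<in>Pow (pairs V). subset_prob (pairs V) w S * (tden J V (\<lambda>e. of_bool (e \<in> S)) - tden J V w)\<^sup>2)
     \<le> 3 * (real (card (verts J)))\<^sup>2 / real (card V)"
proof -
  define E where "E = pairs V"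
  have finE: "finite E" unfolding E_def pairs_def using V by (auto intro: finite_subset[of _ "Pow V"])
  define P where "P = subset_prob E w"
  have P0: "0 \<le> P S" for S using subset_prob_nonneg[OF w] by (simp add: P_def)
  have P1: "(\<Sum>S\<in>Pow E. P S) = 1" using sum_subset_prob[OF finE] by (simp add: P_def)
  have prob: "(\<Sum>S\<in>Pow E. P S * of_bool (B \<subseteq> S)) = (\<Prod>e\<in>B. w e)" if "B \<subseteq> E" for B
    using random_subset_prob[OF finE that, of w] by (simp add: P_def subset_prob_def)
  define A where "A = verts J"
  have finA: "finite A" using J by (simp add: A_def simple_graph_def)
  have EJ: "e \<subseteq> A" "card e = 2" "finite e" if "e \<in> edges J" for e
    using J that finA by (auto simp: A_def simple_graph_def intro: finite_subset)
  define X where "X = A \<rightarrow>\<^sub>E V"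
  define im where "im \<phi> = (\<lambda>e. \<phi> ` e) ` edges J" for \<phi> :: "'a \<Rightarrow> 'v"
  define h where "h S \<phi> = (\<Prod>e\<in>edges J. of_bool (\<phi> ` e \<in> S) :: real)" for S and \<phi> :: "'a \<Rightarrow> 'v"
  have h: "h S \<phi> = of_bool (im \<phi> \<subseteq> S)" for S \<phi>
    unfolding h_def im_def prod_of_bool[OF finite_edges[OF J]] by auto
  define W where "W \<phi> = (\<Prod>e\<in>edges J. w (\<phi> ` e))" for \<phi> :: "'a \<Rightarrow> 'v"
  have W01: "0 \<le> W \<phi>" "W \<phi> \<le> 1" for \<phi>
    unfolding W_def using w by (auto intro!: prod_nonneg prod_le_1)
  define D where "D S \<phi> = h S \<phi> - W \<phi>" for S \<phi>
  have D1: "\<bar>D S \<phi>\<bar> \<le> 1" for S \<phi>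
    using W01[of \<phi>] by (auto simp: D_def h)
  \<comment> \<open>A union bound: the sum is at least 1 unless both maps are injective with
    disjoint images. The last term keeps \<open>a = b\<close>, since there the two maps themselves
    may meet.\<close>
  define bad where "bad \<phi> \<psi> = (\<Sum>(a, b)\<in>A \<times> A. of_bool (a \<noteq> b \<and> \<phi> a = \<phi> b) +
      of_bool (a \<noteq> b \<and> \<psi> a = \<psi> b) + (of_bool (\<phi> a = \<psi> b) :: real))" for \<phi> \<psi> :: "'a \<Rightarrow> 'v"
  \<comment> \<open>For an injective map distinct edges keep distinct two-element images, so no
    factor is repeated and no loop weight occurs.\<close>
  have im_good: "im \<phi> \<subseteq> E \<and> (\<Prod>e\<in>im \<phi>. w e) = W \<phi>" if "inj_on \<phi> A" "\<phi> \<in> X" for \<phi>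
  proof
    show "im \<phi> \<subseteq> E"
    proof
      fix e' assume "e' \<in> im \<phi>"
      then obtain e where e: "e \<in> edges J" "e' = \<phi> ` e" by (auto simp: im_def)
      have "card e' = 2" using EJ[OF e(1)] that(1) e(2) by (simp add: card_image inj_on_subset)
      moreover have "e' \<subseteq> V" using EJ[OF e(1)] that(2) e(2) by (auto simp: X_def)
      ultimately show "e' \<in> E" by (simp add: E_def pairs_def)
    qed
    have "inj_on (\<lambda>e. \<phi> ` e) (edges J)"
      by (rule inj_on_subset[OF inj_on_image_Pow[OF that(1)]]) (use EJ(1) in blast)
    then show "(\<Prod>e\<in>im \<phi>. w e) = W \<phi>"
      unfolding im_def W_def by (simp add: prod.reindex)
  qed
  have corr: "(\<Sum>S\<in>Pow E. P S * (D S \<phi> * D S \<psi>)) \<le> bad \<phi> \<psi>" if X: "\<phi> \<in> X" "\<psi> \<in> X" for \<phi> \<psi>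
  proof (cases "inj_on \<phi> A \<and> inj_on \<psi> A \<and> \<phi> ` A \<inter> \<psi> ` A = {}")
    case True
    have "im \<phi> \<inter> im \<psi> = {}"
    proof (rule ccontr)
      assume "im \<phi> \<inter> im \<psi> \<noteq> {}"
      then obtain e e' where e: "e \<in> edges J" "e' \<in> edges J" "\<phi> ` e = \<psi> ` e'" by (auto simp: im_def)
      then obtain x where "x \<in> e" using EJ(2)[OF e(1)] by fastforce
      then have "\<phi> x \<in> \<phi> ` A \<inter> \<psi> ` A" using EJ(1) e by blast
      then show False using True by simp
    qed
    moreover have "finite (im \<phi>)" "finite (im \<psi>)" using finite_edges[OF J] by (auto simp: im_def)
    ultimately have "(\<Prod>e\<in>im \<phi> \<union> im \<psi>. w e) = W \<phi> * W \<psi>"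
      using im_good X True by (simp add: prod.union_disjoint)
    then have hh: "(\<Sum>S\<in>Pow E. P S * (h S \<phi> * h S \<psi>)) = W \<phi> * W \<psi>"
      using prob[of "im \<phi> \<union> im \<psi>"] im_good X True by (simp add: h of_bool_conj[symmetric])
    have h1: "(\<Sum>S\<in>Pow E. P S * h S \<phi>) = W \<phi>" "(\<Sum>S\<in>Pow E. P S * h S \<psi>) = W \<psi>"
      using prob[of "im \<phi>"] prob[of "im \<psi>"] im_good X True by (auto simp: h)
    have "(\<Sum>S\<in>Pow E. P S * (D S \<phi> * D S \<psi>)) = (\<Sum>S\<in>Pow E. P S * (h S \<phi> * h S \<psi>))
      - W \<psi> * (\<Sum>S\<in>Pow E. P S * h S \<phi>) - W \<phi> * (\<Sum>S\<in>Pow E. P S * h S \<psi>) + W \<phi> * W \<psi> * (\<Sum>S\<in>Pow E. P S)"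
      unfolding sum_distrib_left sum_subtractf[symmetric] sum.distrib[symmetric]
      by (rule sum.cong) (simp_all add: D_def algebra_simps)
    also have "\<dots> = 0" by (simp add: hh h1 P1)
    also have "0 \<le> bad \<phi> \<psi>" unfolding bad_def by (intro sum_nonneg) auto
    finally show ?thesis .
  next
    case False
    then obtain a b where ab: "a \<in> A" "b \<in> A" "a \<noteq> b \<and> \<phi> a = \<phi> b \<or> a \<noteq> b \<and> \<psi> a = \<psi> b \<or> \<phi> a = \<psi> b"
      unfolding inj_on_def by blast
    have "(\<Sum>S\<in>Pow E. P S * (D S \<phi> * D S \<psi>)) \<le> (\<Sum>S\<in>Pow E. P S * 1)"
    proof (intro sum_mono mult_left_mono P0)
      fix S
      have "\<bar>D S \<phi>\<bar> * \<bar>D S \<psi>\<bar> \<le> 1" using D1 by (simp add: mult_le_one)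
      then show "D S \<phi> * D S \<psi> \<le> 1" by (metis abs_le_D1 abs_mult)
    qed
    also have "\<dots> = 1" using P1 by simp
    also have "1 \<le> of_bool (a \<noteq> b \<and> \<phi> a = \<phi> b) + of_bool (a \<noteq> b \<and> \<psi> a = \<psi> b) + (of_bool (\<phi> a = \<psi> b) :: real)"
      using ab by auto
    also have "\<dots> \<le> bad \<phi> \<psi>"
      unfolding bad_def using ab finA
      by (intro member_le_sum[of "(a, b)" "A \<times> A" "\<lambda>(a, b). of_bool (a \<noteq> b \<and> \<phi> a = \<phi> b) +
        of_bool (a \<noteq> b \<and> \<psi> a = \<psi> b) + (of_bool (\<phi> a = \<psi> b) :: real)", simplified]) auto
    finally show ?thesis .
  qed
  have finX: "finite X" "X \<noteq> {}" using finA V by (auto simp: X_def finite_PiE PiE_eq_empty_iff)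
  \<comment> \<open>Squaring turns the deviation into an average over two independent maps, so the
    expectation over \<open>S\<close> can be taken for each pair of maps separately.\<close>
  have sq: "(tden J V (\<lambda>e. of_bool (e \<in> S)) - tden J V w)\<^sup>2 = mean2 X (\<lambda>\<phi> \<psi>. D S \<phi> * D S \<psi>)" for S
  proof -
    have "tden J V (\<lambda>e. of_bool (e \<in> S)) - tden J V w = mean X (D S)"
      unfolding tden_def avg_def mean_diff[symmetric] D_def[abs_def] h_def W_def X_def A_def by simp
    then show ?thesis by (simp add: mean2_def power2_eq_square mean_cmult mean_multc)
  qed
  have "(\<Sum>S\<in>Pow E. P S * (tden J V (\<lambda>e. of_bool (e \<in> S)) - tden J V w)\<^sup>2)
     = mean2 X (\<lambda>\<phi> \<psi>. \<Sum>S\<in>Pow E. P S * (D S \<phi> * D S \<psi>))"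
    unfolding sq mean2_cmult[symmetric] by (simp add: mean2_def mean_sum)
  also have "\<dots> \<le> mean2 X bad" by (intro mean2_mono corr)
  also have "\<dots> = (\<Sum>(a, b)\<in>A \<times> A. mean X (\<lambda>\<phi>. of_bool (a \<noteq> b \<and> \<phi> a = \<phi> b)) +
      mean X (\<lambda>\<psi>. of_bool (a \<noteq> b \<and> \<psi> a = \<psi> b)) + mean X (\<lambda>\<psi>. mean X (\<lambda>\<phi>. of_bool (\<phi> a = \<psi> b))))"
    unfolding mean2_def bad_def mean_sum case_prod_unfold mean_add
    by (simp add: mean_const[OF finX] mean_swap[of X X "\<lambda>\<phi> \<psi>. of_bool (\<phi> _ = \<psi> _)"])
  also have "\<dots> \<le> (\<Sum>(a, b)\<in>A \<times> A. 3 / real (card V))"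
  proof (rule sum_mono, clarify)
    fix a b assume ab: "a \<in> A" "b \<in> A"
    have 1: "mean X (\<lambda>\<phi>. of_bool (a \<noteq> b \<and> \<phi> a = \<phi> b)) \<le> 1 / real (card V)"
    proof (cases "a = b")
      case False
      then show ?thesis
        using avg_collision[OF V ab(1), of "\<lambda>\<phi>. \<phi> b"] by (simp add: avg_def X_def)
    qed (simp add: mean_def)
    have 2: "mean X (\<lambda>\<psi>. mean X (\<lambda>\<phi>. of_bool (\<phi> a = \<psi> b))) \<le> 1 / real (card V)"
      by (rule mean_le_bound)
        (use avg_collision[OF V ab(1), of "\<lambda>_. _"] in \<open>auto simp: avg_def X_def\<close>)
    show "mean X (\<lambda>\<phi>. of_bool (a \<noteq> b \<and> \<phi> a = \<phi> b)) + mean X (\<lambda>\<psi>. of_bool (a \<noteq> b \<and> \<psi> a = \<psi> b))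
      + mean X (\<lambda>\<psi>. mean X (\<lambda>\<phi>. of_bool (\<phi> a = \<psi> b))) \<le> 3 / real (card V)"
      using 1 2 by simp
  qed
  also have "\<dots> = 3 * (real (card (verts J)))\<^sup>2 / real (card V)"
    by (simp add: A_def card_cartesian_product power2_eq_square)
  finally show ?thesis by (simp add: E_def P_def)
qed

lemma exists_le_weighted_mean:
  fixes P Y :: "'s \<Rightarrow> real"
  assumes "(\<Sum>S\<in>Q. P S) = 1" "\<And>S. 0 \<le> P S" "(\<Sum>S\<in>Q. P S * Y S) \<le> c"
  shows "\<exists>S\<in>Q. Y S \<le> c"
proof (rule ccontr)
  assume "\<not> ?thesis"
  then have gt: "c < Y S" if "S \<in> Q" for S using that by force
  have fin: "finite Q" using assms(1) by (rule contrapos_pp) simp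
  obtain S0 where S0: "S0 \<in> Q" "P S0 \<noteq> 0"
    using assms(1) by (metis sum.neutral zero_neq_one)
  have "(\<Sum>S\<in>Q. P S * c) < (\<Sum>S\<in>Q. P S * Y S)"
  proof (rule sum_strict_mono_ex1[OF fin])
    show "\<forall>S\<in>Q. P S * c \<le> P S * Y S" using gt assms(2) by (simp add: less_imp_le mult_left_mono)
    have "P S0 > 0" using assms(2)[of S0] S0 by simp
    then show "\<exists>S\<in>Q. P S * c < P S * Y S" using gt[OF S0(1)] by (intro bexI[OF _ S0(1)] mult_strict_left_mono)
  qed
  then show False using assms(1,3) by (simp add: sum_distrib_right[symmetric])
qed

text \<open>One graph must serve \<open>F\<close>, \<open>G\<close> and the test graph
  \<open>J\<close> together, so the three second moments are added before a subset with at most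
  average total is chosen.\<close>

lemma graph_near_kernel:
  fixes F :: "'a sgraph" and G :: "'b sgraph" and J :: "'c sgraph"
  assumes FGJ: "simple_graph F" "simple_graph G" "simple_graph J"
    and V: "finite V" "V \<noteq> {}" and w: "\<forall>e. 0 \<le> w e \<and> w e \<le> 1"
  defines "C \<equiv> 3 * ((real (card (verts F)))\<^sup>2 + (real (card (verts G)))\<^sup>2 + (real (card (verts J)))\<^sup>2)"
  shows "\<exists>H. simple_graph H \<and> verts H = V \<and> (hom_density F H - tden F V w)\<^sup>2 \<le> C / real (card V) \<and>
    (hom_density G H - tden G V w)\<^sup>2 \<le> C / real (card V) \<and> (hom_density J H - tden J V w)\<^sup>2 \<le> C / real (card V)"
proof -
  let ?E = "pairs V" and ?P = "subset_prob (pairs V) w"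
  let ?d = "\<lambda>S. \<lambda>e. of_bool (e \<in> S) :: real"
  define Y where "Y S = (tden F V (?d S) - tden F V w)\<^sup>2 + (tden G V (?d S) - tden G V w)\<^sup>2 + (tden J V (?d S) - tden J V w)\<^sup>2" for S
  have fin: "finite ?E" unfolding pairs_def using V by (auto intro: finite_subset[of _ "Pow V"])
  have "(\<Sum>S\<in>Pow ?E. ?P S * Y S) \<le> C / real (card V)"
    using random_graph_second_moment[OF FGJ(1) V w] random_graph_second_moment[OF FGJ(2) V w]
      random_graph_second_moment[OF FGJ(3) V w]
    by (simp add: Y_def C_def distrib_left sum.distrib add_divide_distrib)
  from exists_le_weighted_mean[OF sum_subset_prob[OF fin] subset_prob_nonneg[OF w] this]
  obtain S where S: "S \<subseteq> ?E" "Y S \<le> C / real (card V)" by auto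
  define H where "H = \<lparr>verts = V, edges = S\<rparr>"
  have H: "simple_graph H" using V S by (auto simp: H_def simple_graph_def pairs_def)
  have "(hom_density F H - tden F V w)\<^sup>2 + (hom_density G H - tden G V w)\<^sup>2 + (hom_density J H - tden J V w)\<^sup>2 = Y S"
    using FGJ V by (simp add: hom_density_eq_tden H_def Y_def)
  then have "(hom_density F H - tden F V w)\<^sup>2 \<le> Y S" "(hom_density G H - tden G V w)\<^sup>2 \<le> Y S"
     "(hom_density J H - tden J V w)\<^sup>2 \<le> Y S"
    by (smt (verit) zero_le_power2)+
  then show ?thesis using S(2) H by (intro exI[of _ H]) (auto simp: H_def)
qed

lemma has_density_iff_tendsto:
  assumes "0 < p"
  shows "has_density p H J \<longleftrightarrow> (\<lambda>n. hom_density J (H n)) \<longlonglongrightarrow> p ^ card (edges J)"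
  unfolding has_density_def
  using assms asymp_equivD_const tendsto_imp_asymp_equiv_const[of _ "p ^ card (edges J)" sequentially] by auto

lemma strict_mono_nat_filterlim_real:
  fixes f :: "nat \<Rightarrow> nat"
  assumes "strict_mono f"
  shows "filterlim (\<lambda>n. real (f n)) at_top sequentially"
  by (rule filterlim_compose[OF filterlim_real_sequentially filterlim_subseq[OF assms]])

text \<open>Transfers forcing from graphs to weights. The rounded graphs may depend on
  \<open>J\<close>, which is harmless because \<open>J\<close> is fixed before they are
  chosen.\<close>

lemma kernel_forcing:
  fixes V :: "nat \<Rightarrow> nat set" and J :: "nat sgraph"
  assumes forces: "forces_at q F G" and FGJ: "simple_graph F" "simple_graph G" "simple_graph J" and q: "0 < q"
    and V: "\<And>n. finite (V n)" "\<And>n. V n \<noteq> {}" "strict_mono (\<lambda>n. card (V n))"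
    and w: "\<And>n. \<forall>e. 0 \<le> w n e \<and> w n e \<le> 1"
    and lim: "(\<lambda>n. tden F (V n) (w n)) \<longlonglongrightarrow> q ^ card (edges F)" "(\<lambda>n. tden G (V n) (w n)) \<longlonglongrightarrow> q ^ card (edges G)"
  shows "(\<lambda>n. tden J (V n) (w n)) \<longlonglongrightarrow> q ^ card (edges J)"
proof -
  define C where "C = 3 * ((real (card (verts F)))\<^sup>2 + (real (card (verts G)))\<^sup>2 + (real (card (verts J)))\<^sup>2)"
  define good where "good n H \<longleftrightarrow> simple_graph H \<and> verts H = V n \<and> (hom_density F H - tden F (V n) (w n))\<^sup>2 \<le> C / real (card (V n)) \<and>
    (hom_density G H - tden G (V n) (w n))\<^sup>2 \<le> C / real (card (V n)) \<and> (hom_density J H - tden J (V n) (w n))\<^sup>2 \<le> C / real (card (V n))" for n H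
  define H where "H n = (SOME H. good n H)" for n
  have "good n (H n)" for n
    unfolding H_def by (rule someI_ex) (unfold good_def C_def, rule graph_near_kernel[OF FGJ V(1,2) w])
  note H = this[unfolded good_def]
  have small: "(\<lambda>n. C / real (card (V n))) \<longlonglongrightarrow> 0"
    by (rule real_tendsto_divide_at_top[OF tendsto_const strict_mono_nat_filterlim_real[OF V(3)]])
  have null: "f \<longlonglongrightarrow> 0" if "\<And>n. (f n)\<^sup>2 \<le> C / real (card (V n))" for f
  proof -
    have "(\<lambda>n. (f n)\<^sup>2) \<longlonglongrightarrow> 0"
      by (rule Lim_null_comparison[OF always_eventually small]) (use that in auto)
    then show ?thesis by simp
  qed
  have dF: "(\<lambda>n. hom_density F (H n) - tden F (V n) (w n)) \<longlonglongrightarrow> 0" by (rule null) (use H in blast)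
  have dG: "(\<lambda>n. hom_density G (H n) - tden G (V n) (w n)) \<longlonglongrightarrow> 0" by (rule null) (use H in blast)
  have dJ: "(\<lambda>n. hom_density J (H n) - tden J (V n) (w n)) \<longlonglongrightarrow> 0" by (rule null) (use H in blast)
  have "has_density q H F" "has_density q H G"
    unfolding has_density_iff_tendsto[OF q]
    using tendsto_add[OF dF lim(1)] tendsto_add[OF dG lim(2)] by simp_all
  moreover have "increasing_order H" unfolding increasing_order_def using V(3) H by simp
  ultimately have "quasi_random q H" using forces H unfolding forces_at_def by blast
  then have "(\<lambda>n. hom_density J (H n)) \<longlonglongrightarrow> q ^ card (edges J)"
    using FGJ(3) by (simp add: quasi_random_def has_density_iff_tendsto[OF q])
  from tendsto_diff[OF this dJ] show ?thesis by simp
qed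

section \<open>Quasi-randomness and the cut norm\<close>

definition edge_graph :: "nat sgraph" where
  "edge_graph = \<lparr>verts = {0, 1}, edges = {{0, 1}}\<rparr>"

definition cherry_graph :: "nat sgraph" where
  "cherry_graph = \<lparr>verts = {0, 1, 2}, edges = {{0, 1}, {0, 2}}\<rparr>"

text \<open>The 4-cycle with opposite pairs \<open>{0, 1}\<close> and \<open>{2, 3}\<close>; its
  density is the second moment of the codegree.\<close>

definition square_graph :: "nat sgraph" where
  "square_graph = \<lparr>verts = {0, 1, 2, 3}, edges = {{0, 2}, {1, 2}, {0, 3}, {1, 3}}\<rparr>"

lemma simple_small_graphs: "simple_graph edge_graph" "simple_graph cherry_graph" "simple_graph square_graph"
  by (auto simp: simple_graph_def edge_graph_def cherry_graph_def square_graph_def)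

lemma card_edges_small_graphs:
  "card (edges edge_graph) = 1" "card (edges cherry_graph) = 2" "card (edges square_graph) = 4"
  by (auto simp: edge_graph_def cherry_graph_def square_graph_def doubleton_eq_iff)

lemma tden_edge_graph:
  assumes "finite V"
  shows "tden edge_graph V w = mean2 V (\<lambda>x y. w {x, y})"
  using assms by (simp add: tden_def edge_graph_def avg_insert avg_empty mean2_def)

lemma tden_cherry_graph:
  assumes "finite V"
  shows "tden cherry_graph V w = mean V (\<lambda>x. (mean V (\<lambda>y. w {x, y}))\<^sup>2)"
proof -
  have "tden cherry_graph V w = mean V (\<lambda>x. mean V (\<lambda>y. mean V (\<lambda>z. w {x, y} * w {x, z})))"
    using assms by (simp add: tden_def cherry_graph_def avg_insert avg_empty doubleton_eq_iff)
  then show ?thesis by (simp add: mean_cmult mean_multc power2_eq_square)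
qed

lemma tden_square_graph:
  assumes "finite V"
  shows "tden square_graph V w = mean2 V (\<lambda>x y. (mean V (\<lambda>z. w {x, z} * w {y, z}))\<^sup>2)"
proof -
  have "tden square_graph V w =
     mean2 V (\<lambda>x y. mean V (\<lambda>z. mean V (\<lambda>t. (w {x, z} * w {y, z}) * (w {x, t} * w {y, t}))))"
    using assms by (simp add: tden_def square_graph_def avg_insert avg_empty doubleton_eq_iff mean2_def mult_ac)
  then show ?thesis by (simp add: mean_cmult mean_multc power2_eq_square)
qed

text \<open>Two applications of Cauchy-Schwarz remove first \<open>a\<close> and then
  \<open>b\<close>; what remains is the 4-cycle density of \<open>K\<close>.\<close>

lemma cut_le_square_density:
  assumes a: "\<forall>x\<in>V. \<bar>a x\<bar> \<le> 1" and b: "\<forall>x\<in>V. \<bar>b x\<bar> \<le> 1"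
  shows "((mean2 V (\<lambda>x y. K x y * a x * b y))\<^sup>2)\<^sup>2 \<le> mean2 V (\<lambda>y z. (mean V (\<lambda>x. K x y * K x z))\<^sup>2)"
proof -
  have sq: "(a x)\<^sup>2 \<le> 1" "(b x)\<^sup>2 \<le> 1" if "x \<in> V" for x
    using a b that by (auto simp: abs_square_le_1)
  have "(mean2 V (\<lambda>x y. K x y * a x * b y))\<^sup>2 = (mean V (\<lambda>x. a x * mean V (\<lambda>y. K x y * b y)))\<^sup>2"
    by (simp add: mean2_def mean_cmult[symmetric] mult_ac)
  also have "\<dots> \<le> mean V (\<lambda>x. (a x)\<^sup>2) * mean V (\<lambda>x. (mean V (\<lambda>y. K x y * b y))\<^sup>2)"
    by (rule mean_Cauchy_Schwarz)
  also have "\<dots> \<le> 1 * mean V (\<lambda>x. (mean V (\<lambda>y. K x y * b y))\<^sup>2)"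
    using sq by (intro mult_right_mono mean_le_bound mean_nonneg) auto
  also have "\<dots> = mean V (\<lambda>x. mean2 V (\<lambda>y z. (K x y * K x z) * (b y * b z)))"
  proof -
    have "(mean V (\<lambda>y. K x y * b y))\<^sup>2 = mean2 V (\<lambda>y z. (K x y * K x z) * (b y * b z))" for x
    proof -
      have "mean2 V (\<lambda>y z. (K x y * K x z) * (b y * b z)) = mean2 V (\<lambda>y z. (K x y * b y) * (K x z * b z))"
        by (simp add: mult_ac)
      also have "\<dots> = (mean V (\<lambda>y. K x y * b y))\<^sup>2"
        unfolding mean2_def mean_cmult mean_multc by (simp add: power2_eq_square)
      finally show ?thesis by simp
    qed
    then show ?thesis by simp
  qed
  also have "\<dots> = mean2 V (\<lambda>y z. mean V (\<lambda>x. K x y * K x z) * (b y * b z))"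
    unfolding mean_mean2_swap mean_multc ..
  finally have "((mean2 V (\<lambda>x y. K x y * a x * b y))\<^sup>2)\<^sup>2 \<le> (mean2 V (\<lambda>y z. mean V (\<lambda>x. K x y * K x z) * (b y * b z)))\<^sup>2"
    by (intro power_mono) auto
  also have "\<dots> \<le> mean2 V (\<lambda>y z. (mean V (\<lambda>x. K x y * K x z) * (b y * b z))\<^sup>2)"
    by (rule mean2_power2_le)
  also have "\<dots> \<le> mean2 V (\<lambda>y z. (mean V (\<lambda>x. K x y * K x z))\<^sup>2)"
  proof (rule mean2_mono)
    fix y z assume "y \<in> V" "z \<in> V"
    then have "(b y)\<^sup>2 * (b z)\<^sup>2 \<le> 1" using sq by (intro mult_le_one) auto
    then show "(mean V (\<lambda>x. K x y * K x z) * (b y * b z))\<^sup>2 \<le> (mean V (\<lambda>x. K x y * K x z))\<^sup>2"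
      using mult_left_mono[of "(b y)\<^sup>2 * (b z)\<^sup>2" 1 "(mean V (\<lambda>x. K x y * K x z))\<^sup>2"]
      by (simp add: power_mult_distrib)
  qed
  finally show ?thesis .
qed

context vertex_sets
begin

text \<open>Edge and cherry show that the degrees concentrate at \<open>q\<close>, cherry and
  4-cycle that the codegrees concentrate at \<open>q\<^sup>2\<close>. Together they make the
  codegree \<open>\<kappa>\<close> of the centred weight small, hence also its 4-cycle
  density.\<close>

lemma cut_small_of_densities:
  assumes w1: "(\<lambda>n. tden edge_graph (V n) (w n)) \<longlonglongrightarrow> q"
    and w2: "(\<lambda>n. tden cherry_graph (V n) (w n)) \<longlonglongrightarrow> q\<^sup>2"
    and w4: "(\<lambda>n. tden square_graph (V n) (w n)) \<longlonglongrightarrow> q ^ 4"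
  shows "cut_small V (\<lambda>n x y. w n {x, y} - q)"
proof -
  define d where "d n x = mean (V n) (\<lambda>y. w n {x, y})" for n x
  define f where "f n x y = mean (V n) (\<lambda>z. w n {x, z} * w n {y, z})" for n x y
  define \<kappa> where "\<kappa> n x y = mean (V n) (\<lambda>z. (w n {z, x} - q) * (w n {z, y} - q))" for n x y
  have const: "mean (V n) (\<lambda>_. c) = c" "mean2 (V n) (\<lambda>_ _. c) = c" for n and c :: real
    by (simp_all add: mean_const mean2_const finite_V nonempty_V)
  have \<kappa>: "\<kappa> n x y = (f n x y - q\<^sup>2) - q * (d n x - q) - q * (d n y - q)" for n x y
  proof -
    have "\<kappa> n x y = mean (V n) (\<lambda>z. w n {x, z} * w n {y, z} - q * w n {x, z} - q * w n {y, z} + q\<^sup>2)"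
      unfolding \<kappa>_def by (rule mean_cong) (simp add: insert_commute algebra_simps power2_eq_square)
    then show ?thesis
      by (simp add: mean_add mean_diff mean_cmult const f_def d_def algebra_simps power2_eq_square)
  qed
  have mean_f: "mean2 (V n) (f n) = tden cherry_graph (V n) (w n)" for n
  proof -
    have "mean2 (V n) (f n) = mean (V n) (\<lambda>z. mean2 (V n) (\<lambda>x y. w n {x, z} * w n {y, z}))"
      unfolding mean_mean2_swap by (simp add: f_def[abs_def])
    also have "\<dots> = mean (V n) (\<lambda>z. mean (V n) (\<lambda>x. w n {x, z}) * mean (V n) (\<lambda>x. w n {x, z}))"
      by (simp add: mean2_def mean_cmult mean_multc)
    finally show ?thesis
      by (simp add: tden_cherry_graph[OF finite_V] power2_eq_square insert_commute)
  qed
  have sq_f: "mean2 (V n) (\<lambda>x y. (f n x y - q\<^sup>2)\<^sup>2) =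
      tden square_graph (V n) (w n) - 2 * q\<^sup>2 * tden cherry_graph (V n) (w n) + q ^ 4" for n
  proof -
    have "mean2 (V n) (\<lambda>x y. (f n x y - q\<^sup>2)\<^sup>2) = mean2 (V n) (\<lambda>x y. (f n x y)\<^sup>2 - (2 * q\<^sup>2) * f n x y + q ^ 4)"
      by (rule mean2_cong) (simp add: power2_diff power_mult[symmetric])
    then show ?thesis
      by (simp add: mean2_add mean2_diff mean2_cmult const mean_f tden_square_graph[OF finite_V] f_def[symmetric])
  qed
  have sq_d: "mean (V n) (\<lambda>x. (d n x - q)\<^sup>2) = tden cherry_graph (V n) (w n) - 2 * q * tden edge_graph (V n) (w n) + q\<^sup>2" for n
  proof -
    have "mean (V n) (\<lambda>x. (d n x - q)\<^sup>2) = mean (V n) (\<lambda>x. (d n x)\<^sup>2 - (2 * q) * d n x + q\<^sup>2)"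
      by (rule mean_cong) (simp add: power2_diff)
    then show ?thesis
      by (simp add: mean_add mean_diff mean_cmult const tden_cherry_graph[OF finite_V] tden_edge_graph[OF finite_V] d_def mean2_def)
  qed
  have "(\<lambda>n. mean2 (V n) (\<lambda>x y. (f n x y - q\<^sup>2)\<^sup>2)) \<longlonglongrightarrow> q ^ 4 - 2 * q\<^sup>2 * q\<^sup>2 + q ^ 4"
    unfolding sq_f by (intro tendsto_intros w2 w4)
  then have lim_f: "(\<lambda>n. mean2 (V n) (\<lambda>x y. (f n x y - q\<^sup>2)\<^sup>2)) \<longlonglongrightarrow> 0"
    by (simp add: power2_eq_square power4_eq_xxxx)
  have "(\<lambda>n. mean (V n) (\<lambda>x. (d n x - q)\<^sup>2)) \<longlonglongrightarrow> q\<^sup>2 - 2 * q * q + q\<^sup>2"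
    unfolding sq_d by (intro tendsto_intros w1 w2)
  then have lim_d: "(\<lambda>n. mean (V n) (\<lambda>x. (d n x - q)\<^sup>2)) \<longlonglongrightarrow> 0"
    by (simp add: power2_eq_square)
  have \<kappa>_le: "mean2 (V n) (\<lambda>x y. (\<kappa> n x y)\<^sup>2) \<le>
      3 * mean2 (V n) (\<lambda>x y. (f n x y - q\<^sup>2)\<^sup>2) + 6 * q\<^sup>2 * mean (V n) (\<lambda>x. (d n x - q)\<^sup>2)" for n
  proof -
    have *: "(A - B - C)\<^sup>2 \<le> 3 * A\<^sup>2 + 3 * B\<^sup>2 + 3 * C\<^sup>2" for A B C :: real
    proof -
      have "0 \<le> (A + B)\<^sup>2 + (A + C)\<^sup>2 + (B - C)\<^sup>2" by simp
      then show ?thesis by (simp add: power2_eq_square algebra_simps)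
    qed
    have "mean2 (V n) (\<lambda>x y. (\<kappa> n x y)\<^sup>2) \<le>
        mean2 (V n) (\<lambda>x y. 3 * (f n x y - q\<^sup>2)\<^sup>2 + 3 * (q * (d n x - q))\<^sup>2 + 3 * (q * (d n y - q))\<^sup>2)"
      unfolding \<kappa> by (intro mean2_mono *)
    also have "\<dots> = 3 * mean2 (V n) (\<lambda>x y. (f n x y - q\<^sup>2)\<^sup>2) + 6 * q\<^sup>2 * mean (V n) (\<lambda>x. (d n x - q)\<^sup>2)"
      unfolding mean2_add mean2_cmult power_mult_distrib by (simp add: mean2_def const)
    finally show ?thesis .
  qed
  have "(\<lambda>n. 3 * mean2 (V n) (\<lambda>x y. (f n x y - q\<^sup>2)\<^sup>2) + 6 * q\<^sup>2 * mean (V n) (\<lambda>x. (d n x - q)\<^sup>2)) \<longlonglongrightarrow> 3 * 0 + 6 * q\<^sup>2 * 0"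
    by (intro tendsto_intros lim_f lim_d)
  then have lim_\<kappa>: "(\<lambda>n. mean2 (V n) (\<lambda>x y. (\<kappa> n x y)\<^sup>2)) \<longlonglongrightarrow> 0"
    by (intro Lim_null_comparison[OF always_eventually, of "\<lambda>n. mean2 (V n) (\<lambda>x y. (\<kappa> n x y)\<^sup>2)"])
      (use \<kappa>_le in \<open>auto simp: mean2_nonneg\<close>)
  show ?thesis
  proof (rule cut_smallI)
    fix a b :: "nat \<Rightarrow> 'v \<Rightarrow> real"
    assume a: "\<forall>n. \<forall>x\<in>V n. \<bar>a n x\<bar> \<le> 1" and b: "\<forall>n. \<forall>x\<in>V n. \<bar>b n x\<bar> \<le> 1"
    let ?m = "\<lambda>n. mean2 (V n) (\<lambda>x y. (w n {x, y} - q) * a n x * b n y)"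
    have "(\<lambda>n. ((?m n)\<^sup>2)\<^sup>2) \<longlonglongrightarrow> 0"
    proof (rule Lim_null_comparison[OF always_eventually lim_\<kappa>], rule allI)
      show "norm (((?m n)\<^sup>2)\<^sup>2) \<le> mean2 (V n) (\<lambda>x y. (\<kappa> n x y)\<^sup>2)" for n
        using cut_le_square_density[of "V n" "a n" "b n" "\<lambda>x y. w n {x, y} - q"] a b by (simp add: \<kappa>_def)
    qed
    then show "?m \<longlonglongrightarrow> 0" by simp
  qed
qed

text \<open>The edges are replaced by \<open>p\<close> one at a time. With all vertices but the ends
  of the current edge frozen at a worst choice, every other edge sees at most one of these ends, so
  the error is a cut-norm test.\<close>

lemma counting_lemma:
  fixes A :: "'a set"
  assumes small: "cut_small V (\<lambda>n x y. w n {x, y} - p)"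
    and w: "\<forall>n e. 0 \<le> w n e \<and> w n e \<le> 1"
    and A: "finite A" and E: "finite E" "\<forall>e\<in>E. e \<subseteq> A \<and> card e = 2"
  shows "(\<lambda>n. avg A (V n) (\<lambda>\<phi>. \<Prod>e\<in>E. w n (\<phi> ` e))) \<longlonglongrightarrow> p ^ card E"
  using E
proof (induction E rule: finite_induct)
  case empty
  have "finite (A \<rightarrow>\<^sub>E V n)" "A \<rightarrow>\<^sub>E V n \<noteq> {}" for n
    using A finite_V nonempty_V by (auto simp: finite_PiE PiE_eq_empty_iff)
  then show ?case by (simp add: avg_def mean_const)
next
  case (insert e0 E)
  obtain a b where ab: "e0 = {a, b}" "a \<noteq> b"
    using insert.prems by (metis card_2_iff insertI1)
  have abA: "a \<in> A" "b \<in> A" using insert.prems ab by auto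
  define R where "R n \<phi> = (w n {\<phi> a, \<phi> b} - p) * (\<Prod>e\<in>E. w n (\<phi> ` e))" for n and \<phi> :: "'a \<Rightarrow> 'v"
  have fin: "finite (A \<rightarrow>\<^sub>E V n)" "A \<rightarrow>\<^sub>E V n \<noteq> {}" for n
    using A finite_V nonempty_V by (auto simp: finite_PiE PiE_eq_empty_iff)
  define Q where "Q n \<phi> = mean2 (V n) (\<lambda>x y. R n (\<phi>(a := x, b := y)))" for n \<phi>
  have resample: "avg A (V n) (R n) = mean (A \<rightarrow>\<^sub>E V n) (Q n)" for n
  proof -
    have "avg A (V n) (R n) = avg A (V n) (\<lambda>\<phi>. mean (V n) (\<lambda>y. R n (\<phi>(b := y))))"
      by (rule avg_resample[OF finite_V nonempty_V abA(2)])
    also have "\<dots> = avg A (V n) (\<lambda>\<phi>. mean (V n) (\<lambda>x. mean (V n) (\<lambda>y. R n (\<phi>(a := x, b := y)))))"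
      by (rule avg_resample[OF finite_V nonempty_V abA(1)])
    finally show ?thesis by (simp add: avg_def Q_def[abs_def] mean2_def)
  qed
  define \<phi> where "\<phi> n = (SOME \<phi>. \<bar>mean (A \<rightarrow>\<^sub>E V n) (Q n)\<bar> \<le> \<bar>Q n \<phi>\<bar>)" for n
  have \<phi>: "\<bar>mean (A \<rightarrow>\<^sub>E V n) (Q n)\<bar> \<le> \<bar>Q n (\<phi> n)\<bar>" for n
    unfolding \<phi>_def
    by (rule someI_ex[of "\<lambda>\<phi>. \<bar>mean (A \<rightarrow>\<^sub>E V n) (Q n)\<bar> \<le> \<bar>Q n \<phi>\<bar>"]) (use abs_mean_attained[OF fin, of n "Q n"] in auto)
  \<comment> \<open>An edge other than \<open>e0\<close> that contains \<open>b\<close> cannot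
    contain \<open>a\<close>. Thus the edges avoiding \<open>b\<close> depend only on
    \<open>x\<close> and the others only on \<open>y\<close>.\<close>
  define \<alpha> where "\<alpha> n x = (\<Prod>e\<in>{e\<in>E. b \<notin> e}. w n ((\<phi> n)(a := x) ` e))" for n x
  define \<beta> where "\<beta> n y = (\<Prod>e\<in>{e\<in>E. b \<in> e}. w n ((\<phi> n)(b := y) ` e))" for n y
  have split: "R n ((\<phi> n)(a := x, b := y)) = (w n {x, y} - p) * \<alpha> n x * \<beta> n y" for n x y
  proof -
    have "(\<Prod>e\<in>E. w n ((\<phi> n)(a := x, b := y) ` e)) =
      (\<Prod>e\<in>{e\<in>E. b \<notin> e}. w n ((\<phi> n)(a := x, b := y) ` e)) * (\<Prod>e\<in>{e\<in>E. b \<in> e}. w n ((\<phi> n)(a := x, b := y) ` e))"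
      using insert.hyps(1) by (subst prod.union_disjoint[symmetric]) (auto intro!: prod.cong)
    also have "(\<Prod>e\<in>{e\<in>E. b \<notin> e}. w n ((\<phi> n)(a := x, b := y) ` e)) = \<alpha> n x"
      unfolding \<alpha>_def by (rule prod.cong) (auto intro!: arg_cong[of _ _ "w n"] image_cong)
    also have "(\<Prod>e\<in>{e\<in>E. b \<in> e}. w n ((\<phi> n)(a := x, b := y) ` e)) = \<beta> n y"
      unfolding \<beta>_def
    proof (rule prod.cong[OF refl])
      fix e assume e: "e \<in> {e\<in>E. b \<in> e}"
      have "a \<notin> e"
      proof
        assume "a \<in> e"
        then have sub: "{a, b} \<subseteq> e" using e by auto
        have "card e = 2" using e insert.prems by auto
        then have "{a, b} = e" using sub ab(2) by (intro card_subset_eq) (auto intro: card_ge_0_finite)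
        then show False using e insert.hyps(2) ab(1) by auto
      qed
      then have "(\<phi> n)(a := x, b := y) ` e = (\<phi> n)(b := y) ` e" by (intro image_cong) auto
      then show "w n ((\<phi> n)(a := x, b := y) ` e) = w n ((\<phi> n)(b := y) ` e)" by simp
    qed
    finally show ?thesis using ab(2) by (simp add: R_def)
  qed
  have "\<forall>n. \<forall>x\<in>V n. \<bar>\<alpha> n x\<bar> \<le> 1" "\<forall>n. \<forall>x\<in>V n. \<bar>\<beta> n x\<bar> \<le> 1"
    unfolding \<alpha>_def \<beta>_def abs_prod using w by (auto intro!: prod_le_1)
  from cut_smallD[OF small this] have "(\<lambda>n. Q n (\<phi> n)) \<longlonglongrightarrow> 0"
    by (simp add: Q_def split)
  then have "(\<lambda>n. \<bar>Q n (\<phi> n)\<bar>) \<longlonglongrightarrow> 0" by (rule tendsto_rabs_zero)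
  then have "(\<lambda>n. avg A (V n) (R n)) \<longlonglongrightarrow> 0"
    by (rule Lim_null_comparison[rotated]) (use \<phi> resample in auto)
  moreover have "(\<lambda>n. avg A (V n) (\<lambda>\<phi>. \<Prod>e\<in>E. w n (\<phi> ` e))) \<longlonglongrightarrow> p ^ card E"
    using insert by auto
  ultimately have "(\<lambda>n. avg A (V n) (R n) + p * avg A (V n) (\<lambda>\<phi>. \<Prod>e\<in>E. w n (\<phi> ` e))) \<longlonglongrightarrow> 0 + p * p ^ card E"
    by (intro tendsto_intros)
  moreover have "avg A (V n) (R n) + p * avg A (V n) (\<lambda>\<phi>. \<Prod>e\<in>E. w n (\<phi> ` e)) = avg A (V n) (\<lambda>\<phi>. \<Prod>e\<in>insert e0 E. w n (\<phi> ` e))" for n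
    unfolding avg_def mean_cmult[symmetric] mean_add[symmetric]
    by (rule mean_cong) (use insert.hyps ab in \<open>simp add: R_def algebra_simps\<close>)
  ultimately show ?case using insert.hyps by simp
qed

end

section \<open>Densities of subdivisions\<close>

text \<open>\<open>I e\<close> holds the private coordinates of the gadget \<open>e\<close>, and
  \<open>m e\<close> is what \<open>g e\<close> becomes when they are averaged out. In the induction
  \<open>h\<close> collects the gadgets already treated, and it stays independent of the private
  coordinates still to come.\<close>

lemma avg_prod_gadgets:
  fixes g m :: "'e \<Rightarrow> ('i \<Rightarrow> 'v) \<Rightarrow> real"
  assumes "finite E"
    and rep: "\<And>e h. e \<in> E \<Longrightarrow> (\<And>\<phi> a x. a \<in> I e \<Longrightarrow> h (\<phi>(a := x)) = h \<phi>) \<Longrightarrow>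
       avg B V (\<lambda>\<phi>. h \<phi> * g e \<phi>) = avg B V (\<lambda>\<phi>. h \<phi> * m e \<phi>)"
    and g: "\<And>e e' \<phi> a x. e \<in> E \<Longrightarrow> e' \<in> E \<Longrightarrow> e \<noteq> e' \<Longrightarrow> a \<in> I e \<Longrightarrow> g e' (\<phi>(a := x)) = g e' \<phi>"
    and m: "\<And>e e' \<phi> a x. e \<in> E \<Longrightarrow> e' \<in> E \<Longrightarrow> a \<in> I e \<Longrightarrow> m e' (\<phi>(a := x)) = m e' \<phi>"
  shows "avg B V (\<lambda>\<phi>. \<Prod>e\<in>E. g e \<phi>) = avg B V (\<lambda>\<phi>. \<Prod>e\<in>E. m e \<phi>)"
proof -
  have "avg B V (\<lambda>\<phi>. h \<phi> * (\<Prod>e\<in>D. g e \<phi>)) = avg B V (\<lambda>\<phi>. h \<phi> * (\<Prod>e\<in>D. m e \<phi>))"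
    if "finite D" "D \<subseteq> E" "\<And>\<phi> e a x. e \<in> D \<Longrightarrow> a \<in> I e \<Longrightarrow> h (\<phi>(a := x)) = h \<phi>" for D h
    using that
  proof (induction D arbitrary: h rule: finite_induct)
    case (insert c D)
    have "avg B V (\<lambda>\<phi>. h \<phi> * (\<Prod>e\<in>insert c D. g e \<phi>)) = avg B V (\<lambda>\<phi>. (h \<phi> * (\<Prod>e\<in>D. g e \<phi>)) * g c \<phi>)"
      using insert.hyps by (simp add: mult_ac)
    also have "\<dots> = avg B V (\<lambda>\<phi>. (h \<phi> * (\<Prod>e\<in>D. g e \<phi>)) * m c \<phi>)"
    proof (rule rep)
      show "c \<in> E" using insert.prems by simp
      fix \<phi> a x assume a: "a \<in> I c"
      have "g e (\<phi>(a := x)) = g e \<phi>" if "e \<in> D" for e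
        using a insert.prems insert.hyps that by (intro g[of c]) auto
      moreover have "h (\<phi>(a := x)) = h \<phi>" by (rule insert.prems(2)[of c]) (use a in auto)
      ultimately show "h (\<phi>(a := x)) * (\<Prod>e\<in>D. g e (\<phi>(a := x))) = h \<phi> * (\<Prod>e\<in>D. g e \<phi>)"
        by simp
    qed
    also have "\<dots> = avg B V (\<lambda>\<phi>. (h \<phi> * m c \<phi>) * (\<Prod>e\<in>D. g e \<phi>))" by (simp add: mult_ac)
    also have "\<dots> = avg B V (\<lambda>\<phi>. (h \<phi> * m c \<phi>) * (\<Prod>e\<in>D. m e \<phi>))"
    proof (rule insert.IH)
      show "D \<subseteq> E" using insert.prems by simp
      fix \<phi> e a x assume e: "e \<in> D" "a \<in> I e"
      have "h (\<phi>(a := x)) = h \<phi>" by (rule insert.prems(2)[of e]) (use e in auto)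
      moreover have "m c (\<phi>(a := x)) = m c \<phi>" by (rule m[of e]) (use e insert.prems(1) in auto)
      ultimately show "h (\<phi>(a := x)) * m c (\<phi>(a := x)) = h \<phi> * m c \<phi>" by simp
    qed
    finally show ?case using insert.hyps by (simp add: mult_ac)
  qed simp
  from this[of E "\<lambda>_. 1"] show ?thesis using assms(1) by simp
qed

text \<open>The part common to both subdivisions: \<open>I e\<close> contains the new vertices on
  \<open>e\<close>. Once they are averaged out, only the \<open>Inl\<close> copies of the old
  vertices matter.\<close>

lemma tden_subdivision:
  fixes G :: "'a sgraph" and S :: "('a + 'b) sgraph" and V :: "'c set"
  assumes G: "simple_graph G" and V: "finite V" "V \<noteq> {}"
    and S: "finite (verts S)" "Inl ` verts G \<subseteq> verts S"
    and prod: "\<And>\<phi>. (\<Prod>f\<in>edges S. U (\<phi> ` f)) = (\<Prod>e\<in>edges G. g e \<phi>)"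
    and rep: "\<And>e h. e \<in> edges G \<Longrightarrow> (\<And>\<phi> a x. a \<in> I e \<Longrightarrow> h (\<phi>(a := x)) = h \<phi>) \<Longrightarrow>
       avg (verts S) V (\<lambda>\<phi>. h \<phi> * g e \<phi>) = avg (verts S) V (\<lambda>\<phi>. h \<phi> * W ((\<lambda>v. \<phi> (Inl v)) ` e))"
    and g: "\<And>e e' \<phi> a x. e \<in> edges G \<Longrightarrow> e' \<in> edges G \<Longrightarrow> e \<noteq> e' \<Longrightarrow> a \<in> I e \<Longrightarrow> g e' (\<phi>(a := x)) = g e' \<phi>"
    and I: "\<And>e v. e \<in> edges G \<Longrightarrow> Inl v \<notin> I e"
  shows "tden S V U = tden G V W"
proof -
  let ?F = "\<lambda>\<phi> :: 'a + 'b \<Rightarrow> 'c. \<Prod>e\<in>edges G. W ((\<lambda>v. \<phi> (Inl v)) ` e)"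
  have sub: "e \<subseteq> verts G" if "e \<in> edges G" for e using G that by (simp add: simple_graph_def)
  have "tden S V U = avg (verts S) V (\<lambda>\<phi>. \<Prod>e\<in>edges G. g e \<phi>)"
    unfolding tden_def prod ..
  also have "\<dots> = avg (verts S) V ?F"
  proof (rule avg_prod_gadgets[OF finite_edges[OF G] rep g], assumption+)
    fix e e' and \<phi> :: "'a + 'b \<Rightarrow> 'c" and a x assume "e \<in> edges G" "a \<in> I e"
    then have "a \<noteq> Inl v" for v using I[of e v] by auto
    then have "(\<lambda>v. (\<phi>(a := x)) (Inl v)) = (\<lambda>v. \<phi> (Inl v))" by force
    then show "W ((\<lambda>v. (\<phi>(a := x)) (Inl v)) ` e') = W ((\<lambda>v. \<phi> (Inl v)) ` e')" by (simp only:)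
  qed
  also have "\<dots> = avg (Inl ` verts G) V ?F"
  proof (rule avg_unused[OF V S])
    fix \<phi> :: "'a + 'b \<Rightarrow> 'c" and a x assume a: "a \<in> verts S - Inl ` verts G"
    have "W ((\<lambda>v. (\<phi>(a := x)) (Inl v)) ` e) = W ((\<lambda>v. \<phi> (Inl v)) ` e)" if "e \<in> edges G" for e
      using a sub[OF that] by (intro arg_cong[of _ _ W] image_cong) auto
    then show "?F (\<phi>(a := x)) = ?F \<phi>" by simp
  qed
  also have "\<dots> = tden G V W"
    unfolding tden_def avg_reindex[OF inj_Inl[THEN inj_on_subset, OF subset_UNIV]]
  proof (intro avg_cong prod.cong refl arg_cong[of _ _ W])
    fix \<phi> :: "'a \<Rightarrow> 'c" and e assume e: "e \<in> edges G"
    let ?\<psi> = "\<lambda>b :: 'a + 'b. if b \<in> Inl ` verts G then \<phi> (the_inv_into (verts G) Inl b) else undefined"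
    show "(\<lambda>v. ?\<psi> (Inl v)) ` e = \<phi> ` e"
      by (rule image_cong[OF refl])
        (use sub[OF e] in \<open>auto simp: the_inv_into_f_f[OF inj_Inl[THEN inj_on_subset, OF subset_UNIV]]\<close>)
  qed
  finally show ?thesis .
qed

text \<open>Turns a symmetric function of two vertices into a function of sets.\<close>

lemma Min_Max_pair_symmetric:
  fixes x y :: nat
  assumes "\<And>x y. K x y = K y x"
  shows "K (Min {x, y}) (Max {x, y}) = K x y"
  using assms by (cases "x \<le> y") (auto simp: min_def max_def)

section \<open>Triangle gadgets\<close>

definition triangle_edges :: "'a set \<Rightarrow> ('a + 'a set) set set" where
  "triangle_edges e = insert (Inl ` e) ((\<lambda>u. {Inl u, Inr e}) ` e)"

lemma edges_K3_subdivision: "edges (K3_subdivision G) = (\<Union>e\<in>edges G. triangle_edges e)"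
  unfolding K3_subdivision_def triangle_edges_def by auto

lemma triangle_edges_disjoint: "e \<noteq> e' \<Longrightarrow> triangle_edges e \<inter> triangle_edges e' = {}"
  unfolding triangle_edges_def by (auto simp: doubleton_eq_iff inj_image_eq_iff)

lemma triangle_edges_pair:
  assumes "u \<noteq> v"
  shows "card (triangle_edges {u, v}) = 3" (is ?A)
    and "(\<Prod>f\<in>triangle_edges {u, v}. k f) = k {Inl u, Inl v} * (k {Inl u, Inr {u, v}} * k {Inl v, Inr {u, v}} :: real)" (is ?B)
proof -
  have "triangle_edges {u, v} = {{Inl u, Inl v}, {Inl u, Inr {u, v}}, {Inl v, Inr {u, v}}}"
    by (simp add: triangle_edges_def)
  moreover have "{Inl u, Inl v} \<noteq> {Inl u, Inr {u, v}}" "{Inl u, Inl v} \<noteq> {Inl v, Inr {u, v}}"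
    "{Inl u, Inr {u, v}} \<noteq> {Inl v, Inr {u, v}}"
    using assms by (auto simp: doubleton_eq_iff)
  ultimately show ?A ?B by simp_all
qed

lemma edge_pair:
  assumes "simple_graph G" "e \<in> edges G"
  obtains u v where "e = {u, v}" "u \<noteq> v" "u \<in> verts G" "v \<in> verts G"
  using assms unfolding simple_graph_def by (metis card_2_iff insert_subset)

lemma finite_triangle_edges: "finite e \<Longrightarrow> finite (triangle_edges e)"
  by (simp add: triangle_edges_def)

lemma simple_graph_finite_edge: "simple_graph G \<Longrightarrow> e \<in> edges G \<Longrightarrow> finite e"
  unfolding simple_graph_def by (meson finite_subset)

lemma card_edges_K3_subdivision:
  assumes "simple_graph G"
  shows "card (edges (K3_subdivision G)) = 3 * card (edges G)"
proof -
  have "card (\<Union>e\<in>edges G. triangle_edges e) = (\<Sum>e\<in>edges G. card (triangle_edges e))"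
    by (intro card_UN_disjoint finite_edges ballI impI triangle_edges_disjoint finite_triangle_edges
        simple_graph_finite_edge[OF assms] assms)
  also have "\<dots> = (\<Sum>e\<in>edges G. 3)"
    by (rule sum.cong[OF refl]) (metis edge_pair[OF assms] triangle_edges_pair(1))
  finally show ?thesis by (simp add: edges_K3_subdivision)
qed

text \<open>The new vertex of \<open>e\<close> lies in no other triangle, so averaging over it
  yields a codegree. If the two ends have the same image, \<open>Min\<close> and \<open>Max\<close>
  agree and the formula still gives the right loop weight.\<close>

lemma tden_K3_subdivision:
  fixes V :: "nat set"
  assumes G: "simple_graph G" and V: "finite V" "V \<noteq> {}"
  shows "tden (K3_subdivision G) V U = tden G V (\<lambda>s. U s * mean V (\<lambda>z. U {Min s, z} * U {Max s, z}))"
proof (rule tden_subdivision[OF G V, where I = "\<lambda>e. {Inr e}" and g = "\<lambda>e \<phi>. \<Prod>f\<in>triangle_edges e. U (\<phi> ` f)"])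
  show "finite (verts (K3_subdivision G))"
    using simple_graph_K3_subdivision[OF G] by (simp add: simple_graph_def)
  show "Inl ` verts G \<subseteq> verts (K3_subdivision G)" by (simp add: K3_subdivision_def)
  show "(\<Prod>f\<in>edges (K3_subdivision G). U (\<phi> ` f)) = (\<Prod>e\<in>edges G. \<Prod>f\<in>triangle_edges e. U (\<phi> ` f))" for \<phi>
    unfolding edges_K3_subdivision
    by (intro prod.UNION_disjoint finite_edges ballI impI triangle_edges_disjoint finite_triangle_edges
        simple_graph_finite_edge[OF G] G)
next
  fix e and h :: "('a + 'a set \<Rightarrow> nat) \<Rightarrow> real"
  assume e: "e \<in> edges G" and h: "\<And>\<phi> a x. a \<in> {Inr e} \<Longrightarrow> h (\<phi>(a := x)) = h \<phi>"
  obtain u v where uv: "e = {u, v}" "u \<noteq> v" using edge_pair[OF G e] by metis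
  have mem: "Inr e \<in> verts (K3_subdivision G)" using e by (simp add: K3_subdivision_def)
  define K where "K x y = U {x, y} * mean V (\<lambda>z. U {x, z} * U {y, z})" for x y
  have K: "K x y = K y x" for x y by (simp add: K_def insert_commute mult.commute)
  have W: "U {x, y} * mean V (\<lambda>z. U {Min {x, y}, z} * U {Max {x, y}, z}) = K x y" for x y
  proof -
    have "{Min {x, y}, Max {x, y}} = {x, y}" by (auto simp: min_def max_def)
    then show ?thesis using Min_Max_pair_symmetric[of K x y, OF K] by (simp add: K_def)
  qed
  have "avg (verts (K3_subdivision G)) V (\<lambda>\<phi>. h \<phi> * (\<Prod>f\<in>triangle_edges e. U (\<phi> ` f)))
    = avg (verts (K3_subdivision G)) V (\<lambda>\<phi>. mean V (\<lambda>z. h \<phi> * (U {\<phi> (Inl u), \<phi> (Inl v)} * (U {\<phi> (Inl u), z} * U {\<phi> (Inl v), z}))))"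
    by (subst avg_resample[OF V mem]) (use uv h in \<open>simp add: triangle_edges_pair(2)\<close>)
  also have "\<dots> = avg (verts (K3_subdivision G)) V (\<lambda>\<phi>. h \<phi> * K (\<phi> (Inl u)) (\<phi> (Inl v)))"
    by (simp add: mean_cmult K_def)
  finally show "avg (verts (K3_subdivision G)) V (\<lambda>\<phi>. h \<phi> * (\<Prod>f\<in>triangle_edges e. U (\<phi> ` f))) =
     avg (verts (K3_subdivision G)) V (\<lambda>\<phi>. h \<phi> * (U ((\<lambda>v. \<phi> (Inl v)) ` e) *
        mean V (\<lambda>z. U {Min ((\<lambda>v. \<phi> (Inl v)) ` e), z} * U {Max ((\<lambda>v. \<phi> (Inl v)) ` e), z})))"
    unfolding uv(1) image_insert image_empty W .
next
  fix e e' :: "'a set" and \<phi> :: "'a + 'a set \<Rightarrow> nat" and a :: "'a + 'a set" and x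
  assume "e \<noteq> e'" "a \<in> {Inr e}"
  then show "(\<Prod>f\<in>triangle_edges e'. U (\<phi>(a := x) ` f)) = (\<Prod>f\<in>triangle_edges e'. U (\<phi> ` f))"
    by (intro prod.cong refl arg_cong[of _ _ U] image_cong) (auto simp: triangle_edges_def)
qed simp

section \<open>Walks and path gadgets\<close>

lemma walk_Suc_left: "walk V U (Suc j) x y = mean V (\<lambda>z. U x z * walk V U j z y)"
proof (induction j arbitrary: y)
  case (Suc j)
  have "walk V U (Suc (Suc j)) x y = mean V (\<lambda>z. mean V (\<lambda>t. U x t * (walk V U j t z * U z y)))"
    unfolding walk.simps(2)[of V U "Suc j"] Suc.IH by (simp add: mean_multc[symmetric] mult.assoc)
  also have "\<dots> = mean V (\<lambda>t. U x t * walk V U (Suc j) t y)"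
    by (subst mean_swap) (simp add: mean_cmult)
  finally show ?case .
qed simp

lemma walk_symmetric:
  assumes "\<And>x y. U x y = U y x"
  shows "walk V U j x y = walk V U j y x"
proof (induction j arbitrary: x y)
  case (Suc j)
  have "walk V U (Suc j) x y = mean V (\<lambda>z. U y z * walk V U j z x)"
    unfolding walk.simps by (rule mean_cong) (metis Suc.IH assms mult.commute)
  then show ?case by (simp only: walk_Suc_left)
qed (simp add: assms)

lemma walk_range:
  assumes "\<And>x y. 0 \<le> U x y \<and> U x y \<le> 1"
  shows "0 \<le> walk V U j x y \<and> walk V U j x y \<le> 1"
proof (induction j arbitrary: y)
  case (Suc j)
  have "0 \<le> walk V U j x z * U z y \<and> walk V U j x z * U z y \<le> 1" for z
    using Suc.IH[of z] assms[of z y] mult_le_one by auto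
  then show ?case by (auto intro!: mean_nonneg mean_le_bound)
qed (use assms in auto)

text \<open>The internal vertices are averaged out from the start of the path. The last edge is
  first moved into \<open>h\<close>, where it does not involve the internal vertices covered by the
  induction hypothesis.\<close>

lemma avg_path_eq_walk:
  assumes V: "finite V" "V \<noteq> {}" and P: "inj_on P {..Suc j}" "P ` {..Suc j} \<subseteq> B"
    and h: "\<And>\<phi> i x. 1 \<le> i \<Longrightarrow> i \<le> j \<Longrightarrow> h (\<phi>(P i := x)) = h \<phi>"
  shows "avg B V (\<lambda>\<phi>. h \<phi> * (\<Prod>i<Suc j. U (\<phi> (P i)) (\<phi> (P (Suc i))))) =
    avg B V (\<lambda>\<phi>. h \<phi> * walk V U j (\<phi> (P 0)) (\<phi> (P (Suc j))))"
  using P h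
proof (induction j arbitrary: h)
  case 0
  then show ?case by simp
next
  case (Suc j)
  have ne: "P i \<noteq> P (Suc j)" if "i \<le> Suc (Suc j)" "i \<noteq> Suc j" for i
    using Suc.prems(1) that by (auto dest: inj_onD)
  have "avg B V (\<lambda>\<phi>. h \<phi> * (\<Prod>i<Suc (Suc j). U (\<phi> (P i)) (\<phi> (P (Suc i))))) =
    avg B V (\<lambda>\<phi>. (h \<phi> * U (\<phi> (P (Suc j))) (\<phi> (P (Suc (Suc j))))) * (\<Prod>i<Suc j. U (\<phi> (P i)) (\<phi> (P (Suc i)))))"
    by (simp add: mult_ac)
  also have "\<dots> = avg B V (\<lambda>\<phi>. (h \<phi> * U (\<phi> (P (Suc j))) (\<phi> (P (Suc (Suc j))))) * walk V U j (\<phi> (P 0)) (\<phi> (P (Suc j))))"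
  proof (rule Suc.IH)
    show "inj_on P {..Suc j}" by (rule inj_on_subset[OF Suc.prems(1)]) auto
    show "P ` {..Suc j} \<subseteq> B" using Suc.prems(2) by auto
    fix \<phi> i x assume i: "1 \<le> i" "i \<le> j"
    then have "P i \<noteq> P (Suc j)" "P i \<noteq> P (Suc (Suc j))"
      using Suc.prems(1) by (auto dest: inj_onD)
    moreover have "h (\<phi>(P i := x)) = h \<phi>" by (rule Suc.prems(3)) (use i in auto)
    ultimately show "h (\<phi>(P i := x)) * U ((\<phi>(P i := x)) (P (Suc j))) ((\<phi>(P i := x)) (P (Suc (Suc j)))) =
      h \<phi> * U (\<phi> (P (Suc j))) (\<phi> (P (Suc (Suc j))))"
      by simp
  qed
  also have "\<dots> = avg B V (\<lambda>\<phi>. mean V (\<lambda>z. h \<phi> * (walk V U j (\<phi> (P 0)) z * U z (\<phi> (P (Suc (Suc j)))))))"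
  proof (subst avg_resample[OF V, of "P (Suc j)"])
    show "P (Suc j) \<in> B" using Suc.prems(2) by auto
    show "avg B V (\<lambda>\<phi>. mean V (\<lambda>x. h (\<phi>(P (Suc j) := x)) *
         U ((\<phi>(P (Suc j) := x)) (P (Suc j))) ((\<phi>(P (Suc j) := x)) (P (Suc (Suc j)))) *
         walk V U j ((\<phi>(P (Suc j) := x)) (P 0)) ((\<phi>(P (Suc j) := x)) (P (Suc j))))) =
      avg B V (\<lambda>\<phi>. mean V (\<lambda>z. h \<phi> * (walk V U j (\<phi> (P 0)) z * U z (\<phi> (P (Suc (Suc j)))))))"
    proof -
      have "h (\<phi>(P (Suc j) := x)) = h \<phi>" for \<phi> x by (rule Suc.prems(3)) auto
      then show ?thesis using ne[of 0] ne[of "Suc (Suc j)"] by (simp add: mult_ac)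
    qed
  qed
  finally show ?case by (simp add: mean_cmult)
qed

definition path_edges :: "nat \<Rightarrow> 'a \<Rightarrow> 'a \<Rightarrow> ('a + ('a \<times> nat) set) set set" where
  "path_edges k u v = (\<lambda>i. {path_vertex k u v i, path_vertex k u v (Suc i)}) ` {..<k}"

lemma path_edges_reverse_subset:
  assumes "0 < k"
  shows "path_edges k v u \<subseteq> path_edges k u v"
proof
  fix f assume "f \<in> path_edges k v u"
  then obtain i where i: "i < k" "f = {path_vertex k v u i, path_vertex k v u (Suc i)}"
    by (auto simp: path_edges_def)
  have "path_vertex k v u i = path_vertex k u v (Suc (k - Suc i))"
    using path_vertex_reverse[of i k u v] i assms by (simp add: Suc_diff_Suc)
  moreover have "path_vertex k v u (Suc i) = path_vertex k u v (k - Suc i)"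
    using path_vertex_reverse[of "Suc i" k u v] i assms by simp
  ultimately show "f \<in> path_edges k u v"
    using i by (auto simp: path_edges_def intro!: image_eqI[of _ _ "k - Suc i"])
qed

lemma path_edges_reverse: "0 < k \<Longrightarrow> path_edges k v u = path_edges k u v"
  by (simp add: path_edges_reverse_subset subset_antisym)

lemma inj_on_path_vertex: "u \<noteq> v \<Longrightarrow> inj_on (path_vertex k u v) {..k}"
  by (rule inj_onI) (auto simp: path_vertex_def doubleton_eq_iff split: if_splits)

lemma inj_on_path_edge:
  assumes "u \<noteq> v"
  shows "inj_on (\<lambda>i. {path_vertex k u v i, path_vertex k u v (Suc i)}) {..<k}"
proof (rule inj_onI)
  fix i j assume ij: "i \<in> {..<k}" "j \<in> {..<k}"
    and eq: "{path_vertex k u v i, path_vertex k u v (Suc i)} = {path_vertex k u v j, path_vertex k u v (Suc j)}"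
  have inj: "path_vertex k u v a = path_vertex k u v b \<longleftrightarrow> a = b" if "a \<le> k" "b \<le> k" for a b
    using inj_on_eq_iff[OF inj_on_path_vertex[OF assms, of k]] that by simp
  \<comment> \<open>The crossed case \<open>i = Suc j\<close> and \<open>Suc i = j\<close> is
    arithmetically impossible.\<close>
  show "i = j" using eq ij by (simp add: doubleton_eq_iff inj) linarith
qed

text \<open>For \<open>k \<ge> 2\<close> no path edge joins the two ends directly, and the name of
  an internal vertex records both ends. An edge of the subdivision therefore determines the edge it
  comes from.\<close>

lemma path_edges_internal_vertex:
  assumes "2 \<le> k" "f \<in> path_edges k u v"
  shows "\<exists>X. Inr X \<in> f" and "Inr X \<in> f \<Longrightarrow> fst ` X = {u, v}"
  using assms by (auto simp: path_edges_def path_vertex_def split: if_splits, blast)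

text \<open>\<open>SOME\<close> picks an orientation of the edge; by
  \<open>path_edges_reverse\<close> the choice does not affect the path.\<close>

definition edge_path :: "nat \<Rightarrow> 'a set \<Rightarrow> ('a + ('a \<times> nat) set) set set" where
  "edge_path k e = (let (u, v) = (SOME (u, v). e = {u, v}) in path_edges k u v)"

lemma edge_path_pair:
  assumes "0 < k"
  shows "edge_path k {u, v} = path_edges k u v"
proof -
  obtain a b where ab: "(SOME (a, b). {u, v} = {a, b}) = (a, b)" by fastforce
  have "case (SOME (a, b). {u, v} = {a, b}) of (a, b) \<Rightarrow> {u, v} = {a, b}"
    by (rule someI[of "\<lambda>(a, b). {u, v} = {a, b}" "(u, v)"]) simp
  then have "{u, v} = {a, b}" unfolding ab by simp
  then have "(a, b) = (u, v) \<or> (a, b) = (v, u)" by (auto simp: doubleton_eq_iff)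
  then show ?thesis
    unfolding edge_path_def ab using path_edges_reverse[OF assms, of u v] by auto
qed

lemma edges_path_subdivision:
  assumes "simple_graph G" "0 < k"
  shows "edges (path_subdivision k G) = (\<Union>e\<in>edges G. edge_path k e)"
proof -
  have "edges (path_subdivision k G) = (\<Union>(u, v)\<in>{(u, v). {u, v} \<in> edges G}. path_edges k u v)"
    by (auto simp: path_subdivision_def path_edges_def)
  also have "\<dots> = (\<Union>(u, v)\<in>{(u, v). {u, v} \<in> edges G}. edge_path k {u, v})"
    using assms(2) by (simp add: edge_path_pair)
  also have "\<dots> = (\<Union>e\<in>edges G. edge_path k e)"
    using edge_pair[OF assms(1)] by (auto, metis)
  finally show ?thesis .
qed

lemma edge_path_internal_vertex:
  assumes "simple_graph G" "2 \<le> k" "e \<in> edges G" "f \<in> edge_path k e"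
  shows "\<exists>X. Inr X \<in> f" and "Inr X \<in> f \<Longrightarrow> fst ` X = e"
proof -
  obtain u v where uv: "e = {u, v}" using edge_pair[OF assms(1,3)] by metis
  have f: "f \<in> path_edges k u v" using assms(2,4) by (simp add: uv edge_path_pair)
  show "\<exists>X. Inr X \<in> f" "Inr X \<in> f \<Longrightarrow> fst ` X = e"
    using path_edges_internal_vertex[OF assms(2) f] uv by auto
qed

lemma edge_path_disjoint:
  assumes "simple_graph G" "2 \<le> k" "e \<in> edges G" "e' \<in> edges G" "e \<noteq> e'"
  shows "edge_path k e \<inter> edge_path k e' = {}"
proof (rule ccontr)
  assume "edge_path k e \<inter> edge_path k e' \<noteq> {}"
  then obtain f where f: "f \<in> edge_path k e" "f \<in> edge_path k e'" by blast
  then obtain X where "Inr X \<in> f" using edge_path_internal_vertex(1)[OF assms(1-3)] by blast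
  then show False
    using edge_path_internal_vertex(2)[OF assms(1,2)] f assms(3-5) by metis
qed

lemma finite_edge_path: "finite (edge_path k e)"
  by (simp add: edge_path_def path_edges_def case_prod_unfold Let_def)

lemma card_edges_path_subdivision:
  assumes "simple_graph G" "2 \<le> k"
  shows "card (edges (path_subdivision k G)) = k * card (edges G)"
proof -
  have "card (\<Union>e\<in>edges G. edge_path k e) = (\<Sum>e\<in>edges G. card (edge_path k e))"
    by (intro card_UN_disjoint finite_edges ballI impI edge_path_disjoint[OF assms] finite_edge_path assms)
  also have "\<dots> = (\<Sum>e\<in>edges G. k)"
  proof (rule sum.cong[OF refl])
    fix e assume "e \<in> edges G"
    then obtain u v where "e = {u, v}" "u \<noteq> v" using edge_pair[OF assms(1)] by metis
    then show "card (edge_path k e) = k"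
      using assms(2) by (simp add: edge_path_pair path_edges_def card_image inj_on_path_edge)
  qed
  finally show ?thesis using assms by (simp add: edges_path_subdivision)
qed

lemma tden_path_subdivision:
  fixes V :: "nat set" and G :: "'a sgraph"
  assumes G: "simple_graph G" and V: "finite V" "V \<noteq> {}" and k: "2 \<le> k"
  shows "tden (path_subdivision k G) V U = tden G V (\<lambda>s. walk V (\<lambda>x y. U {x, y}) (k - 1) (Min s) (Max s))"
\<comment> \<open>The private vertices of \<open>e\<close> are recognised by their names: the first
  components form \<open>e\<close>. Names of distinct edges are therefore distinct.\<close>
proof (rule tden_subdivision[OF G V, where I = "\<lambda>e. Inr ` {X. fst ` X = e}"
      and g = "\<lambda>e \<phi>. \<Prod>f\<in>edge_path k e. U (\<phi> ` f)"])
  show "finite (verts (path_subdivision k G))"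
    using simple_graph_path_subdivision[OF G k] by (simp add: simple_graph_def)
  show "Inl ` verts G \<subseteq> verts (path_subdivision k G)" by (simp add: path_subdivision_def)
  show "(\<Prod>f\<in>edges (path_subdivision k G). U (\<phi> ` f)) = (\<Prod>e\<in>edges G. \<Prod>f\<in>edge_path k e. U (\<phi> ` f))" for \<phi>
  proof -
    have "(\<Prod>f\<in>(\<Union>e\<in>edges G. edge_path k e). U (\<phi> ` f)) = (\<Prod>e\<in>edges G. \<Prod>f\<in>edge_path k e. U (\<phi> ` f))"
      by (intro prod.UNION_disjoint finite_edges ballI impI edge_path_disjoint[OF G k] finite_edge_path G)
    then show ?thesis using k by (simp add: edges_path_subdivision[OF G])
  qed
next
  fix e and h :: "('a + ('a \<times> nat) set \<Rightarrow> nat) \<Rightarrow> real"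
  assume e: "e \<in> edges G" and h: "\<And>\<phi> a x. a \<in> Inr ` {X. fst ` X = e} \<Longrightarrow> h (\<phi>(a := x)) = h \<phi>"
  obtain u v where uv: "e = {u, v}" "u \<noteq> v" "u \<in> verts G" "v \<in> verts G" using edge_pair[OF G e] by metis
  obtain j where j: "k = Suc j" using k by (cases k) auto
  let ?K = "\<lambda>x y. U {x, y}" and ?P = "path_vertex k u v" and ?B = "verts (path_subdivision k G)"
  have W: "walk V ?K j (Min {x, y}) (Max {x, y}) = walk V ?K j x y" for x y
    by (rule Min_Max_pair_symmetric) (rule walk_symmetric, simp add: insert_commute)
  have "(\<Prod>f\<in>edge_path k e. U (\<phi> ` f)) = (\<Prod>i<Suc j. ?K (\<phi> (?P i)) (\<phi> (?P (Suc i))))" for \<phi>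
    using k inj_on_path_edge[OF uv(2), of k] by (simp add: uv(1) edge_path_pair path_edges_def prod.reindex j)
  then have "avg ?B V (\<lambda>\<phi>. h \<phi> * (\<Prod>f\<in>edge_path k e. U (\<phi> ` f))) =
      avg ?B V (\<lambda>\<phi>. h \<phi> * (\<Prod>i<Suc j. ?K (\<phi> (?P i)) (\<phi> (?P (Suc i)))))"
    by (simp only:)
  also have "\<dots> = avg ?B V (\<lambda>\<phi>. h \<phi> * walk V ?K j (\<phi> (?P 0)) (\<phi> (?P (Suc j))))"
  proof (rule avg_path_eq_walk[OF V])
    show "inj_on ?P {..Suc j}" using inj_on_path_vertex[OF uv(2), of k] by (simp add: j)
    show "?P ` {..Suc j} \<subseteq> ?B"
    proof clarify
      fix i assume "i \<le> Suc j"
      then consider "i = 0" | "i = k" | "0 < i" "i < k" using j by linarith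
      then show "?P i \<in> ?B"
      proof cases
        case 3
        then show ?thesis using e uv(1) by (auto simp: path_subdivision_def)
      qed (use uv k in \<open>auto simp: path_vertex_def path_subdivision_def\<close>)
    qed
    fix \<phi> i x assume "1 \<le> i" "i \<le> j"
    then show "h (\<phi>(?P i := x)) = h \<phi>"
      by (intro h) (auto simp: path_vertex_def j uv(1))
  qed
  also have "\<dots> = avg ?B V (\<lambda>\<phi>. h \<phi> * walk V ?K j (\<phi> (Inl u)) (\<phi> (Inl v)))"
    by (simp add: path_vertex_def j)
  finally show "avg ?B V (\<lambda>\<phi>. h \<phi> * (\<Prod>f\<in>edge_path k e. U (\<phi> ` f))) =
      avg ?B V (\<lambda>\<phi>. h \<phi> * walk V ?K (k - 1) (Min ((\<lambda>v. \<phi> (Inl v)) ` e)) (Max ((\<lambda>v. \<phi> (Inl v)) ` e)))"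
    unfolding uv(1) image_insert image_empty by (simp only: W j diff_Suc_1)
next
  fix e e' :: "'a set" and \<phi> :: "'a + ('a \<times> nat) set \<Rightarrow> nat" and a :: "'a + ('a \<times> nat) set" and x
  assume e: "e \<in> edges G" "e' \<in> edges G" "e \<noteq> e'" "a \<in> Inr ` {X. fst ` X = e}"
  have "a \<notin> f" if "f \<in> edge_path k e'" for f
    using edge_path_internal_vertex(2)[OF G k e(2) that] e(3,4) by auto
  then show "(\<Prod>f\<in>edge_path k e'. U (\<phi>(a := x) ` f)) = (\<Prod>f\<in>edge_path k e'. U (\<phi> ` f))"
    by (intro prod.cong refl arg_cong[of _ _ U] image_cong) auto
qed auto

section \<open>Forcing\<close>

lemma has_density_Suc: "has_density p (\<lambda>n. H (Suc n)) J \<longleftrightarrow> has_density p H J"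
  unfolding has_density_def asymp_equiv_def
  by (rule filterlim_sequentially_Suc[of "\<lambda>n. if hom_density J (H n) = 0 \<and> p ^ card (edges J) = 0 then 1 else hom_density J (H n) / p ^ card (edges J)"])

text \<open>Only the first graph of a sequence of increasing order can be empty.\<close>

lemma forces_at_nonemptyI:
  assumes "\<And>H :: nat \<Rightarrow> nat sgraph. (\<And>n. simple_graph (H n)) \<Longrightarrow> (\<And>n. verts (H n) \<noteq> {}) \<Longrightarrow>
     strict_mono (\<lambda>n. card (verts (H n))) \<Longrightarrow> has_density p H A \<Longrightarrow> has_density p H B \<Longrightarrow> quasi_random p H"
  shows "forces_at p A B"
  unfolding forces_at_def
proof (intro allI impI)
  fix H :: "nat \<Rightarrow> nat sgraph"
  assume H: "(\<forall>n. simple_graph (H n)) \<and> increasing_order H \<and> has_density p H A \<and> has_density p H B"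
  then have mono: "strict_mono (\<lambda>n. card (verts (H n)))" by (simp add: increasing_order_def)
  have "quasi_random p (\<lambda>n. H (Suc n))"
  proof (rule assms)
    show "verts (H (Suc n)) \<noteq> {}" for n
      using strict_monoD[OF mono, of 0 "Suc n"] by auto
    show "strict_mono (\<lambda>n. card (verts (H (Suc n))))"
      using mono by (simp add: strict_mono_def)
  qed (use H in \<open>simp_all add: has_density_Suc\<close>)
  then show "quasi_random p H" by (simp add: quasi_random_def has_density_Suc)
qed

lemma quasi_random_of_cut_small:
  fixes H :: "nat \<Rightarrow> nat sgraph"
  assumes H: "\<And>n. simple_graph (H n)" "\<And>n. verts (H n) \<noteq> {}" and p: "0 < p"
    and small: "cut_small (\<lambda>n. verts (H n)) (\<lambda>n x y. of_bool ({x, y} \<in> edges (H n)) - p)"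
  shows "quasi_random p H"
  unfolding quasi_random_def has_density_iff_tendsto[OF p]
proof (intro allI impI)
  fix J :: "nat sgraph" assume J: "simple_graph J"
  have fin: "finite (verts (H n))" for n using H by (simp add: simple_graph_def)
  interpret vertex_sets "\<lambda>n. verts (H n)" by unfold_locales (use fin H in auto)
  have "(\<lambda>n. avg (verts J) (verts (H n)) (\<lambda>\<phi>. \<Prod>e\<in>edges J. of_bool (\<phi> ` e \<in> edges (H n)))) \<longlonglongrightarrow> p ^ card (edges J)"
    by (rule counting_lemma[of "\<lambda>n e. of_bool (e \<in> edges (H n))", OF small])
      (use J finite_edges[OF J] in \<open>auto simp: simple_graph_def\<close>)
  then show "(\<lambda>n. hom_density J (H n)) \<longlonglongrightarrow> p ^ card (edges J)"
    by (simp add: hom_density_eq_tden[OF J fin] tden_def)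
qed

text \<open>Forcing is invoked once for each of the three small graphs, possibly with different
  roundings, since only the densities in the common weight \<open>w\<close> enter the
  conclusion.\<close>

lemma cut_small_of_forcing:
  fixes V :: "nat \<Rightarrow> nat set"
  assumes forces: "forces_at q F G" and FG: "simple_graph F" "simple_graph G" and q: "0 < q"
    and V: "\<And>n. finite (V n)" "\<And>n. V n \<noteq> {}" "strict_mono (\<lambda>n. card (V n))"
    and w: "\<And>n. \<forall>e. 0 \<le> w n e \<and> w n e \<le> 1"
    and lim: "(\<lambda>n. tden F (V n) (w n)) \<longlonglongrightarrow> q ^ card (edges F)" "(\<lambda>n. tden G (V n) (w n)) \<longlonglongrightarrow> q ^ card (edges G)"
  shows "cut_small V (\<lambda>n x y. w n {x, y} - q)"
proof -
  interpret vertex_sets V by unfold_locales (use V in auto)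
  have "(\<lambda>n. tden J (V n) (w n)) \<longlonglongrightarrow> q ^ card (edges J)" if "simple_graph J" for J :: "nat sgraph"
    by (rule kernel_forcing[OF forces FG that q V w lim])
  from this[OF simple_small_graphs(1)] this[OF simple_small_graphs(2)] this[OF simple_small_graphs(3)]
  show ?thesis by (intro cut_small_of_densities) (simp_all add: card_edges_small_graphs)
qed

lemma K3_subdivision_forces_at:
  assumes FG: "simple_graph F" "simple_graph G" and p: "0 < p" "p \<le> 1" and forces: "forces_at (p ^ 3) F G"
  shows "forces_at p (K3_subdivision F) (K3_subdivision G)"
proof (rule forces_at_nonemptyI)
  fix H :: "nat \<Rightarrow> nat sgraph"
  assume H: "\<And>n. simple_graph (H n)" "\<And>n. verts (H n) \<noteq> {}" and mono: "strict_mono (\<lambda>n. card (verts (H n)))"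
    and dens: "has_density p H (K3_subdivision F)" "has_density p H (K3_subdivision G)"
  define V where "V n = verts (H n)" for n
  have V: "finite (V n)" "V n \<noteq> {}" for n using H by (auto simp: V_def simple_graph_def)
  interpret vertex_sets V by unfold_locales (use V in auto)
  define U where "U n e = (of_bool (e \<in> edges (H n)) :: real)" for n e
  have U_eq: "(\<lambda>e. of_bool (e \<in> edges (H n))) = U n" for n by (simp add: U_def fun_eq_iff)
  have U01: "0 \<le> U n e" "U n e \<le> 1" for n e by (auto simp: U_def)
  define w where "w n s = U n s * mean (V n) (\<lambda>z. U n {Min s, z} * U n {Max s, z})" for n s
  have w: "0 \<le> w n s \<and> w n s \<le> 1" for n s
  proof -
    have "0 \<le> mean (V n) (\<lambda>z. U n {Min s, z} * U n {Max s, z})" "mean (V n) (\<lambda>z. U n {Min s, z} * U n {Max s, z}) \<le> 1"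
      using U01 by (auto intro!: mean_nonneg mean_le_bound mult_le_one)
    then show ?thesis unfolding w_def using U01 by (auto intro!: mult_le_one)
  qed
  have lim: "(\<lambda>n. tden J (V n) (w n)) \<longlonglongrightarrow> (p ^ 3) ^ card (edges J)"
    if J: "simple_graph J" and d: "has_density p H (K3_subdivision J)" for J :: "'x sgraph"
  proof -
    have "hom_density (K3_subdivision J) (H n) = tden J (V n) (w n)" for n
      using hom_density_eq_tden[OF simple_graph_K3_subdivision[OF J], of "H n"] V
        tden_K3_subdivision[OF J V, of n "U n"]
      by (simp add: V_def[symmetric] U_eq w_def[abs_def])
    then show ?thesis
      using d by (simp add: has_density_iff_tendsto[OF p(1)] card_edges_K3_subdivision[OF J] power_mult)
  qed
  have "cut_small V (\<lambda>n x y. w n {x, y} - p ^ 3)"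
    by (rule cut_small_of_forcing[OF forces FG _ V _ _ lim[OF FG(1) dens(1)] lim[OF FG(2) dens(2)]])
      (use p w mono in \<open>auto simp: V_def\<close>)
  moreover have "w n {x, y} = U n {x, y} * codeg (\<lambda>n x y. U n {x, y}) n x y" for n x y
  proof -
    have "mean (V n) (\<lambda>z. U n {Min {x, y}, z} * U n {Max {x, y}, z}) = mean (V n) (\<lambda>z. U n {x, z} * U n {y, z})"
      by (rule Min_Max_pair_symmetric[of "\<lambda>x y. mean (V n) (\<lambda>z. U n {x, z} * U n {y, z})"]) (simp add: mult.commute)
    then show ?thesis unfolding w_def codeg_def by (simp add: insert_commute)
  qed
  ultimately have "cut_small V (\<lambda>n x y. U n {x, y} - p)"
    by (intro cut_small_triangle_kernel[of "\<lambda>n x y. U n {x, y}"]) (use U01 p in \<open>auto simp: insert_commute\<close>)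
  then show "quasi_random p H"
    by (intro quasi_random_of_cut_small H p) (simp add: V_def[abs_def] U_def)
qed

lemma path_subdivision_forces_at_pos:
  assumes FG: "simple_graph F" "simple_graph G" and p: "0 < p" "p \<le> 1" and k: "2 \<le> k" and forces: "forces_at (p ^ k) F G"
  shows "forces_at p (path_subdivision k F) (path_subdivision k G)"
proof (rule forces_at_nonemptyI)
  fix H :: "nat \<Rightarrow> nat sgraph"
  assume H: "\<And>n. simple_graph (H n)" "\<And>n. verts (H n) \<noteq> {}" and mono: "strict_mono (\<lambda>n. card (verts (H n)))"
    and dens: "has_density p H (path_subdivision k F)" "has_density p H (path_subdivision k G)"
  define V where "V n = verts (H n)" for n
  have V: "finite (V n)" "V n \<noteq> {}" for n using H by (auto simp: V_def simple_graph_def)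
  interpret vertex_sets V by unfold_locales (use V in auto)
  define U where "U n e = (of_bool (e \<in> edges (H n)) :: real)" for n e
  have U_eq: "(\<lambda>e. of_bool (e \<in> edges (H n))) = U n" for n by (simp add: U_def fun_eq_iff)
  have U01: "0 \<le> U n e" "U n e \<le> 1" for n e by (auto simp: U_def)
  define K where "K n x y = U n {x, y}" for n x y
  have K01: "0 \<le> K n x y \<and> K n x y \<le> 1" and K: "K n x y = K n y x" for n x y
    using U01 by (auto simp: K_def insert_commute)
  define w where "w n s = walk (V n) (K n) (k - 1) (Min s) (Max s)" for n s
  have w: "0 \<le> w n s \<and> w n s \<le> 1" for n s
    unfolding w_def by (rule walk_range[OF K01])
  have lim: "(\<lambda>n. tden J (V n) (w n)) \<longlonglongrightarrow> (p ^ k) ^ card (edges J)"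
    if J: "simple_graph J" and d: "has_density p H (path_subdivision k J)" for J :: "'x sgraph"
  proof -
    have "hom_density (path_subdivision k J) (H n) = tden J (V n) (w n)" for n
      using hom_density_eq_tden[OF simple_graph_path_subdivision[OF J k], of "H n"] V
        tden_path_subdivision[OF J V k, of n "U n"]
      by (simp add: V_def[symmetric] U_eq w_def[abs_def] K_def[abs_def])
    then show ?thesis
      using d by (simp add: has_density_iff_tendsto[OF p(1)] card_edges_path_subdivision[OF J k] power_mult)
  qed
  have "cut_small V (\<lambda>n x y. w n {x, y} - p ^ k)"
    by (rule cut_small_of_forcing[OF forces FG _ V _ _ lim[OF FG(1) dens(1)] lim[OF FG(2) dens(2)]])
      (use p w mono in \<open>auto simp: V_def\<close>)
  moreover have "w n {x, y} = walk (V n) (K n) (k - 1) x y" for n x y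
    unfolding w_def by (rule Min_Max_pair_symmetric) (rule walk_symmetric, rule K)
  ultimately have "cut_small V (\<lambda>n x y. K n x y - p)"
    by (intro cut_small_walk_kernel[of K p "k - 1"]) (use K01 K p k in auto)
  then show "quasi_random p H"
    by (intro quasi_random_of_cut_small H p) (simp add: V_def[abs_def] U_def K_def)
qed

section \<open>Density 0\<close>

lemma tden_pos:
  assumes V: "finite V" and J: "simple_graph J" and w: "\<And>e. 0 \<le> w e"
    and \<phi>: "\<phi> \<in> verts J \<rightarrow>\<^sub>E V" "\<And>e. e \<in> edges J \<Longrightarrow> 0 < w (\<phi> ` e)"
  shows "0 < tden J V w"
proof -
  have fin: "finite (verts J \<rightarrow>\<^sub>E V)" using J V by (intro finite_PiE) (auto simp: simple_graph_def)
  have "0 < (\<Prod>e\<in>edges J. w (\<phi> ` e))" using \<phi>(2) by (intro prod_pos) auto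
  then have "0 < (\<Sum>\<phi>\<in>verts J \<rightarrow>\<^sub>E V. \<Prod>e\<in>edges J. w (\<phi> ` e))"
    using fin \<phi>(1) w by (intro sum_pos2[of _ \<phi>] prod_nonneg) auto
  moreover have "card (verts J \<rightarrow>\<^sub>E V) > 0" using fin \<phi>(1) by (auto simp: card_gt_0_iff)
  ultimately show ?thesis unfolding tden_def avg_def mean_def by simp
qed

lemma hom_density_no_edges:
  assumes "simple_graph J" "edges J = {}" "finite (verts H)" "verts H \<noteq> {}"
  shows "hom_density J H = 1"
proof -
  have "finite (verts J \<rightarrow>\<^sub>E verts H)" "verts J \<rightarrow>\<^sub>E verts H \<noteq> {}"
    using assms by (auto simp: simple_graph_def finite_PiE PiE_eq_empty_iff)
  then show ?thesis
    using assms by (simp add: hom_density_eq_tden tden_def avg_def mean_const)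
qed

lemma has_density_no_edges:
  assumes "simple_graph J" "edges J = {}" "\<And>n. finite (verts (H n))" "\<And>n. verts (H n) \<noteq> {}"
  shows "has_density p H J"
  using assms by (simp add: has_density_def hom_density_no_edges)

lemma has_density_zero_iff:
  assumes "card (edges J) \<noteq> 0"
  shows "has_density 0 H J \<longleftrightarrow> (\<forall>\<^sub>F n in sequentially. hom_density J (H n) = 0)"
  using assms by (simp add: has_density_def asymp_equiv_0_right_iff power_0_left)

definition two_colouring :: "'a sgraph \<Rightarrow> ('a \<Rightarrow> bool) \<Rightarrow> bool" where
  "two_colouring F c \<longleftrightarrow> (\<forall>u v. {u, v} \<in> edges F \<longrightarrow> c u \<noteq> c v)"

text \<open>Otherwise complete bipartite graphs would refute forcing at density \<open>0\<close>.\<close>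

lemma forces_at_zero_bipartite:
  assumes FG: "simple_graph F" "simple_graph G" and forces: "forces_at 0 F G"
  shows "(edges F \<noteq> {} \<and> (\<exists>c. two_colouring F c)) \<or> (edges G \<noteq> {} \<and> (\<exists>c. two_colouring G c))"
proof -
  \<comment> \<open>Complete bipartite graphs between the even and the odd numbers; the parity of
    the image of a homomorphism is a two-colouring.\<close>
  define H :: "nat \<Rightarrow> nat sgraph" where
    "H n = \<lparr>verts = {..<n + 2}, edges = {{a, b} | a b. a < n + 2 \<and> b < n + 2 \<and> even a \<and> odd b}\<rparr>" for n
  have edge_H: "{x, y} \<in> edges (H n) \<Longrightarrow> even x \<longleftrightarrow> odd y" for x y n
    unfolding H_def by (auto simp: doubleton_eq_iff)
  have sg: "simple_graph (H n)" for n
    unfolding simple_graph_def H_def by (auto simp: card_2_iff)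
  have V: "finite (verts (H n))" "verts (H n) \<noteq> {}" for n by (auto simp: H_def)
  have bip: "edges J \<noteq> {} \<and> (\<exists>c. two_colouring J c)" if J: "simple_graph J" and "\<not> has_density 0 H J" for J :: "'x sgraph"
  proof -
    \<comment> \<open>An edgeless graph has density 1, which is \<open>0 ^ 0\<close>, and so never
      violates the density condition.\<close>
    have ne: "edges J \<noteq> {}" using has_density_no_edges[where H = H, OF J _ V] that(2) by blast
    then have "card (edges J) \<noteq> 0" using finite_edges[OF J] by simp
    then have "\<not> (\<forall>\<^sub>F n in sequentially. hom_density J (H n) = 0)"
      using that(2) has_density_zero_iff by blast
    then obtain n where "hom_density J (H n) \<noteq> 0" by (metis (mono_tags) always_eventually)
    then have "graph_homs J (H n) \<noteq> {}" by (auto simp: hom_density_def)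
    then obtain \<phi> where "\<forall>u v. {u, v} \<in> edges J \<longrightarrow> {\<phi> u, \<phi> v} \<in> edges (H n)"
      by (auto simp: graph_homs_def)
    then have "two_colouring J (\<lambda>v. even (\<phi> v))" unfolding two_colouring_def using edge_H by blast
    then show ?thesis using ne by blast
  qed
  have "\<not> quasi_random 0 H"
  proof
    assume "quasi_random 0 H"
    then have "has_density 0 H edge_graph" using simple_small_graphs(1) by (simp add: quasi_random_def)
    then have "\<forall>\<^sub>F n in sequentially. hom_density edge_graph (H n) = 0"
      by (simp add: has_density_zero_iff card_edges_small_graphs)
    then obtain n where n: "hom_density edge_graph (H n) = 0"
      using eventually_happens trivial_limit_sequentially by blast
    have "{0, 1} \<in> edges (H n)"
      unfolding H_def by (simp, rule exI[of _ 0], rule exI[of _ "Suc 0"], simp)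
    then have "0 < tden edge_graph (verts (H n)) (\<lambda>e. of_bool (e \<in> edges (H n)))"
      by (intro tden_pos[where \<phi> = "restrict id {0, 1}"] simple_small_graphs(1))
        (auto simp: edge_graph_def H_def)
    then show False using n V simple_small_graphs(1) by (simp add: hom_density_eq_tden)
  qed
  moreover have "increasing_order H" by (auto simp: increasing_order_def H_def strict_mono_def)
  ultimately have "\<not> has_density 0 H F \<or> \<not> has_density 0 H G"
    using forces sg unfolding forces_at_def by blast
  then show ?thesis using bip[OF FG(1)] bip[OF FG(2)] by blast
qed

text \<open>The walk that alternates between \<open>a\<close> and \<open>b\<close> has
  \<open>Suc j\<close> edges, so it ends at \<open>b\<close> exactly when \<open>j\<close> is
  even.\<close>

lemma walk_alternating_pos:
  assumes V: "finite V" "a \<in> V" "b \<in> V" and U: "\<And>x y. 0 \<le> U x y" "0 < U a b" "0 < U b a"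
  shows "0 < walk V U j a (if even j then b else a)"
proof (induction j)
  case (Suc j)
  have nonneg: "0 \<le> walk V U i x y" for i x y
    by (induction i arbitrary: y) (auto intro!: mean_nonneg simp: U)
  let ?z = "if even j then b else a" and ?y = "if even (Suc j) then b else a"
  have "0 < walk V U j a ?z * U ?z ?y" using Suc.IH U by auto
  then have "0 < (\<Sum>z\<in>V. walk V U j a z * U z ?y)"
    using V nonneg U by (intro sum_pos2[of V ?z]) auto
  then show ?case using V by (auto simp: mean_def card_gt_0_iff intro!: divide_pos_pos)
qed (use U in simp)

text \<open>Every path of the subdivision is folded onto a single edge of \<open>H\<close>, starting
  from a suitable placement of the old vertices.\<close>

lemma hom_density_path_subdivision_pos:
  fixes H :: "nat sgraph"
  assumes F: "simple_graph F" "two_colouring F c" and k: "2 \<le> k"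
    and H: "simple_graph H" "edges H \<noteq> {}"
  shows "0 < hom_density (path_subdivision k F) H"
proof -
  obtain a b where ab: "{a, b} \<in> edges H" "a \<in> verts H" "b \<in> verts H"
    using H edge_pair[OF H(1)] by (metis ex_in_conv)
  have V: "finite (verts H)" "verts H \<noteq> {}" using H ab by (auto simp: simple_graph_def)
  define K where "K x y = (of_bool ({x, y} \<in> edges H) :: real)" for x y
  define w where "w s = walk (verts H) K (k - 1) (Min s) (Max s)" for s
  have K: "K x y = K y x" for x y by (simp add: K_def insert_commute)
  have w: "w {x, y} = walk (verts H) K (k - 1) x y" for x y
    unfolding w_def by (rule Min_Max_pair_symmetric) (rule walk_symmetric, rule K)
  have w01: "0 \<le> w s" for s
    unfolding w_def using walk_range[of K] by (simp add: K_def)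
  have pos: "0 < w {a, if even (k - 1) then b else a}"
    unfolding w by (rule walk_alternating_pos) (use V ab in \<open>auto simp: K_def insert_commute\<close>)
  \<comment> \<open>For odd \<open>k\<close> a folded path joins opposite ends, so the colour
    classes go to \<open>a\<close> and \<open>b\<close>; for even \<open>k\<close> it returns to its
    start, so all old vertices go to \<open>a\<close>.\<close>
  define \<phi> where "\<phi> = restrict (\<lambda>v. if even (k - 1) \<and> c v then b else a) (verts F)"
  have "0 < tden F (verts H) w"
  proof (rule tden_pos[OF V(1) F(1) w01])
    show "\<phi> \<in> verts F \<rightarrow>\<^sub>E verts H" using ab by (auto simp: \<phi>_def)
    fix e assume e: "e \<in> edges F"
    then obtain u v where uv: "e = {u, v}" "u \<in> verts F" "v \<in> verts F" using edge_pair[OF F(1)] by metis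
    then have "c u \<noteq> c v" using F(2) e by (simp add: two_colouring_def)
    then have "\<phi> ` e = {a, if even (k - 1) then b else a}"
      using uv by (auto simp: \<phi>_def)
    then show "0 < w (\<phi> ` e)" using pos by simp
  qed
  also have "tden F (verts H) w = hom_density (path_subdivision k F) H"
    using hom_density_eq_tden[OF simple_graph_path_subdivision[OF F(1) k] V(1)]
      tden_path_subdivision[OF F(1) V k, of "\<lambda>e. of_bool (e \<in> edges H)"]
    by (simp add: w_def[abs_def] K_def[abs_def])
  finally show ?thesis .
qed

text \<open>One of \<open>F\<close> and \<open>G\<close> is bipartite with an edge. Its subdivision
  has positive density in every graph with an edge, so the graphs of the sequence are eventually
  edgeless, which settles all densities.\<close>

lemma path_subdivision_forces_at_zero:
  assumes FG: "simple_graph F" "simple_graph G" and k: "2 \<le> k" and forces: "forces_at 0 F G"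
  shows "forces_at 0 (path_subdivision k F) (path_subdivision k G)"
proof (rule forces_at_nonemptyI)
  fix H :: "nat \<Rightarrow> nat sgraph"
  assume H: "\<And>n. simple_graph (H n)" "\<And>n. verts (H n) \<noteq> {}"
    and dens: "has_density 0 H (path_subdivision k F)" "has_density 0 H (path_subdivision k G)"
  have fin: "finite (verts (H n))" for n using H by (simp add: simple_graph_def)
  have edgeless: "\<forall>\<^sub>F n in sequentially. edges (H n) = {}"
    if J: "simple_graph J" "edges J \<noteq> {}" "two_colouring J c" and d: "has_density 0 H (path_subdivision k J)"
    for J :: "'x sgraph" and c
  proof -
    have "card (edges (path_subdivision k J)) \<noteq> 0"
      using J k finite_edges[OF J(1)] by (simp add: card_edges_path_subdivision[OF J(1) k])
    then have "\<forall>\<^sub>F n in sequentially. hom_density (path_subdivision k J) (H n) = 0"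
      using d has_density_zero_iff by blast
    then show ?thesis
      by eventually_elim (use hom_density_path_subdivision_pos[OF J(1,3) k H(1)] in force)
  qed
  have empty: "\<forall>\<^sub>F n in sequentially. edges (H n) = {}"
    using forces_at_zero_bipartite[OF FG forces] edgeless[OF FG(1) _ _ dens(1)] edgeless[OF FG(2) _ _ dens(2)] by blast
  show "quasi_random 0 H"
    unfolding quasi_random_def
  proof (intro allI impI)
    fix J :: "nat sgraph" assume J: "simple_graph J"
    show "has_density 0 H J"
    proof (cases "edges J = {}")
      case True
      then show ?thesis by (rule has_density_no_edges[OF J _ fin H(2)])
    next
      case False
      then obtain u v where uv: "{u, v} \<in> edges J" using edge_pair[OF J] by (metis ex_in_conv)
      have "\<forall>\<^sub>F n in sequentially. hom_density J (H n) = 0"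
        using empty
      proof eventually_elim
        case (elim n)
        then have "graph_homs J (H n) = {}" using uv by (auto simp: graph_homs_def)
        then show ?case by (simp add: hom_density_def)
      qed
      then show ?thesis
        using False finite_edges[OF J] by (simp add: has_density_zero_iff)
    qed
  qed
qed

text \<open>Density 0 is left out of the triangle part because it fails for graphs with edges, as
  \<open>K3_subdivision_not_forces_at_0\<close> shows.\<close>

theorem theorem1p4:
  fixes F :: "'a sgraph" and G :: "'b sgraph"
  assumes "simple_graph F" and "simple_graph G"
    and "forcing_pair F G"
  shows "(\<forall>p. 0 < p \<and> p \<le> 1 \<longrightarrow> forces_at p (K3_subdivision F) (K3_subdivision G)) \<and>
         (\<forall>k\<ge>2. forcing_pair (path_subdivision k F) (path_subdivision k G))"
proof (intro conjI allI impI)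
  \<comment> \<open>Powers of \<open>p\<close> stay in \<open>[0, 1]\<close>. The exponent is 3 for
    triangles and \<open>k\<close> for paths; exponent 1 serves \<open>p = 0\<close>.\<close>
  have forces: "forces_at (p ^ k) F G" if "0 \<le> p" "p \<le> 1" for p k
    using assms(3) that by (simp add: forcing_pair_def power_le_one)
  show "forces_at p (K3_subdivision F) (K3_subdivision G)" if "0 < p \<and> p \<le> 1" for p
    using that forces[of p 3] by (intro K3_subdivision_forces_at assms) auto
  fix k :: nat assume k: "2 \<le> k"
  show "forcing_pair (path_subdivision k F) (path_subdivision k G)"
    unfolding forcing_pair_def
  proof (intro allI impI)
    fix p :: real assume p: "0 \<le> p \<and> p \<le> 1"
    show "forces_at p (path_subdivision k F) (path_subdivision k G)"
    proof (cases "p = 0")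
      case True
      then show ?thesis
        using path_subdivision_forces_at_zero[OF assms(1,2) k] forces[of 0 1] by simp
    next
      case False
      then show ?thesis
        using p k forces[of p k] by (intro path_subdivision_forces_at_pos assms) auto
    qed
  qed
qed

end
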